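(* Let $G$ be a group with finite symmetric generating set $Y$, and let $C_2*C_2=\langle b_1,b_2\mid b_1^2,b_2^2\rangle$ have generating set $X=\{b_1,b_2\}$. Then the conjugacy growth series of $(G\wr(C_2*C_2),\vec Y)$ is $$\begin{aligned}\tilde\sigma_{(G\wr(C_2*C_2),\vec Y)}(z)=\;&\sum_{r\ge1}\frac{\phi(r)}{r}\sum_{s\ge1}\frac{z^{2rs}\,\sigma_{(G,Y)}(z^r)^{2s}}{s}+2z\,\tilde\sigma_{(G,Y)}(z)\,\frac{1-z^2}{1-z^2\tilde\sigma_{(G,Y)}(z)}\\&+\tilde\sigma_{(G,Y)}(z)+z^2\bigl(1+z^2\tilde\sigma_{(G,Y)}(z)\bigr)\frac{\bigl(\tilde\sigma_{(G,Y)}(z)-1\bigr)^2}{1-z^4\tilde\sigma_{(G,Y)}(z)^2}+z^2\,\frac{\tilde\sigma_{(G,Y)}(z^2)-1}{1-z^4\tilde\sigma_{(G,Y)}(z^2)},\end{aligned}$$ where $\phi$ is Euler's totient function.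
   Context: Wreath product. Let $L=C_2*C_2$, and let $e,e'$ be the neutral elements of $G,L$. $G\wr L=\bigl(\bigoplus_{i\in L}G\bigr)\rtimes L$ with product $(\eta,m)(\theta,n)=(\eta\theta^m,mn)$, where $\theta^m(i)=\theta(m^{-1}i)$. For $g\in G$, $\vec g\in\bigoplus_{i\in L}G$ has value $g$ at $e'$ and $e$ elsewhere. The generating set is $\vec Y=\{(\vec e,x):x\in X\}\cup\{(\vec y,e'):y\in Y\}$. Growth series. For a group $H$ with finite symmetric generating set $Z$, $|h|_Z$ is the word length. The standard growth series is $\sigma_{(H,Z)}(z)=\sum_{n\ge0}\#\{h\in H:|h|_Z=n\}z^n$. The length of a conjugacy class is the minimum of $|h|_Z$ over its elements $h$; the conjugacy growth series $\tilde\sigma_{(H,Z)}(z)$ has as coefficient of $z^n$ the number of conjugacy classes of $H$ of length $n$. *)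

theory Defs
  imports
    "HOL-Algebra.Product_Groups"
    "HOL-Algebra.Group_Action"
    "HOL-Computational_Algebra.Formal_Power_Series"
    "HOL-Number_Theory.Totient"
begin

section \<open>Groups given by generators and relators\<close>

text \<open>A letter \<open>(x, True)\<close> stands for the generator \<open>x\<close> and \<open>(x, False)\<close> for its formal inverse.\<close>

type_synonym 'x word = "('x \<times> bool) list"

inductive pres_eq :: "'x word set \<Rightarrow> 'x word \<Rightarrow> 'x word \<Rightarrow> bool" for R :: "'x word set" where
  cancel: "pres_eq R [(x, s), (x, \<not> s)] []"
| relator: "r \<in> R \<Longrightarrow> pres_eq R r []"
| subst_word: "pres_eq R u v \<Longrightarrow> pres_eq R (p @ u @ q) (p @ v @ q)"
| refl: "pres_eq R u u"
| sym: "pres_eq R u v \<Longrightarrow> pres_eq R v u"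
| trans: "pres_eq R u v \<Longrightarrow> pres_eq R v w \<Longrightarrow> pres_eq R u w"

definition pres_class :: "'x word set \<Rightarrow> 'x word \<Rightarrow> 'x word set" where
  "pres_class R u = {v. pres_eq R u v}"

definition presented_group :: "'x word set \<Rightarrow> 'x word set monoid" where
  "presented_group R =
    \<lparr>carrier = range (pres_class R),
     monoid.mult = (\<lambda>A B. {w. \<exists>u\<in>A. \<exists>v\<in>B. pres_eq R (u @ v) w}),
     one = pres_class R []\<rparr>"

lemma pres_class_eq_iff: "pres_class R u = pres_class R v \<longleftrightarrow> pres_eq R u v"
  unfolding pres_class_def by (blast intro: pres_eq.refl pres_eq.sym pres_eq.trans)

lemma pres_eq_append:
  assumes "pres_eq R u u'" "pres_eq R v v'"
  shows "pres_eq R (u @ v) (u' @ v')"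
proof -
  have "pres_eq R (u @ v) (u' @ v)" using pres_eq.subst_word[OF assms(1), of "[]" v] by simp
  moreover have "pres_eq R (u' @ v) (u' @ v')" using pres_eq.subst_word[OF assms(2), of u' "[]"] by simp
  ultimately show ?thesis by (rule pres_eq.trans)
qed

lemma mult_presented_group:
  "pres_class R u \<otimes>\<^bsub>presented_group R\<^esub> pres_class R v = pres_class R (u @ v)"
  unfolding presented_group_def pres_class_def
  by (auto intro: pres_eq.refl pres_eq.trans pres_eq_append)

lemma carrier_presented_group: "carrier (presented_group R) = range (pres_class R)"
  and one_presented_group: "\<one>\<^bsub>presented_group R\<^esub> = pres_class R []"
  by (simp_all add: presented_group_def)

definition word_inv :: "'x word \<Rightarrow> 'x word" where
  "word_inv u = rev (map (\<lambda>(x, s). (x, \<not> s)) u)"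

lemma pres_eq_word_inv: "pres_eq R (word_inv u @ u) []"
proof (induction u)
  case (Cons a u)
  obtain x s where a: "a = (x, s)" by (cases a)
  have "pres_eq R (word_inv u @ [(x, \<not> s), (x, \<not> \<not> s)] @ u) (word_inv u @ [] @ u)"
    by (intro pres_eq.subst_word pres_eq.cancel)
  with Cons show ?case
    by (auto simp: word_inv_def a intro: pres_eq.trans)
qed (simp add: word_inv_def pres_eq.refl)

lemma group_presented_group: "group (presented_group R)"
proof (rule groupI)
  fix A assume "A \<in> carrier (presented_group R)"
  then obtain u where A: "A = pres_class R u" by (auto simp: carrier_presented_group)
  show "\<exists>B\<in>carrier (presented_group R). B \<otimes>\<^bsub>presented_group R\<^esub> A = \<one>\<^bsub>presented_group R\<^esub>"
    by (rule bexI[of _ "pres_class R (word_inv u)"])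
      (auto simp: A mult_presented_group one_presented_group carrier_presented_group
        pres_class_eq_iff pres_eq_word_inv)
qed (auto simp: carrier_presented_group mult_presented_group one_presented_group)

datatype c2c2_gen = b1 | b2

definition c2_free_c2 :: "c2c2_gen word set monoid" where
  "c2_free_c2 = presented_group {[(b, True), (b, True)] | b. b \<in> {b1, b2}}"

definition c2_free_c2_gens :: "c2c2_gen word set set" where
  "c2_free_c2_gens =
    {pres_class {[(b, True), (b, True)] | b. b \<in> {b1, b2}} [(b, True)] | b. b \<in> {b1, b2}}"

section \<open>Restricted wreath products\<close>

definition wreath_shift :: "('l, 'n) monoid_scheme \<Rightarrow> 'l \<Rightarrow> ('l \<Rightarrow> 'g) \<Rightarrow> 'l \<Rightarrow> 'g" where
  "wreath_shift L m \<theta> = (\<lambda>i\<in>carrier L. \<theta> (inv\<^bsub>L\<^esub> m \<otimes>\<^bsub>L\<^esub> i))"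

definition wreath ::
    "('g, 'm) monoid_scheme \<Rightarrow> ('l, 'n) monoid_scheme \<Rightarrow> (('l \<Rightarrow> 'g) \<times> 'l) monoid" where
  "wreath G L = (let S = sum_group (carrier L) (\<lambda>_. G) in
    \<lparr>carrier = carrier S \<times> carrier L,
     monoid.mult = (\<lambda>(\<eta>, m) (\<theta>, n). (\<eta> \<otimes>\<^bsub>S\<^esub> wreath_shift L m \<theta>, m \<otimes>\<^bsub>L\<^esub> n)),
     one = (\<one>\<^bsub>S\<^esub>, \<one>\<^bsub>L\<^esub>)\<rparr>)"

definition lamp ::
    "('g, 'm) monoid_scheme \<Rightarrow> ('l, 'n) monoid_scheme \<Rightarrow> 'g \<Rightarrow> 'l \<Rightarrow> 'g" where
  "lamp G L g = (\<lambda>i\<in>carrier L. if i = \<one>\<^bsub>L\<^esub> then g else \<one>\<^bsub>G\<^esub>)"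

definition wreath_gens ::
    "('g, 'm) monoid_scheme \<Rightarrow> ('l, 'n) monoid_scheme \<Rightarrow> 'g set \<Rightarrow> 'l set \<Rightarrow> (('l \<Rightarrow> 'g) \<times> 'l) set" where
  "wreath_gens G L Y X = {(lamp G L \<one>\<^bsub>G\<^esub>, x) | x. x \<in> X} \<union> {(lamp G L y, \<one>\<^bsub>L\<^esub>) | y. y \<in> Y}"

lemma wreath_shift_closed:
  assumes "group G" "group L" "m \<in> carrier L" "\<theta> \<in> carrier (sum_group (carrier L) (\<lambda>_. G))"
  shows "wreath_shift L m \<theta> \<in> carrier (sum_group (carrier L) (\<lambda>_. G))"
proof -
  interpret L: group L by fact
  have \<theta>: "\<theta> \<in> carrier L \<rightarrow>\<^sub>E carrier G" "finite {i \<in> carrier L. \<theta> i \<noteq> \<one>\<^bsub>G\<^esub>}"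
    using assms by (auto simp: carrier_sum_group)
  have "{i \<in> carrier L. wreath_shift L m \<theta> i \<noteq> \<one>\<^bsub>G\<^esub>}
      \<subseteq> (\<lambda>i. m \<otimes>\<^bsub>L\<^esub> i) ` {i \<in> carrier L. \<theta> i \<noteq> \<one>\<^bsub>G\<^esub>}"
  proof
    fix i assume i: "i \<in> {i \<in> carrier L. wreath_shift L m \<theta> i \<noteq> \<one>\<^bsub>G\<^esub>}"
    then have "i = m \<otimes>\<^bsub>L\<^esub> (inv\<^bsub>L\<^esub> m \<otimes>\<^bsub>L\<^esub> i)"
      using assms by (simp add: L.m_assoc[symmetric])
    with i assms show "i \<in> (\<lambda>i. m \<otimes>\<^bsub>L\<^esub> i) ` {i \<in> carrier L. \<theta> i \<noteq> \<one>\<^bsub>G\<^esub>}"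
      by (auto simp: wreath_shift_def intro!: image_eqI[where x = "inv\<^bsub>L\<^esub> m \<otimes>\<^bsub>L\<^esub> i"])
  qed
  then have "finite {i \<in> carrier L. wreath_shift L m \<theta> i \<noteq> \<one>\<^bsub>G\<^esub>}"
    using \<theta>(2) by (meson finite_imageI finite_subset)
  moreover have "wreath_shift L m \<theta> \<in> carrier L \<rightarrow>\<^sub>E carrier G"
    using \<theta>(1) assms by (auto simp: wreath_shift_def)
  ultimately show ?thesis using assms by (simp add: carrier_sum_group)
qed

lemma group_wreath:
  assumes "group G" "group L"
  shows "group (wreath G L)"
proof -
  interpret G: group G by fact
  interpret L: group L by fact
  define S where "S = sum_group (carrier L) (\<lambda>_. G)"
  interpret S: group S unfolding S_def using assms by simp
  note closed = wreath_shift_closed[OF assms, folded S_def]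
  have mult: "x \<otimes>\<^bsub>wreath G L\<^esub> y = (fst x \<otimes>\<^bsub>S\<^esub> wreath_shift L (snd x) (fst y), snd x \<otimes>\<^bsub>L\<^esub> snd y)" for x y
    by (simp add: wreath_def S_def Let_def split: prod.splits)
  have carr: "carrier (wreath G L) = carrier S \<times> carrier L"
    and one: "\<one>\<^bsub>wreath G L\<^esub> = (\<one>\<^bsub>S\<^esub>, \<one>\<^bsub>L\<^esub>)"
    by (simp_all add: wreath_def S_def Let_def)
  have ext: "f \<in> carrier L \<rightarrow>\<^sub>E carrier G" if "f \<in> carrier S" for f
    using that by (auto simp: S_def carrier_sum_group assms)
  have shift_mult: "wreath_shift L m (f \<otimes>\<^bsub>S\<^esub> g) = wreath_shift L m f \<otimes>\<^bsub>S\<^esub> wreath_shift L m g"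
    if "m \<in> carrier L" for m f g
    using that by (auto simp: wreath_shift_def S_def fun_eq_iff)
  have shift_shift: "wreath_shift L m (wreath_shift L n f) = wreath_shift L (m \<otimes>\<^bsub>L\<^esub> n) f"
    if "m \<in> carrier L" "n \<in> carrier L" for m n f
    using that by (auto simp: wreath_shift_def fun_eq_iff L.inv_mult_group L.m_assoc)
  have shift_one: "wreath_shift L \<one>\<^bsub>L\<^esub> f = f" if "f \<in> carrier S" for f
    using ext[OF that] by (auto simp: wreath_shift_def fun_eq_iff PiE_def extensional_def)
  show ?thesis
  proof (rule groupI)
    fix x assume x: "x \<in> carrier (wreath G L)"
    let ?y = "(wreath_shift L (inv\<^bsub>L\<^esub> snd x) (inv\<^bsub>S\<^esub> fst x), inv\<^bsub>L\<^esub> snd x)"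
    have "?y \<otimes>\<^bsub>wreath G L\<^esub> x = \<one>\<^bsub>wreath G L\<^esub>"
    proof -
      have "wreath_shift L (inv\<^bsub>L\<^esub> snd x) (inv\<^bsub>S\<^esub> fst x) \<otimes>\<^bsub>S\<^esub> wreath_shift L (inv\<^bsub>L\<^esub> snd x) (fst x)
          = wreath_shift L (inv\<^bsub>L\<^esub> snd x) \<one>\<^bsub>S\<^esub>"
        using x by (subst shift_mult[symmetric]) (auto simp: carr)
      also have "\<dots> = \<one>\<^bsub>S\<^esub>"
        using x by (auto simp: carr wreath_shift_def S_def fun_eq_iff)
      finally show ?thesis using x by (auto simp: mult one carr)
    qed
    moreover have "?y \<in> carrier (wreath G L)" using x by (auto simp: carr closed)
    ultimately show "\<exists>y\<in>carrier (wreath G L). y \<otimes>\<^bsub>wreath G L\<^esub> x = \<one>\<^bsub>wreath G L\<^esub>" by blast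
  qed (auto simp: carr one mult closed shift_mult shift_shift shift_one S.m_assoc L.m_assoc)
qed

section \<open>Growth series\<close>

definition fin_sym_gen_set :: "('h, 'm) monoid_scheme \<Rightarrow> 'h set \<Rightarrow> bool" where
  "fin_sym_gen_set H Z \<longleftrightarrow>
    finite Z \<and> Z \<subseteq> carrier H \<and> (\<forall>z\<in>Z. inv\<^bsub>H\<^esub> z \<in> Z) \<and> generate H Z = carrier H"

definition word_length :: "('h, 'm) monoid_scheme \<Rightarrow> 'h set \<Rightarrow> 'h \<Rightarrow> nat" where
  "word_length H Z h =
    (LEAST n. \<exists>ws. length ws = n \<and> set ws \<subseteq> Z \<and> foldr (\<otimes>\<^bsub>H\<^esub>) ws \<one>\<^bsub>H\<^esub> = h)"

definition growth_series :: "('h, 'm) monoid_scheme \<Rightarrow> 'h set \<Rightarrow> rat fps" where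
  "growth_series H Z = Abs_fps (\<lambda>n. of_nat (card {h \<in> carrier H. word_length H Z h = n}))"

definition conj_classes :: "('h, 'm) monoid_scheme \<Rightarrow> 'h set set" where
  "conj_classes H = orbits H (carrier H) (\<lambda>g. \<lambda>h\<in>carrier H. g \<otimes>\<^bsub>H\<^esub> h \<otimes>\<^bsub>H\<^esub> inv\<^bsub>H\<^esub> g)"

definition class_length :: "('h, 'm) monoid_scheme \<Rightarrow> 'h set \<Rightarrow> 'h set \<Rightarrow> nat" where
  "class_length H Z C = (LEAST n. \<exists>h\<in>C. word_length H Z h = n)"

definition conj_growth_series :: "('h, 'm) monoid_scheme \<Rightarrow> 'h set \<Rightarrow> rat fps" where
  "conj_growth_series H Z = Abs_fps (\<lambda>n. of_nat (card {C \<in> conj_classes H. class_length H Z C = n}))"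

text \<open>
  Infinite sums of formal power series are taken in the topology of
  \<^theory>\<open>HOL-Computational_Algebra.Formal_Power_Series\<close> (coefficientwise eventual constancy).
  This criterion covers the double sum in the growth formula, where the inner series and
  its \<open>s\<close>-th term are divisible by \<open>z ^ (2 * r)\<close> and \<open>z ^ (2 * r * s)\<close> respectively.
\<close>

lemma fps_sums_of_low_coeffs_zero:
  fixes f :: "nat \<Rightarrow> 'a::ab_group_add fps"
  assumes "\<And>n k. k < n \<Longrightarrow> fps_nth (f n) k = 0"
  shows "f sums Abs_fps (\<lambda>k. \<Sum>n\<le>k. fps_nth (f n) k)"
  unfolding sums_def
proof (rule tendsto_fpsI)
  fix k
  show "\<forall>\<^sub>F N in sequentially. fps_nth (sum f {..<N}) k = fps_nth (Abs_fps (\<lambda>k. \<Sum>n\<le>k. fps_nth (f n) k)) k"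
    using eventually_gt_at_top[of k]
  proof eventually_elim
    case (elim N)
    have "(\<Sum>n<N. fps_nth (f n) k) = (\<Sum>n\<le>k. fps_nth (f n) k)"
      by (rule sum.mono_neutral_right) (use elim assms in auto)
    then show ?case by (simp add: fps_sum_nth)
  qed
qed

end

theory Submission
  imports Defs
    "HOL-Computational_Algebra.Formal_Laurent_Series"
begin

text \<open>
  The group \<open>L = C\<^sub>2 * C\<^sub>2\<close> is infinite dihedral, and its Cayley graph for \<open>b1, b2\<close> is a line.
  With the vertices of the line numbered by the integers, from \<open>0\<close> for the neutral element, \<open>1\<close> for \<open>b1\<close>
  and \<open>- 1\<close> for \<open>b2\<close>, the even integers act as translations and an odd integer \<open>p\<close> acts as the reflection
  \<open>i \<mapsto> p - i\<close> in the midpoint of an edge. So an element of the wreath product is a pair of a lamp configuration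
  \<open>f\<close>, a finitely supported function from the integers to \<open>G\<close>, and a cursor position \<open>p\<close>; a word for it
  is a walk from \<open>0\<close> to \<open>p\<close> that changes the lamps it passes.

  Conjugacy classes are sorted by the cursor. Conjugating by a lamp configuration with neutral cursor
  (\<open>base_conj\<close>) allows lamps to be pushed along the orbits of the cursor acting on the line
  (\<open>gather\<close>), and the remaining freedom comes from the cursor part of the conjugating element.

  If \<open>p\<close> is a nontrivial translation, conjugate to \<open>2 * n\<close> with \<open>n > 0\<close>, all lamps can be gathered in
  \<open>{0..<2 * n}\<close>, where they form a list of \<open>2 * n\<close> elements of \<open>G\<close>; the class is this list up to rotation
  by two places, and its length is \<open>2 * n\<close> plus the word lengths of the entries. Counting orbits of
  rotations with the Cauchy--Frobenius lemma gives the double sum with Euler's function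
  (\<open>conj_gf_translations\<close>).

  If \<open>p\<close> is a reflection, it is conjugate to exactly one of \<open>1\<close> and \<open>- 1\<close>, and all lamps can be gathered on one
  side of the axis. There each lamp matters only up to conjugacy in \<open>G\<close>. A shortest representative starts at the outermost
  lamp, walks to the axis, crosses it and walks back, so a class amounts to a list of conjugacy classes in
  which each step away from the axis costs two moves (\<open>conj_gf_refl_part\<close>, \<open>gf_rays\<close>). This happens twice.

  If \<open>p = 0\<close>, only the conjugacy class of each lamp matters, and the configuration of classes is taken up to
  the action of \<open>L\<close> on the line. A configuration whose support has minimum \<open>a\<close> and maximum \<open>b\<close> costs a closed
  walk of \<open>2 * (b - a)\<close> moves. The sum \<open>a + b\<close> can be moved to exactly one of \<open>0\<close>, \<open>1\<close> and \<open>- 1\<close>; its stabiliser is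
  trivial for \<open>0\<close>, and for \<open>1\<close> and \<open>- 1\<close> it reverses the configuration. The first kind gives lists of odd
  length, the other two give lists of even length up to reversal, again counted with the
  Cauchy--Frobenius lemma (\<open>conj_gf_id_part_0\<close>, \<open>conj_gf_id_part_odd\<close>, \<open>gf_reversal_classes\<close>).

  That these representatives are shortest follows from one invariant of words, \<open>cost_bound\<close>: it bounds
  the number of moves of a walk by the positions of the lamps that it leaves changed.
\<close>

section \<open>Generating functions of weighted sets\<close>

definition gf :: "'a set \<Rightarrow> ('a \<Rightarrow> nat) \<Rightarrow> rat fps" where
  "gf A w = Abs_fps (\<lambda>n. of_nat (card {a \<in> A. w a = n}))"

text \<open>
  The cardinality of an infinite set is \<open>0\<close>, so \<open>gf A w\<close> counts the elements of \<open>A\<close> only if every weight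
  is taken finitely often.
\<close>

definition fin_wt :: "'a set \<Rightarrow> ('a \<Rightarrow> nat) \<Rightarrow> bool" where
  "fin_wt A w \<longleftrightarrow> (\<forall>n. finite {a \<in> A. w a = n})"

lemma gf_nth: "fps_nth (gf A w) n = of_nat (card {a \<in> A. w a = n})"
  by (simp add: gf_def)

lemma fin_wt_subset: "fin_wt A w \<Longrightarrow> B \<subseteq> A \<Longrightarrow> fin_wt B w"
  unfolding fin_wt_def by (auto intro: finite_subset[of "{a \<in> B. w a = n}" "{a \<in> A. w a = n}" for n])

lemma fin_wt_le:
  assumes "fin_wt A w"
  shows "finite {a \<in> A. w a \<le> n}"
proof -
  have "{a \<in> A. w a \<le> n} = (\<Union>k\<le>n. {a \<in> A. w a = k})" by auto
  then show ?thesis using assms by (simp add: fin_wt_def)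
qed

lemma gf_cong:
  assumes "A = B" "\<And>a. a \<in> B \<Longrightarrow> w a = v a"
  shows "gf A w = gf B v"
proof -
  have "{a \<in> A. w a = n} = {a \<in> B. v a = n}" for n using assms by auto
  then show ?thesis by (simp add: gf_def)
qed

lemma
  assumes "bij_betw h A B" and "\<And>a. a \<in> A \<Longrightarrow> v (h a) = w a"
  shows gf_bij: "gf B v = gf A w" and fin_wt_bij: "fin_wt A w \<Longrightarrow> fin_wt B v"
proof -
  have *: "bij_betw h {a \<in> A. w a = n} {b \<in> B. v b = n}" for n
    using assms by (auto simp: bij_betw_def inj_on_def image_iff)
  show "gf B v = gf A w"
    by (rule fps_ext) (simp add: gf_nth bij_betw_same_card[OF *])
  show "fin_wt A w \<Longrightarrow> fin_wt B v"
    using bij_betw_finite[OF *] unfolding fin_wt_def by blast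
qed

lemma
  assumes "inj_on h A" and "\<And>a. a \<in> A \<Longrightarrow> v (h a) = w a"
  shows gf_image: "gf (h ` A) v = gf A w" and fin_wt_image: "fin_wt A w \<Longrightarrow> fin_wt (h ` A) v"
proof -
  have *: "bij_betw h A (h ` A)" using assms(1) by (rule inj_on_imp_bij_betw)
  show "gf (h ` A) v = gf A w" by (rule gf_bij[OF *]) (rule assms(2))
  show "fin_wt A w \<Longrightarrow> fin_wt (h ` A) v" by (rule fin_wt_bij[OF *]) (rule assms(2))
qed

lemma gf_Un:
  assumes "fin_wt A w" "fin_wt B w" "A \<inter> B = {}"
  shows "gf (A \<union> B) w = gf A w + gf B w"
proof (rule fps_ext)
  fix n
  have "{a \<in> A \<union> B. w a = n} = {a \<in> A. w a = n} \<union> {a \<in> B. w a = n}" by auto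
  then show "fps_nth (gf (A \<union> B) w) n = fps_nth (gf A w + gf B w) n"
    using assms by (subst gf_nth, simp, subst card_Un_disjoint) (auto simp: fin_wt_def gf_nth)
qed

lemma fin_wt_Un: "fin_wt A w \<Longrightarrow> fin_wt B w \<Longrightarrow> fin_wt (A \<union> B) w"
  unfolding fin_wt_def by (auto simp: conj_disj_distribR Collect_disj_eq)

lemma gf_singleton: "gf {a} w = fps_X ^ w a"
proof (rule fps_ext)
  fix n
  have "{x \<in> {a}. w x = n} = (if w a = n then {a} else {})" by auto
  then show "fps_nth (gf {a} w) n = fps_nth (fps_X ^ w a) n"
    by (auto simp: gf_nth)
qed

lemma fin_wt_finite: "finite A \<Longrightarrow> fin_wt A w"
  by (simp add: fin_wt_def)

lemma gf_Diff_singleton: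
  assumes "fin_wt A w" "a \<in> A"
  shows "gf (A - {a}) w = gf A w - fps_X ^ w a"
proof -
  have "gf A w = gf ((A - {a}) \<union> {a}) w" using assms by (intro gf_cong) auto
  also have "\<dots> = gf (A - {a}) w + fps_X ^ w a"
    by (subst gf_Un) (auto simp: gf_singleton fin_wt_finite intro: fin_wt_subset[OF assms(1)])
  finally show ?thesis by simp
qed

lemma gf_shift: "gf A (\<lambda>a. w a + c) = fps_X ^ c * gf A w"
proof (rule fps_ext)
  fix n
  show "fps_nth (gf A (\<lambda>a. w a + c)) n = fps_nth (fps_X ^ c * gf A w) n"
  proof (cases "n < c")
    case True
    then have "{a \<in> A. w a + c = n} = {}" by auto
    with True show ?thesis by (simp add: gf_nth fps_X_power_mult_nth)
  next
    case False
    then have "{a \<in> A. w a + c = n} = {a \<in> A. w a = n - c}" by auto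
    with False show ?thesis by (simp add: gf_nth fps_X_power_mult_nth)
  qed
qed

lemma fin_wt_mono:
  assumes "fin_wt A w" "\<And>a. a \<in> A \<Longrightarrow> w a \<le> v a"
  shows "fin_wt A v"
  unfolding fin_wt_def
proof
  fix n
  have "{a \<in> A. v a = n} \<subseteq> {a \<in> A. w a \<le> n}" using assms(2) by auto
  then show "finite {a \<in> A. v a = n}" using fin_wt_le[OF assms(1)] by (rule finite_subset)
qed

lemma gf_scale:
  assumes "k > 0"
  shows "gf A (\<lambda>a. k * w a) = gf A w oo fps_X ^ k"
proof (rule fps_ext)
  fix n
  show "fps_nth (gf A (\<lambda>a. k * w a)) n = fps_nth (gf A w oo fps_X ^ k) n"
  proof (cases "k dvd n")
    case True
    then obtain m where "n = k * m" by auto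
    with assms show ?thesis by (simp add: gf_nth fps_nth_compose_X_power)
  next
    case False
    then have empty: "{a \<in> A. k * w a = n} = {}" by auto
    from False show ?thesis by (simp add: gf_nth fps_nth_compose_X_power empty del: Collect_empty_eq)
  qed
qed

lemma
  assumes "fin_wt A w" "fin_wt B v"
  shows gf_Times: "gf (A \<times> B) (\<lambda>(a, b). w a + v b) = gf A w * gf B v"
    and fin_wt_Times: "fin_wt (A \<times> B) (\<lambda>(a, b). w a + v b)"
proof -
  define P where "P n i = {a \<in> A. w a = i} \<times> {b \<in> B. v b = n - i}" for n i
  have fin: "finite (P n i)" for n i using assms by (simp add: P_def fin_wt_def)
  have eq: "{x \<in> A \<times> B. (\<lambda>(a, b). w a + v b) x = n} = (\<Union>i\<in>{0..n}. P n i)" for n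
    by (auto simp: P_def)
  show "fin_wt (A \<times> B) (\<lambda>(a, b). w a + v b)"
    unfolding fin_wt_def eq using fin by simp
  show "gf (A \<times> B) (\<lambda>(a, b). w a + v b) = gf A w * gf B v"
  proof (rule fps_ext)
    fix n
    have "card (\<Union>i\<in>{0..n}. P n i) = (\<Sum>i=0..n. card (P n i))"
      using fin by (subst card_UN_disjoint) (auto simp: P_def)
    then show "fps_nth (gf (A \<times> B) (\<lambda>(a, b). w a + v b)) n = fps_nth (gf A w * gf B v) n"
      by (simp only: gf_nth eq fps_mult_nth) (simp add: P_def card_cartesian_product)
  qed
qed

lemma
  assumes "fin_wt A w" "fin_wt B v" "inj_on h (A \<times> B)"
    and "\<And>a b. a \<in> A \<Longrightarrow> b \<in> B \<Longrightarrow> u (h (a, b)) = w a + v b"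
  shows gf_image_Times: "gf (h ` (A \<times> B)) u = gf A w * gf B v"
    and fin_wt_image_Times: "fin_wt (h ` (A \<times> B)) u"
proof -
  have *: "u (h x) = (\<lambda>(a, b). w a + v b) x" if "x \<in> A \<times> B" for x
    using that assms(4) by auto
  show "gf (h ` (A \<times> B)) u = gf A w * gf B v"
    unfolding gf_Times[OF assms(1,2), symmetric] using assms(3) * by (rule gf_image)
  show "fin_wt (h ` (A \<times> B)) u"
    using assms(3) * fin_wt_Times[OF assms(1,2)] by (rule fin_wt_image)
qed

abbreviation lwt :: "('a \<Rightarrow> nat) \<Rightarrow> 'a list \<Rightarrow> nat" where
  "lwt w xs \<equiv> sum_list (map w xs)"

text \<open>
  Lists over an alphabet are counted by splitting off the first letters, which gives a linear equation
  for their generating function instead of an infinite sum.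
\<close>

lemma geometric_eq:
  fixes F B :: "rat fps"
  assumes "F = 1 + B * F" "fps_nth B 0 = 0"
  shows "F = inverse (1 - B)"
proof -
  have "F - B * F = 1" by (subst (1) assms(1)) simp
  then have "F * (1 - B) = 1" by (simp add: right_diff_distrib mult.commute)
  then show ?thesis using fps_inverse_unique[of "1 - B" F] by (simp add: mult.commute)
qed

text \<open>
  Since letters have positive weight, a list of weight \<open>n\<close> has at most \<open>n\<close> letters, each of weight at
  most \<open>n\<close>.
\<close>

lemma fin_wt_lists:
  assumes "fin_wt A w" "\<And>a. a \<in> A \<Longrightarrow> w a > 0"
  shows "fin_wt (lists A) (lwt w)"
  unfolding fin_wt_def
proof
  fix n
  have "length xs \<le> lwt w xs \<and> set xs \<subseteq> {a \<in> A. w a \<le> lwt w xs}" if "xs \<in> lists A" for xs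
    using that
  proof (induction xs)
    case (Cons x xs)
    then show ?case using assms(2)[of x] by auto
  qed simp
  then have "{xs \<in> lists A. lwt w xs = n} \<subseteq> {xs. set xs \<subseteq> {a \<in> A. w a \<le> n} \<and> length xs \<le> n}"
    by blast
  then show "finite {xs \<in> lists A. lwt w xs = n}"
    using finite_lists_length_le[OF fin_wt_le[OF assms(1)]] finite_subset by blast
qed

lemma gf_lists:
  assumes fin: "fin_wt A w" and pos: "\<And>a. a \<in> A \<Longrightarrow> w a > 0"
  shows "gf (lists A) (lwt w) = inverse (1 - gf A w)"
proof (rule geometric_eq)
  let ?h = "\<lambda>(x, xs). x # xs"
  have eq: "lists A = {[]} \<union> ?h ` (A \<times> lists A)"
    by (auto simp: image_iff) (metis lists.cases in_listsI)
  have inj: "inj_on ?h (A \<times> lists A)" by (auto simp: inj_on_def)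
  note fl = fin_wt_lists[OF fin pos]
  have "gf (lists A) (lwt w) = gf {[]} (lwt w) + gf (?h ` (A \<times> lists A)) (lwt w)"
    by (subst (1) eq, rule gf_Un)
      (use fin_wt_image_Times[OF fin fl inj, of "lwt w"] in \<open>auto intro: fin_wt_finite\<close>)
  also have "gf (?h ` (A \<times> lists A)) (lwt w) = gf A w * gf (lists A) (lwt w)"
    by (rule gf_image_Times[OF fin fl inj]) auto
  also have "gf {[]} (lwt w) = 1" by (simp add: gf_singleton)
  finally show "gf (lists A) (lwt w) = 1 + gf A w * gf (lists A) (lwt w)" .
  have "{a \<in> A. w a = 0} = {}" using pos by fastforce
  then show "fps_nth (gf A w) 0 = 0" by (simp add: gf_nth del: Collect_empty_eq)
qed

lemma
  assumes fin: "fin_wt A w"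
  shows gf_lists_length: "gf {xs \<in> lists A. length xs = n} (lwt w) = gf A w ^ n"
    and fin_wt_lists_length: "fin_wt {xs \<in> lists A. length xs = n} (lwt w)"
proof (induction n)
  case 0
  have eq: "{xs \<in> lists A. length xs = 0} = {[]}" by auto
  { case 1 show ?case unfolding eq by (simp add: gf_singleton) }
  { case 2 show ?case unfolding eq by (simp add: fin_wt_finite) }
next
  case (Suc n)
  let ?h = "\<lambda>(x, xs). x # xs" and ?L = "\<lambda>n. {xs \<in> lists A. length xs = n}"
  have eq: "?L (Suc n) = ?h ` (A \<times> ?L n)"
    by (auto simp: image_iff length_Suc_conv)
  have inj: "inj_on ?h (A \<times> ?L n)" by (auto simp: inj_on_def)
  { case 1 show ?case unfolding eq
      by (subst gf_image_Times[OF fin Suc(2) inj]) (simp_all add: Suc(1)) }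
  { case 2 show ?case unfolding eq
      by (rule fin_wt_image_Times[OF fin Suc(2) inj]) simp }
qed

section \<open>Orbits of a permutation and rotations of lists\<close>

definition iterate_rel :: "'a set \<Rightarrow> ('a \<Rightarrow> 'a) \<Rightarrow> ('a \<times> 'a) set" where
  "iterate_rel S f = {(x, y). x \<in> S \<and> y \<in> S \<and> (\<exists>k. y = (f ^^ k) x)}"

lemma funpow_mod_period:
  assumes "(f ^^ n) x = x"
  shows "(f ^^ k) x = (f ^^ (k mod n)) x"
proof -
  have "(f ^^ (n * j)) x = x" for j
    by (induction j) (simp_all add: funpow_add assms)
  then have "(f ^^ (k mod n + n * (k div n))) x = (f ^^ (k mod n)) x"
    by (simp only: funpow_add comp_apply)
  moreover have "k mod n + n * (k div n) = k" by simp
  ultimately show ?thesis by metis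
qed

lemma iterate_rel_equiv:
  assumes "f ` S \<subseteq> S" "n > 0" "\<And>x. x \<in> S \<Longrightarrow> (f ^^ n) x = x"
  shows "equiv S (iterate_rel S f)"
proof (rule equivI)
  show "iterate_rel S f \<subseteq> S \<times> S" by (auto simp: iterate_rel_def)
  show "refl_on S (iterate_rel S f)"
    by (auto simp: refl_on_def iterate_rel_def intro!: exI[of _ 0])
  show "trans (iterate_rel S f)"
  proof (rule transI)
    fix x y z assume "(x, y) \<in> iterate_rel S f" "(y, z) \<in> iterate_rel S f"
    then obtain k l where "x \<in> S" "z \<in> S" "y = (f ^^ k) x" "z = (f ^^ l) y"
      by (auto simp: iterate_rel_def)
    then have "z = (f ^^ (l + k)) x" by (simp add: funpow_add)
    then show "(x, z) \<in> iterate_rel S f" using \<open>x \<in> S\<close> \<open>z \<in> S\<close> by (auto simp: iterate_rel_def)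
  qed
  show "sym (iterate_rel S f)"
  proof (rule symI, clarsimp simp: iterate_rel_def)
    fix x k assume x: "x \<in> S"
    have "(f ^^ (n - k mod n)) ((f ^^ k) x) = (f ^^ (n - k mod n + k mod n)) x"
      by (subst funpow_mod_period[OF assms(3)[OF x], of k]) (simp add: funpow_add)
    also have "\<dots> = x" using assms x by (simp add: less_imp_le)
    finally show "\<exists>j. x = (f ^^ j) ((f ^^ k) x)" by metis
  qed
qed

text \<open>
  The numbers \<open>k < n\<close> that move a fixed \<open>x0\<close> to \<open>x\<close> are a shift modulo \<open>n\<close> of those that fix \<open>x\<close>.
  Summing over the orbit therefore counts every \<open>k < n\<close> once.
\<close>

lemma burnside_orbit:
  assumes "f ` S \<subseteq> S" "n > 0" "\<And>x. x \<in> S \<Longrightarrow> (f ^^ n) x = x" "C \<in> S // iterate_rel S f"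
  shows "(\<Sum>x\<in>C. card {k. k < n \<and> (f ^^ k) x = x}) = n"
proof -
  have clos: "(f ^^ k) x \<in> S" if "x \<in> S" for k x
    using that assms(1) by (induction k) auto
  obtain x0 where x0: "x0 \<in> S" and C: "C = iterate_rel S f `` {x0}"
    using assms(4) by (auto elim: quotientE)
  have C_eq: "C = (\<lambda>k. (f ^^ k) x0) ` {..<n}"
  proof -
    have "\<exists>j<n. (f ^^ k) x0 = (f ^^ j) x0" for k
      using funpow_mod_period[OF assms(3)[OF x0], of k] assms(2) by (intro exI[of _ "k mod n"]) auto
    then show ?thesis using x0 clos by (fastforce simp: C iterate_rel_def)
  qed
  have finC: "finite C" by (simp add: C_eq)
  have inj: "(f ^^ j) x = (f ^^ j) y \<Longrightarrow> x = y" if "x \<in> S" "y \<in> S" "j < n" for j x y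
  proof -
    assume "(f ^^ j) x = (f ^^ j) y"
    then have "(f ^^ (n - j + j)) x = (f ^^ (n - j + j)) y" by (simp add: funpow_add)
    then show "x = y" using that assms(3) by simp
  qed
  have "card {k. k < n \<and> (f ^^ k) x = x} = card {k. k < n \<and> (f ^^ k) x0 = x}" if "x \<in> C" for x
  proof -
    obtain j where j: "j < n" "x = (f ^^ j) x0" using \<open>x \<in> C\<close> unfolding C_eq by blast
    have period: "(f ^^ (k mod n)) x0 = (f ^^ k) x0" for k
      using funpow_mod_period[OF assms(3)[OF x0]] by metis
    have fixiff: "(f ^^ k) x = x \<longleftrightarrow> (f ^^ k) x0 = x0" for k
    proof -
      have "(f ^^ k) x = (f ^^ j) ((f ^^ k) x0)"
        by (metis j(2) add.commute comp_apply funpow_add)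
      then show ?thesis using inj[OF clos[OF x0] x0 j(1)] j(2) by metis
    qed
    have "bij_betw (\<lambda>k. (k + j) mod n) {k. k < n \<and> (f ^^ k) x = x} {k. k < n \<and> (f ^^ k) x0 = x}"
    proof (rule bij_betwI[where g = "\<lambda>k. (k + (n - j)) mod n"])
      show "(\<lambda>k. (k + j) mod n) \<in> {k. k < n \<and> (f ^^ k) x = x} \<rightarrow> {k. k < n \<and> (f ^^ k) x0 = x}"
        using assms(2) by (auto simp: period j(2) funpow_add)
      show "(\<lambda>k. (k + (n - j)) mod n) \<in> {k. k < n \<and> (f ^^ k) x0 = x} \<rightarrow> {k. k < n \<and> (f ^^ k) x = x}"
      proof (rule funcsetI)
        fix k assume "k \<in> {k. k < n \<and> (f ^^ k) x0 = x}"
        then have "(f ^^ (n - j + k)) x0 = (f ^^ (n - j + j)) x0"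
          by (simp add: funpow_add j(2))
        then show "(k + (n - j)) mod n \<in> {k. k < n \<and> (f ^^ k) x = x}"
          using assms(2,3) x0 j(1) by (simp add: fixiff period add.commute)
      qed
    next
      fix a
      have *: "((a + c) mod n + d) mod n = a" if "a < n" "c + d = n" for c d
      proof -
        have "((a + c) mod n + d) mod n = (a + (c + d)) mod n"
          by (simp only: mod_add_left_eq add.assoc)
        then show ?thesis using that by simp
      qed
      show "a \<in> {k. k < n \<and> (f ^^ k) x = x} \<Longrightarrow> ((a + j) mod n + (n - j)) mod n = a"
        "a \<in> {k. k < n \<and> (f ^^ k) x0 = x} \<Longrightarrow> ((a + (n - j)) mod n + j) mod n = a"
        using j(1) *[of j "n - j"] *[of "n - j" j] by auto
    qed
    then show ?thesis by (rule bij_betw_same_card)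
  qed
  then have "(\<Sum>x\<in>C. card {k. k < n \<and> (f ^^ k) x = x}) = (\<Sum>x\<in>C. card {k. k < n \<and> (f ^^ k) x0 = x})"
    by simp
  also have "\<dots> = card (\<Union>x\<in>C. {k. k < n \<and> (f ^^ k) x0 = x})"
    using finC by (subst card_UN_disjoint) auto
  also have "(\<Union>x\<in>C. {k. k < n \<and> (f ^^ k) x0 = x}) = {..<n}"
    by (auto simp: C_eq)
  finally show ?thesis by simp
qed

text \<open>
  The weight of an orbit, for a weight that is constant on orbits.
\<close>

definition qwt :: "('a \<Rightarrow> nat) \<Rightarrow> 'a set \<Rightarrow> nat" where
  "qwt w C = w (SOME a. a \<in> C)"

lemma qwt_class:
  assumes "equiv A R" "\<And>a b. (a, b) \<in> R \<Longrightarrow> w a = w b" "C \<in> A // R" "a \<in> C"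
  shows "qwt w C = w a"
proof -
  have "(SOME a. a \<in> C) \<in> C" using assms(4) by (rule someI)
  then show ?thesis
    unfolding qwt_def using assms quotient_eq_iff[OF assms(1,3,3), of "SOME a. a \<in> C" a] by blast
qed

text \<open>
  The Cauchy--Frobenius lemma for the cyclic group of order \<open>n\<close> that acts through the iterates of \<open>f\<close>,
  applied in each weight separately.
\<close>

lemma gf_burnside:
  assumes f: "f ` A \<subseteq> A" "n > 0" "\<And>x. x \<in> A \<Longrightarrow> (f ^^ n) x = x"
    and w: "\<And>x. x \<in> A \<Longrightarrow> w (f x) = w x" and fin: "fin_wt A w"
  shows "of_nat n * gf (A // iterate_rel A f) (qwt w) = (\<Sum>k<n. gf {a \<in> A. (f ^^ k) a = a} w)"
proof (rule fps_ext)
  fix m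
  define S where "S = {a \<in> A. w a = m}"
  define Q where "Q = {C \<in> A // iterate_rel A f. qwt w C = m}"
  note eqv = iterate_rel_equiv[OF f]
  have wk: "(f ^^ k) x \<in> A \<and> w ((f ^^ k) x) = w x" if "x \<in> A" for k x
    using that f(1) w by (induction k) auto
  have wR: "w a = w b" if "(a, b) \<in> iterate_rel A f" for a b
    using that wk by (auto simp: iterate_rel_def)
  have qw: "qwt w C = w a" if "C \<in> A // iterate_rel A f" "a \<in> C" for C a
    using qwt_class[OF eqv wR that] .
  have finS: "finite S" using fin by (simp add: S_def fin_wt_def)
  have US: "\<Union>Q = S"
  proof (rule equalityI)
    show "\<Union>Q \<subseteq> S" using qw in_quotient_imp_subset[OF eqv] by (auto simp: Q_def S_def)
    show "S \<subseteq> \<Union>Q"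
    proof
      fix x assume x: "x \<in> S"
      then have "(x, x) \<in> iterate_rel A f" by (auto simp: S_def iterate_rel_def intro!: exI[of _ 0])
      then have "x \<in> iterate_rel A f `` {x}" "iterate_rel A f `` {x} \<in> A // iterate_rel A f"
        using x by (auto simp: S_def intro: quotientI)
      with x qw show "x \<in> \<Union>Q" by (auto simp: Q_def S_def intro!: exI[of _ "iterate_rel A f `` {x}"])
    qed
  qed
  have disj: "C \<inter> D = {}" if "C \<in> Q" "D \<in> Q" "C \<noteq> D" for C D
    using quotient_disj[OF eqv] that by (auto simp: Q_def)
  have finQ: "finite Q" and finC: "\<And>C. C \<in> Q \<Longrightarrow> finite C"
    using finS US by (metis finite_UnionD, metis finite_UnionD finS US Union_upper finite_subset)
  have "n * card Q = (\<Sum>C\<in>Q. n)" by simp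
  also have "\<dots> = (\<Sum>C\<in>Q. \<Sum>x\<in>C. card {k. k < n \<and> (f ^^ k) x = x})"
    using burnside_orbit[OF f] by (intro sum.cong) (auto simp: Q_def)
  also have "\<dots> = (\<Sum>x\<in>S. card {k. k < n \<and> (f ^^ k) x = x})"
    using sum.Union_disjoint[of Q "\<lambda>x. card {k. k < n \<and> (f ^^ k) x = x}"] disj finC US by simp
  also have "\<dots> = (\<Sum>x\<in>S. \<Sum>k<n. if (f ^^ k) x = x then 1 else 0)"
    by (intro sum.cong HOL.refl) (simp add: sum.If_cases Int_def lessThan_def)
  also have "\<dots> = (\<Sum>k<n. \<Sum>x\<in>S. if (f ^^ k) x = x then 1 else 0)"
    by (rule sum.swap)
  also have "\<dots> = (\<Sum>k<n. card {x \<in> {a \<in> A. (f ^^ k) a = a}. w x = m})"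
    using finS by (intro sum.cong HOL.refl)
      (auto simp: sum.If_cases Int_def S_def intro!: arg_cong[of _ _ card])
  finally have "of_nat (n * card Q) =
      (of_nat (\<Sum>k<n. card {x \<in> {a \<in> A. (f ^^ k) a = a}. w x = m}) :: rat)" by simp
  then show "fps_nth (of_nat n * gf (A // iterate_rel A f) (qwt w)) m =
      fps_nth (\<Sum>k<n. gf {a \<in> A. (f ^^ k) a = a} w) m"
    by (simp add: fps_sum_nth gf_nth Q_def fps_of_nat[symmetric])
qed

text \<open>
  By Bezout, \<open>gcd j n\<close> is a multiple of \<open>j\<close> modulo \<open>n\<close>, and rotation by \<open>n\<close> is the identity.
\<close>

lemma rotate_fixed_iff:
  assumes "length xs = n" "n > 0"
  shows "rotate j xs = xs \<longleftrightarrow> rotate (gcd j n) xs = xs"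
proof
  have mult: "rotate (a * b) xs = xs" if "rotate a xs = xs" for a b
    by (induction b) (simp_all add: that flip: rotate_rotate)
  assume "rotate (gcd j n) xs = xs"
  from mult[OF this, of "j div gcd j n"] show "rotate j xs = xs" by simp
next
  have mult: "rotate (a * b) xs = xs" if "rotate a xs = xs" for a b
    by (induction b) (simp_all add: that flip: rotate_rotate)
  assume j: "rotate j xs = xs"
  show "rotate (gcd j n) xs = xs"
  proof (cases "j = 0")
    case True
    then show ?thesis using assms by simp
  next
    case False
    then obtain x y where xy: "j * x = n * y + gcd j n" using bezout_nat[OF False] by blast
    have "rotate (gcd j n) xs = rotate (gcd j n) (rotate (n * y) xs)"
      using mult[of n y] assms by simp
    also have "\<dots> = rotate (j * x) xs" by (simp add: rotate_rotate xy add.commute)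
    also have "\<dots> = xs" by (rule mult[OF j])
    finally show ?thesis .
  qed
qed

lemma sum_list_periodic:
  assumes "g > (0::nat)"
  shows "(\<Sum>i<q * g. F (i mod g)) = q * (\<Sum>i<g. F i :: nat)"
proof -
  have "(\<Sum>i<q * g. F (i mod g)) = (\<Sum>m<q. \<Sum>i\<in>{m * g..<m * g + g}. F (i mod g))"
    by (rule sum.nat_group[symmetric])
  also have "\<dots> = (\<Sum>m<q. \<Sum>i<g. F i)"
  proof (rule sum.cong[OF HOL.refl])
    fix m
    have "(\<Sum>i\<in>{m * g..<m * g + g}. F (i mod g)) = (\<Sum>i\<in>{0..<g}. F ((i + m * g) mod g))"
      using sum.shift_bounds_nat_ivl[of "\<lambda>i. F (i mod g)" 0 "m * g" g] by (simp add: add.commute)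
    then show "(\<Sum>i\<in>{m * g..<m * g + g}. F (i mod g)) = (\<Sum>i<g. F i)"
      by (simp add: atLeast0LessThan)
  qed
  finally show ?thesis by simp
qed

lemma lwt_nth: "lwt w xs = (\<Sum>i<length xs. w (xs ! i))"
  by (simp add: sum_list_sum_nth atLeast0LessThan)

text \<open>
  A list fixed by a rotation is periodic with period \<open>gcd j n\<close>, so it is determined by its first
  \<open>gcd j n\<close> letters, each of which it repeats \<open>n div gcd j n\<close> times.
\<close>

lemma gf_rotate_fixed:
  fixes j n :: nat and A :: "'a set"
  assumes fin: "fin_wt A w" and n: "n > 0"
  defines "g \<equiv> gcd j n"
  shows "gf {xs \<in> {xs \<in> lists A. length xs = n}. rotate j xs = xs} (lwt w)
    = (gf A w oo fps_X ^ (n div g)) ^ g"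
proof -
  let ?B = "{ys \<in> lists A. length ys = g}"
  let ?h = "\<lambda>ys. map (\<lambda>i. ys ! (i mod g)) [0..<n]"
  have g: "g > 0" "g dvd n" using n by (auto simp: g_def)
  define q where "q = n div g"
  have nq: "n = q * g" "q > 0" "g \<le> n" using g n by (auto simp: q_def dvd_imp_le)
  have per: "xs ! i = xs ! (i mod g)" if xs: "length xs = n" "rotate g xs = xs" "i < n" for xs :: "'a list" and i
    using that(3)
  proof (induction i rule: less_induct)
    case (less i)
    show ?case
    proof (cases "i < g")
      case False
      then have "xs ! i = rotate g xs ! (i - g)"
        using less.prems xs(1) by (subst nth_rotate) auto
      also have "\<dots> = xs ! (i - g)" by (simp add: xs)
      also have "\<dots> = xs ! ((i - g) mod g)" using less.IH[of "i - g"] less.prems False g by simp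
      finally show ?thesis using False by (simp add: le_mod_geq)
    qed simp
  qed
  have bij: "bij_betw ?h ?B {xs \<in> {xs \<in> lists A. length xs = n}. rotate j xs = xs}"
  proof (rule bij_betwI[where g = "take g"])
    show "?h \<in> ?B \<rightarrow> {xs \<in> {xs \<in> lists A. length xs = n}. rotate j xs = xs}"
    proof
      fix ys assume ys: "ys \<in> ?B"
      have "rotate g (?h ys) = ?h ys"
      proof (rule nth_equalityI)
        fix i assume "i < length (rotate g (?h ys))"
        then have i: "i < n" by simp
        have "(i + g) mod n mod g = i mod g"
          using nq by (simp add: mod_mod_cancel g)
        then show "rotate g (?h ys) ! i = ?h ys ! i"
          using i n by (simp add: nth_rotate add.commute)
      qed simp
      then have "rotate j (?h ys) = ?h ys"
        using rotate_fixed_iff[of "?h ys" n j] n by (simp add: g_def)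
      moreover have "?h ys \<in> lists A" using ys g by (auto simp: in_lists_conv_set)
      ultimately show "?h ys \<in> {xs \<in> {xs \<in> lists A. length xs = n}. rotate j xs = xs}" by simp
    qed
    show "take g \<in> {xs \<in> {xs \<in> lists A. length xs = n}. rotate j xs = xs} \<rightarrow> ?B"
      using nq by (auto dest: in_set_takeD)
    show "take g (?h ys) = ys" if "ys \<in> ?B" for ys
      using that nq(3) by (intro nth_equalityI) (auto simp del: nq)
    show "?h (take g xs) = xs" if "xs \<in> {xs \<in> {xs \<in> lists A. length xs = n}. rotate j xs = xs}" for xs
    proof (rule nth_equalityI)
      fix i assume "i < length (?h (take g xs))"
      moreover have "rotate g xs = xs" using that rotate_fixed_iff[of xs n j] n by (simp add: g_def)
      ultimately show "?h (take g xs) ! i = xs ! i"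
        using that g per[of xs i] by simp
    qed (use that in simp)
  qed
  have wt: "lwt w (?h ys) = q * lwt w ys" if "ys \<in> ?B" for ys
  proof -
    have "lwt w (?h ys) = (\<Sum>i<q * g. w (ys ! (i mod g)))"
      by (simp add: lwt_nth nq)
    then show ?thesis using that sum_list_periodic[OF g(1), of "\<lambda>i. w (ys ! i)" q] by (simp add: lwt_nth)
  qed
  have "gf {xs \<in> {xs \<in> lists A. length xs = n}. rotate j xs = xs} (lwt w) = gf ?B (\<lambda>ys. q * lwt w ys)"
    using bij wt by (rule gf_bij)
  also have "\<dots> = (gf A w ^ g) oo fps_X ^ q"
    by (simp add: gf_scale nq gf_lists_length[OF fin])
  also have "\<dots> = (gf A w oo fps_X ^ q) ^ g"
    by (rule fps_compose_power[symmetric]) (use nq in \<open>simp add: fps_X_power_nth\<close>)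
  finally show ?thesis by (simp add: q_def)
qed

section \<open>Conjugacy classes and word length\<close>

text \<open>
  Conjugacy is stated without inverses, which keeps the later computations with lamp configurations
  free of the inverse in the wreath product.
\<close>

definition conj_rel :: "('h, 'm) monoid_scheme \<Rightarrow> 'h \<Rightarrow> 'h \<Rightarrow> bool" where
  "conj_rel H x y \<longleftrightarrow> x \<in> carrier H \<and> y \<in> carrier H \<and> (\<exists>g\<in>carrier H. g \<otimes>\<^bsub>H\<^esub> x = y \<otimes>\<^bsub>H\<^esub> g)"

definition conj_class :: "('h, 'm) monoid_scheme \<Rightarrow> 'h \<Rightarrow> 'h set" where
  "conj_class H x = {y. conj_rel H x y}"

definition conj_closed :: "('h, 'm) monoid_scheme \<Rightarrow> 'h set \<Rightarrow> bool" where
  "conj_closed H U \<longleftrightarrow> U \<subseteq> carrier H \<and> (\<forall>x\<in>U. \<forall>y. conj_rel H x y \<longrightarrow> y \<in> U)"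

text \<open>
  The part of the conjugacy growth series that comes from the classes inside a union \<open>U\<close> of classes.
\<close>

definition conj_gf :: "('h, 'm) monoid_scheme \<Rightarrow> 'h set \<Rightarrow> 'h set \<Rightarrow> rat fps" where
  "conj_gf H Z U = gf {C \<in> conj_classes H. C \<subseteq> U} (class_length H Z)"

lemma conj_relI:
  "g \<in> carrier H \<Longrightarrow> x \<in> carrier H \<Longrightarrow> y \<in> carrier H \<Longrightarrow> g \<otimes>\<^bsub>H\<^esub> x = y \<otimes>\<^bsub>H\<^esub> g \<Longrightarrow> conj_rel H x y"
  unfolding conj_rel_def by blast

lemma conj_closedD: "conj_closed H U \<Longrightarrow> x \<in> U \<Longrightarrow> conj_rel H x y \<Longrightarrow> y \<in> U"
  unfolding conj_closed_def by blast

context group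
begin

lemma conj_rel_refl: "x \<in> carrier G \<Longrightarrow> conj_rel G x x"
  by (rule conj_relI[of \<one>]) auto

lemma conj_rel_sym:
  assumes "conj_rel G x y"
  shows "conj_rel G y x"
proof -
  obtain g where g: "g \<in> carrier G" "x \<in> carrier G" "y \<in> carrier G" "g \<otimes> x = y \<otimes> g"
    using assms by (auto simp: conj_rel_def)
  then have "inv g \<otimes> y = inv g \<otimes> (y \<otimes> g) \<otimes> inv g" by (simp add: m_assoc)
  also have "\<dots> = x \<otimes> inv g" using g by (simp flip: g(4) m_assoc)
  finally show ?thesis using g by (intro conj_relI[of "inv g"]) auto
qed

lemma conj_rel_trans:
  assumes "conj_rel G x y" "conj_rel G y z"
  shows "conj_rel G x z"
proof -
  obtain g h where gh: "g \<in> carrier G" "h \<in> carrier G" "x \<in> carrier G" "y \<in> carrier G" "z \<in> carrier G"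
    "g \<otimes> x = y \<otimes> g" "h \<otimes> y = z \<otimes> h"
    using assms by (auto simp: conj_rel_def)
  have "h \<otimes> g \<otimes> x = h \<otimes> y \<otimes> g" using gh(1-6) by (simp add: m_assoc)
  also have "\<dots> = z \<otimes> h \<otimes> g" using gh by simp
  also have "\<dots> = z \<otimes> (h \<otimes> g)" using gh(1-5) by (simp add: m_assoc)
  finally show ?thesis using gh by (intro conj_relI[of "h \<otimes> g"]) auto
qed

lemma conj_class_self: "x \<in> carrier G \<Longrightarrow> x \<in> conj_class G x"
  by (simp add: conj_class_def conj_rel_refl)

lemma conj_class_eq_iff:
  assumes "x \<in> carrier G" "y \<in> carrier G"
  shows "conj_class G x = conj_class G y \<longleftrightarrow> conj_rel G x y"
  using assms conj_rel_refl conj_rel_sym conj_rel_trans unfolding conj_class_def by blast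

lemma conj_class_subset: "conj_class G x \<subseteq> carrier G"
  by (auto simp: conj_class_def conj_rel_def)

text \<open>
  The orbits of the conjugation action in the definition of \<^const>\<open>conj_classes\<close> are the classes of
  \<open>conj_rel\<close>.
\<close>

lemma conj_classes_eq: "conj_classes G = conj_class G ` carrier G"
proof -
  have "orbit G (\<lambda>g. \<lambda>h\<in>carrier G. g \<otimes> h \<otimes> inv g) x = conj_class G x" if x: "x \<in> carrier G" for x
  proof -
    have "y = g \<otimes> x \<otimes> inv g \<longleftrightarrow> y \<in> carrier G \<and> g \<otimes> x = y \<otimes> g" if "g \<in> carrier G" for g y
      using that x inv_solve_right[of y "g \<otimes> x" g] by auto
    then show ?thesis using x by (auto simp: orbit_def conj_class_def conj_rel_def)
  qed
  then show ?thesis by (auto simp: conj_classes_def orbits_def)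
qed

lemma conj_class_one: "conj_class G \<one> = {\<one>}"
  by (auto simp: conj_class_def conj_rel_def intro!: bexI[of _ \<one>])

lemma conj_class_eq_one_iff:
  assumes "x \<in> carrier G"
  shows "conj_class G x = {\<one>} \<longleftrightarrow> x = \<one>"
  using assms conj_class_one conj_class_self by auto

lemma conj_closed_class:
  "conj_closed G U \<Longrightarrow> x \<in> carrier G \<Longrightarrow> conj_class G x \<subseteq> U \<longleftrightarrow> x \<in> U"
  using conj_class_self[of x] conj_closedD[of G U x] by (auto simp: conj_class_def)

lemma conj_closed_classes:
  "conj_closed G U \<Longrightarrow> {C \<in> conj_classes G. C \<subseteq> U} = conj_class G ` U"
  using conj_closed_class[of U] unfolding conj_classes_eq conj_closed_def by blast

end

lemma word_length_le:
  assumes "set ws \<subseteq> Z" "foldr (\<otimes>\<^bsub>H\<^esub>) ws \<one>\<^bsub>H\<^esub> = h" "length ws \<le> n"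
  shows "word_length H Z h \<le> n"
proof -
  have "word_length H Z h \<le> length ws"
    unfolding word_length_def by (rule Least_le) (use assms in blast)
  with assms(3) show ?thesis by simp
qed

lemma class_length_le: "h \<in> C \<Longrightarrow> class_length H Z C \<le> word_length H Z h"
  unfolding class_length_def by (rule Least_le) blast

lemma class_length_attained:
  assumes "C \<noteq> {}"
  obtains h where "h \<in> C" "word_length H Z h = class_length H Z C"
  using LeastI_ex[of "\<lambda>n. \<exists>h\<in>C. word_length H Z h = n"] assms
  unfolding class_length_def by blast

locale marked_group = group G for G (structure) +
  fixes Z :: "'a set"
  assumes gens_closed: "Z \<subseteq> carrier G"
begin

text \<open>
  An upper bound for word length that composes: short words are built from shorter ones.
\<close>

definition spelled :: "nat \<Rightarrow> 'a \<Rightarrow> bool" where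
  "spelled n x \<longleftrightarrow> (\<exists>ws. set ws \<subseteq> Z \<and> foldr (\<otimes>) ws \<one> = x \<and> length ws \<le> n)"

lemma foldr_closed: "set ws \<subseteq> Z \<Longrightarrow> foldr (\<otimes>) ws \<one> \<in> carrier G"
  using gens_closed by (induction ws) auto

lemma foldr_append:
  assumes "set us \<subseteq> Z" "set vs \<subseteq> Z"
  shows "foldr (\<otimes>) (us @ vs) \<one> = foldr (\<otimes>) us \<one> \<otimes> foldr (\<otimes>) vs \<one>"
  using assms
proof (induction us)
  case (Cons u us)
  then have "u \<in> carrier G" "foldr (\<otimes>) us \<one> \<in> carrier G" "foldr (\<otimes>) vs \<one> \<in> carrier G"
    using gens_closed foldr_closed by auto
  with Cons show ?case by (simp add: m_assoc)
qed (simp add: foldr_closed)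

lemma spelled_mult:
  assumes "spelled m x" "spelled n y" "m + n \<le> k"
  shows "spelled k (x \<otimes> y)"
proof -
  obtain us vs where "set us \<subseteq> Z" "foldr (\<otimes>) us \<one> = x" "length us \<le> m"
    "set vs \<subseteq> Z" "foldr (\<otimes>) vs \<one> = y" "length vs \<le> n"
    using assms(1,2) unfolding spelled_def by blast
  then show ?thesis using assms(3) foldr_append[of us vs]
    unfolding spelled_def by (intro exI[of _ "us @ vs"]) auto
qed

lemma spelled_one: "spelled n \<one>"
  unfolding spelled_def by (rule exI[of _ "[]"]) simp

lemma spelled_gen: "z \<in> Z \<Longrightarrow> spelled 1 z"
  unfolding spelled_def using gens_closed by (intro exI[of _ "[z]"]) auto

lemma word_length_le_spelled: "spelled n x \<Longrightarrow> word_length G Z x \<le> n"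
  unfolding spelled_def by (elim exE conjE) (rule word_length_le)

end

text \<open>
  A finite generating set in the sense of monoids. This is all that the counting arguments use, and it
  can be verified for the wreath product by exhibiting words.
\<close>

locale gen_group = marked_group +
  assumes finite_gens: "finite Z" and words_exist: "x \<in> carrier G \<Longrightarrow> \<exists>n. spelled n x"
begin

lemma shortest_word:
  assumes "x \<in> carrier G"
  obtains ws where "set ws \<subseteq> Z" "foldr (\<otimes>) ws \<one> = x" "length ws = word_length G Z x"
  using LeastI_ex[of "\<lambda>n. \<exists>ws. length ws = n \<and> set ws \<subseteq> Z \<and> foldr (\<otimes>) ws \<one> = x"]
    words_exist[OF assms]
  unfolding word_length_def spelled_def by blast

lemma spelled_word_length: "x \<in> carrier G \<Longrightarrow> spelled (word_length G Z x) x"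
  using shortest_word[of x] unfolding spelled_def by (metis le_refl)

lemma word_length_mult:
  assumes "x \<in> carrier G" "y \<in> carrier G"
  shows "word_length G Z (x \<otimes> y) \<le> word_length G Z x + word_length G Z y"
  using assms by (intro word_length_le_spelled spelled_mult[OF spelled_word_length spelled_word_length]) auto

lemma word_length_one [simp]: "word_length G Z \<one> = 0"
  using word_length_le[of "[]" Z G \<one> 0] by simp

lemma fin_wt_word_length: "fin_wt (carrier G) (word_length G Z)"
  unfolding fin_wt_def
proof
  fix n
  have "{x \<in> carrier G. word_length G Z x = n}
      \<subseteq> (\<lambda>ws. foldr (\<otimes>) ws \<one>) ` {ws. set ws \<subseteq> Z \<and> length ws = n}"
  proof
    fix x assume "x \<in> {x \<in> carrier G. word_length G Z x = n}"
    then show "x \<in> (\<lambda>ws. foldr (\<otimes>) ws \<one>) ` {ws. set ws \<subseteq> Z \<and> length ws = n}"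
      using shortest_word[of x] by (auto simp: image_iff)
  qed
  then show "finite {x \<in> carrier G. word_length G Z x = n}"
    by (rule finite_subset) (simp add: finite_lists_length_eq finite_gens)
qed

definition min_rep :: "'a set \<Rightarrow> 'a" where
  "min_rep C = (SOME h. h \<in> C \<and> word_length G Z h = class_length G Z C)"

lemma min_rep:
  assumes "C \<in> conj_classes G"
  shows "min_rep C \<in> carrier G" "conj_class G (min_rep C) = C"
    "word_length G Z (min_rep C) = class_length G Z C"
proof -
  obtain x where x: "x \<in> carrier G" "C = conj_class G x"
    using assms by (auto simp: conj_classes_eq)
  then have "C \<noteq> {}" using conj_class_self by auto
  then obtain h where "h \<in> C" "word_length G Z h = class_length G Z C"
    using class_length_attained[of C G Z] by blast
  then have *: "min_rep C \<in> C \<and> word_length G Z (min_rep C) = class_length G Z C"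
    unfolding min_rep_def using someI[of "\<lambda>h. h \<in> C \<and> word_length G Z h = class_length G Z C" h] by blast
  then show "word_length G Z (min_rep C) = class_length G Z C" by simp
  show "min_rep C \<in> carrier G" using * x conj_class_subset by auto
  then show "conj_class G (min_rep C) = C"
    using * x by (simp add: conj_class_eq_iff) (simp add: conj_class_def conj_rel_sym)
qed

lemma fin_wt_class_length: "fin_wt (conj_classes G) (class_length G Z)"
  unfolding fin_wt_def
proof
  fix n
  have "{C \<in> conj_classes G. class_length G Z C = n}
      \<subseteq> conj_class G ` {x \<in> carrier G. word_length G Z x = n}"
  proof clarify
    fix C assume C: "C \<in> conj_classes G" "n = class_length G Z C"
    show "C \<in> conj_class G ` {x \<in> carrier G. word_length G Z x = class_length G Z C}"
      using min_rep[OF C(1)] by (intro image_eqI[of _ _ "min_rep C"]) auto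
  qed
  then show "finite {C \<in> conj_classes G. class_length G Z C = n}"
    by (rule finite_subset) (use fin_wt_word_length in \<open>simp add: fin_wt_def\<close>)
qed

lemma one_class: "{\<one>} \<in> conj_classes G"
  using conj_class_one by (auto simp: conj_classes_eq)

lemma class_length_one: "class_length G Z {\<one>} = 0"
  using class_length_le[of \<one> "{\<one>}" G Z] by simp

lemma conj_growth_series_eq: "conj_growth_series G Z = conj_gf G Z (carrier G)"
proof -
  have "{C \<in> conj_classes G. C \<subseteq> carrier G} = conj_classes G"
    using conj_class_subset by (auto simp: conj_classes_eq)
  then show ?thesis by (simp add: conj_growth_series_def conj_gf_def gf_def)
qed

lemma conj_gf_Un:
  assumes U: "conj_closed G U" and V: "conj_closed G V" and disj: "U \<inter> V = {}"
  shows "conj_gf G Z (U \<union> V) = conj_gf G Z U + conj_gf G Z V"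
proof -
  have UV: "conj_closed G (U \<union> V)" using U V by (auto simp: conj_closed_def)
  have eq: "{C \<in> conj_classes G. C \<subseteq> U \<union> V} = {C \<in> conj_classes G. C \<subseteq> U} \<union> {C \<in> conj_classes G. C \<subseteq> V}"
    using conj_closed_classes[OF UV] conj_closed_classes[OF U] conj_closed_classes[OF V] by auto
  have "C \<noteq> {}" if "C \<in> conj_classes G" for C
    using that conj_class_self by (auto simp: conj_classes_eq)
  then have "{C \<in> conj_classes G. C \<subseteq> U} \<inter> {C \<in> conj_classes G. C \<subseteq> V} = {}"
    using disj by blast
  then show ?thesis unfolding conj_gf_def eq
    by (intro gf_Un) (auto intro: fin_wt_subset[OF fin_wt_class_length])
qed

text \<open>
  Only finitely many of the \<open>U n\<close> contain classes of a given length, because elements of \<open>U n\<close> have length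
  at least \<open>n\<close>.
\<close>

lemma conj_gf_UN:
  assumes U: "\<And>n. conj_closed G (U n)" and disj: "\<And>m n. m \<noteq> n \<Longrightarrow> U m \<inter> U n = {}"
    and len: "\<And>n x. x \<in> U n \<Longrightarrow> n \<le> word_length G Z x"
  shows "(\<lambda>n. conj_gf G Z (U n)) sums conj_gf G Z (\<Union>n. U n)"
proof -
  define K where "K k n = {C \<in> {C \<in> conj_classes G. C \<subseteq> U n}. class_length G Z C = k}" for k n
  have low: "K k n = {}" if "k < n" for k n
  proof (rule ccontr)
    assume "K k n \<noteq> {}"
    then obtain C where C: "C \<in> conj_classes G" "C \<subseteq> U n" "class_length G Z C = k"
      by (auto simp: K_def)
    have "min_rep C \<in> C" using min_rep[OF C(1)] conj_class_self by blast
    with C len min_rep[OF C(1)] that show False by fastforce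
  qed
  have "\<Union> (range U) \<subseteq> carrier G" using U by (auto simp: conj_closed_def)
  then have UU: "conj_closed G (\<Union>n. U n)"
    using conj_closedD[OF U] unfolding conj_closed_def by blast
  have "{C \<in> conj_classes G. C \<subseteq> (\<Union>n. U n)} = (\<Union>n. {C \<in> conj_classes G. C \<subseteq> U n})"
    using conj_closed_classes[OF UU] conj_closed_classes[OF U] by auto
  then have eq: "{C \<in> {C \<in> conj_classes G. C \<subseteq> (\<Union>n. U n)}. class_length G Z C = k} = (\<Union>n\<in>{..k}. K k n)" for k
    using low[of k] by (auto simp: K_def not_le[symmetric]) blast
  have fin: "finite (K k n)" for k n
    using fin_wt_subset[OF fin_wt_class_length, of "{C \<in> conj_classes G. C \<subseteq> U n}"]
    by (auto simp: K_def fin_wt_def)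
  have disjK: "K k m \<inter> K k n = {}" if "m \<noteq> n" for k m n
    using disj[OF that] conj_class_self by (fastforce simp: K_def conj_classes_eq)
  have "conj_gf G Z (\<Union>n. U n) = Abs_fps (\<lambda>k. \<Sum>n\<le>k. fps_nth (conj_gf G Z (U n)) k)"
  proof (rule fps_ext)
    fix k
    have "card (\<Union>n\<in>{..k}. K k n) = (\<Sum>n\<le>k. card (K k n))"
      using fin disjK by (intro card_UN_disjoint) auto
    then show "fps_nth (conj_gf G Z (\<Union>n. U n)) k = fps_nth (Abs_fps (\<lambda>k. \<Sum>n\<le>k. fps_nth (conj_gf G Z (U n)) k)) k"
      by (simp only: conj_gf_def gf_nth eq fps_nth_Abs_fps) (simp add: K_def)
  qed
  moreover have "fps_nth (conj_gf G Z (U n)) k = 0" if "k < n" for k n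
    using low[OF that] unfolding conj_gf_def gf_nth K_def by (simp only: card.empty of_nat_0)
  ultimately show ?thesis
    using fps_sums_of_low_coeffs_zero[of "\<lambda>n. conj_gf G Z (U n)"] by simp
qed

text \<open>
  The counting principle behind all cases: normal forms \<open>d\<close> with representatives \<open>rep d\<close>, where \<open>R\<close>
  says which normal forms belong to the same class. If every element is conjugate to a normal form of no
  larger weight, and \<open>rep d\<close> can be spelled within the weight of \<open>d\<close>, then this weight is
  the length of the class.
\<close>

lemma conj_gf_quotient:
  assumes U: "conj_closed G U" and rep: "\<And>d. d \<in> N \<Longrightarrow> rep d \<in> U"
    and lower: "\<And>x. x \<in> U \<Longrightarrow> \<exists>d\<in>N. conj_rel G (rep d) x \<and> wt d \<le> word_length G Z x"
    and upper: "\<And>d. d \<in> N \<Longrightarrow> word_length G Z (rep d) \<le> wt d"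
    and R: "R \<subseteq> N \<times> N" "\<And>d e. d \<in> N \<Longrightarrow> e \<in> N \<Longrightarrow> conj_rel G (rep d) (rep e) \<longleftrightarrow> (d, e) \<in> R"
    and wtR: "\<And>d e. (d, e) \<in> R \<Longrightarrow> wt d = wt e"
  shows "conj_gf G Z U = gf (N // R) (qwt wt)"
proof -
  have repc: "rep d \<in> carrier G" if "d \<in> N" for d
    using rep[OF that] U by (auto simp: conj_closed_def)
  have eqv: "equiv N R"
  proof (rule equivI)
    show "refl_on N R" using R(2)[THEN iffD1, OF _ _ conj_rel_refl] repc by (auto simp: refl_on_def)
    show "sym R"
    proof (rule symI)
      fix a b assume ab: "(a, b) \<in> R"
      with R(1) have "a \<in> N" "b \<in> N" by auto
      with ab R(2) show "(b, a) \<in> R" using conj_rel_sym by blast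
    qed
    show "trans R"
    proof (rule transI)
      fix a b c assume "(a, b) \<in> R" "(b, c) \<in> R"
      with R(1) have "a \<in> N" "b \<in> N" "c \<in> N" by auto
      with \<open>(a, b) \<in> R\<close> \<open>(b, c) \<in> R\<close> R(2) show "(a, c) \<in> R" using conj_rel_trans by blast
    qed
  qed (rule R(1))
  define h where "h = (\<lambda>D. conj_class G (rep (SOME d. d \<in> D)))"
  have h: "h D = conj_class G (rep d)" if "D \<in> N // R" "d \<in> D" for D d
  proof -
    have s: "(SOME d. d \<in> D) \<in> D" using that(2) by (rule someI)
    have "D \<subseteq> N" using in_quotient_imp_subset[OF eqv that(1)] .
    moreover have "((SOME d. d \<in> D), d) \<in> R" using quotient_eq_iff[OF eqv that(1) that(1) s that(2)] by simp
    ultimately show ?thesis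
      using s that R(2)[of "SOME d. d \<in> D" d] repc conj_class_eq_iff[of "rep (SOME d. d \<in> D)" "rep d"]
      unfolding h_def by blast
  qed
  have ex: "\<exists>d. d \<in> D \<and> d \<in> N" if "D \<in> N // R" for D
    using in_quotient_imp_non_empty[OF eqv that] in_quotient_imp_subset[OF eqv that] by auto
  have "bij_betw h (N // R) {C \<in> conj_classes G. C \<subseteq> U}"
    unfolding conj_closed_classes[OF U] bij_betw_def
  proof
    show "inj_on h (N // R)"
    proof (rule inj_onI)
      fix D E assume D: "D \<in> N // R" and E: "E \<in> N // R" and eq: "h D = h E"
      obtain d e where "d \<in> D" "d \<in> N" "e \<in> E" "e \<in> N" using ex D E by blast
      with eq D E h R(2) repc have "(d, e) \<in> R" by (simp add: conj_class_eq_iff)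
      with \<open>d \<in> D\<close> \<open>e \<in> E\<close> show "D = E" using quotient_eq_iff[OF eqv D E] by blast
    qed
    show "h ` (N // R) = conj_class G ` U"
    proof (rule equalityI; rule subsetI)
      fix C assume "C \<in> h ` (N // R)"
      then obtain D where D: "D \<in> N // R" "C = h D" by auto
      obtain d where "d \<in> D" "d \<in> N" using ex[OF D(1)] by blast
      with D h[OF D(1)] rep show "C \<in> conj_class G ` U" by auto
    next
      fix C assume "C \<in> conj_class G ` U"
      then obtain x where x: "x \<in> U" "C = conj_class G x" by auto
      obtain d where d: "d \<in> N" "conj_rel G (rep d) x" using lower[OF x(1)] by blast
      then have "C = conj_class G (rep d)"
        using x conj_class_eq_iff[of "rep d" x] by (auto simp: conj_rel_def)
      moreover have "R `` {d} \<in> N // R" "d \<in> R `` {d}"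
        using d equiv_class_self[OF eqv] by (auto intro: quotientI)
      ultimately show "C \<in> h ` (N // R)" using h[of "R `` {d}" d] by (intro image_eqI) auto
    qed
  qed
  moreover have "class_length G Z (h D) = qwt wt D" if D: "D \<in> N // R" for D
  proof -
    obtain d where d: "d \<in> D" "d \<in> N" using ex D by blast
    have qw: "qwt wt D = wt d" using qwt_class[OF eqv wtR D d(1)] .
    have hD: "h D = conj_class G (rep d)" by (rule h[OF D d(1)])
    have "rep d \<in> h D" using hD repc[OF d(2)] by (simp add: conj_class_self)
    then have 1: "class_length G Z (h D) \<le> wt d"
      using class_length_le[of "rep d" "h D" G Z] upper[OF d(2)] by linarith
    obtain x where x: "x \<in> h D" "word_length G Z x = class_length G Z (h D)"
      using class_length_attained[of "h D"] \<open>rep d \<in> h D\<close> by blast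
    have dx: "conj_rel G (rep d) x" using x(1) hD by (simp add: conj_class_def)
    then have "x \<in> U" using U rep[OF d(2)] by (auto simp: conj_closed_def)
    then obtain e where e: "e \<in> N" "conj_rel G (rep e) x" "wt e \<le> word_length G Z x"
      using lower by blast
    then have "(d, e) \<in> R" using R(2) d(2) dx conj_rel_trans conj_rel_sym by blast
    then have "wt d \<le> class_length G Z (h D)" using e(3) x(2) wtR by metis
    with 1 qw show ?thesis by simp
  qed
  ultimately show ?thesis unfolding conj_gf_def by (rule gf_bij)
qed

text \<open>
  The special case in which each class has only one normal form.
\<close>

lemma conj_gf_transversal:
  assumes U: "conj_closed G U" and rep: "\<And>d. d \<in> N \<Longrightarrow> rep d \<in> U"
    and lower: "\<And>x. x \<in> U \<Longrightarrow> \<exists>d\<in>N. conj_rel G (rep d) x \<and> wt d \<le> word_length G Z x"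
    and upper: "\<And>d. d \<in> N \<Longrightarrow> word_length G Z (rep d) \<le> wt d"
    and R: "\<And>d e. d \<in> N \<Longrightarrow> e \<in> N \<Longrightarrow> conj_rel G (rep d) (rep e) \<Longrightarrow> d = e"
  shows "conj_gf G Z U = gf N wt"
proof -
  have "rep d \<in> carrier G" if "d \<in> N" for d
    using rep[OF that] U by (auto simp: conj_closed_def)
  then have "conj_gf G Z U = gf (N // Id_on N) (qwt wt)"
    using R conj_rel_refl by (intro conj_gf_quotient[OF U rep lower upper]) auto
  also have "N // Id_on N = (\<lambda>d. {d}) ` N" by (auto simp: quotient_def)
  also have "gf \<dots> (qwt wt) = gf N wt"
    by (rule gf_image) (auto simp: qwt_def)
  finally show ?thesis .
qed

end

lemma gen_groupI_fin_sym_gen_set: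
  assumes "group G" "fin_sym_gen_set G Y"
  shows "gen_group G Y"
proof -
  interpret group G by fact
  have Y: "finite Y" "Y \<subseteq> carrier G" "\<And>y. y \<in> Y \<Longrightarrow> inv\<^bsub>G\<^esub> y \<in> Y" "generate G Y = carrier G"
    using assms(2) by (auto simp: fin_sym_gen_set_def)
  interpret marked_group G Y using Y by unfold_locales
  have "\<exists>n. spelled n x" if "x \<in> generate G Y" for x
    using that
  proof (induction rule: generate.induct)
    case one
    show ?case using spelled_one by blast
  next
    case (incl h)
    then show ?case using spelled_gen by blast
  next
    case (inv h)
    then show ?case using spelled_gen Y(3) by blast
  next
    case (eng h1 h2)
    then show ?case using spelled_mult by blast
  qed
  then show ?thesis using Y by unfold_locales auto
qed

lemma word_length_iso:
  assumes "group H" "group K" and h: "h \<in> iso H K" and Z: "Z \<subseteq> carrier H" and x: "x \<in> carrier H"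
  shows "word_length K (h ` Z) (h x) = word_length H Z x"
proof -
  interpret H: group H by fact
  interpret K: group K by fact
  have hom: "h \<in> hom H K" and inj: "inj_on h (carrier H)" using h by (auto simp: iso_def bij_betw_def)
  have closed: "foldr (\<otimes>\<^bsub>H\<^esub>) ws \<one>\<^bsub>H\<^esub> \<in> carrier H" if "set ws \<subseteq> Z" for ws
    using that Z by (induction ws) auto
  have map: "foldr (\<otimes>\<^bsub>K\<^esub>) (map h ws) \<one>\<^bsub>K\<^esub> = h (foldr (\<otimes>\<^bsub>H\<^esub>) ws \<one>\<^bsub>H\<^esub>)" if "set ws \<subseteq> Z" for ws
    using that
  proof (induction ws)
    case Nil
    show ?case using hom_one[OF hom] assms by simp
  next
    case (Cons w ws)
    then show ?case using Z closed[of ws] by (auto simp: hom_mult[OF hom])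
  qed
  have "(\<exists>ws. length ws = n \<and> set ws \<subseteq> h ` Z \<and> foldr (\<otimes>\<^bsub>K\<^esub>) ws \<one>\<^bsub>K\<^esub> = h x)
     \<longleftrightarrow> (\<exists>ws. length ws = n \<and> set ws \<subseteq> Z \<and> foldr (\<otimes>\<^bsub>H\<^esub>) ws \<one>\<^bsub>H\<^esub> = x)" for n
  proof
    assume "\<exists>ws. length ws = n \<and> set ws \<subseteq> h ` Z \<and> foldr (\<otimes>\<^bsub>K\<^esub>) ws \<one>\<^bsub>K\<^esub> = h x"
    then obtain vs where vs: "length vs = n" "set vs \<subseteq> h ` Z" "foldr (\<otimes>\<^bsub>K\<^esub>) vs \<one>\<^bsub>K\<^esub> = h x" by blast
    then have "vs \<in> lists (h ` Z)" by auto
    then have "vs \<in> map h ` lists Z" by (simp add: lists_image)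
    then obtain ws where ws: "vs = map h ws" "set ws \<subseteq> Z" by auto
    have "foldr (\<otimes>\<^bsub>H\<^esub>) ws \<one>\<^bsub>H\<^esub> = x"
      using vs(3) map[OF ws(2)] ws(1) inj closed[OF ws(2)] x by (simp add: inj_on_eq_iff)
    then show "\<exists>ws. length ws = n \<and> set ws \<subseteq> Z \<and> foldr (\<otimes>\<^bsub>H\<^esub>) ws \<one>\<^bsub>H\<^esub> = x"
      using ws vs by auto
  next
    assume "\<exists>ws. length ws = n \<and> set ws \<subseteq> Z \<and> foldr (\<otimes>\<^bsub>H\<^esub>) ws \<one>\<^bsub>H\<^esub> = x"
    then obtain ws where ws: "length ws = n" "set ws \<subseteq> Z" "foldr (\<otimes>\<^bsub>H\<^esub>) ws \<one>\<^bsub>H\<^esub> = x" by blast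
    then show "\<exists>ws. length ws = n \<and> set ws \<subseteq> h ` Z \<and> foldr (\<otimes>\<^bsub>K\<^esub>) ws \<one>\<^bsub>K\<^esub> = h x"
      using map[OF ws(2)] by (intro exI[of _ "map h ws"]) auto
  qed
  then show ?thesis by (simp add: word_length_def)
qed

lemma conj_growth_series_iso:
  assumes "group H" "group K" and h: "h \<in> iso H K" and Z: "Z \<subseteq> carrier H"
  shows "conj_growth_series K (h ` Z) = conj_growth_series H Z"
proof -
  interpret H: group H by fact
  interpret K: group K by fact
  have hom: "h \<in> hom H K" and inj: "inj_on h (carrier H)" and surj: "h ` carrier H = carrier K"
    using h by (auto simp: iso_def bij_betw_def)
  have hc: "h x \<in> carrier K" if "x \<in> carrier H" for x using that surj by blast
  have conj: "conj_rel K (h x) (h y) \<longleftrightarrow> conj_rel H x y" if "x \<in> carrier H" "y \<in> carrier H" for x y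
  proof -
    have "h g \<otimes>\<^bsub>K\<^esub> h x = h y \<otimes>\<^bsub>K\<^esub> h g \<longleftrightarrow> g \<otimes>\<^bsub>H\<^esub> x = y \<otimes>\<^bsub>H\<^esub> g" if "g \<in> carrier H" for g
      using that \<open>x \<in> _\<close> \<open>y \<in> _\<close> inj by (simp flip: hom_mult[OF hom] add: inj_on_eq_iff)
    then show ?thesis using that hc by (auto simp: conj_rel_def simp flip: surj)
  qed
  have cls: "conj_class K (h x) = h ` conj_class H x" if "x \<in> carrier H" for x
  proof -
    have "conj_class K (h x) = h ` {y \<in> carrier H. conj_rel K (h x) (h y)}"
      using K.conj_class_subset[of "h x"] surj by (auto simp: conj_class_def)
    also have "{y \<in> carrier H. conj_rel K (h x) (h y)} = conj_class H x"
      using conj[OF that] H.conj_class_subset[of x] by (auto simp: conj_class_def)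
    finally show ?thesis .
  qed
  have sub: "C \<subseteq> carrier H" if "C \<in> conj_classes H" for C
    using that H.conj_class_subset by (auto simp: H.conj_classes_eq)
  have "bij_betw ((`) h) (conj_classes H) (conj_classes K)"
    unfolding bij_betw_def
  proof
    show "inj_on ((`) h) (conj_classes H)"
      using sub inj by (intro inj_onI) (metis inj_on_image_eq_iff)
    have "conj_classes K = (\<lambda>x. conj_class K (h x)) ` carrier H"
      by (simp add: K.conj_classes_eq image_image flip: surj)
    also have "\<dots> = (`) h ` conj_classes H"
      by (simp add: cls H.conj_classes_eq image_image)
    finally show "(`) h ` conj_classes H = conj_classes K" ..
  qed
  moreover have "class_length K (h ` Z) (h ` C) = class_length H Z C" if "C \<in> conj_classes H" for C
  proof -
    have "(\<exists>y\<in>h ` C. word_length K (h ` Z) y = n) \<longleftrightarrow> (\<exists>x\<in>C. word_length H Z x = n)" for n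
    proof -
      have "word_length K (h ` Z) (h x) = word_length H Z x" if "x \<in> C" for x
        using word_length_iso[OF assms, of x] sub[OF \<open>C \<in> _\<close>] that by blast
      then show ?thesis by auto
    qed
    then show ?thesis by (simp add: class_length_def)
  qed
  ultimately have "gf (conj_classes K) (class_length K (h ` Z)) = gf (conj_classes H) (class_length H Z)"
    by (rule gf_bij)
  then show ?thesis by (simp add: conj_growth_series_def gf_def)
qed

section \<open>The infinite dihedral group on the integers\<close>

text \<open>
  The integer \<open>p\<close> stands for the alternating word of length \<open>\<bar>p\<bar>\<close> that begins with \<open>b1\<close> if \<open>p > 0\<close> and with \<open>b2\<close> if
  \<open>p < 0\<close>. Even elements translate the line and odd elements reflect it.
\<close>

definition dih :: "int monoid" where
  "dih = \<lparr>carrier = UNIV, monoid.mult = (\<lambda>p q. if even p then p + q else p - q), one = 0\<rparr>"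

lemma dih_simps [simp]:
  "carrier dih = UNIV" "p \<otimes>\<^bsub>dih\<^esub> q = (if even p then p + q else p - q)" "\<one>\<^bsub>dih\<^esub> = 0"
  by (simp_all add: dih_def)

lemma group_dih: "group dih"
proof (rule groupI)
  fix x :: int
  show "\<exists>y\<in>carrier dih. y \<otimes>\<^bsub>dih\<^esub> x = \<one>\<^bsub>dih\<^esub>"
    by (rule bexI[of _ "if even x then - x else x"]) auto
qed auto

lemma inv_dih [simp]: "inv\<^bsub>dih\<^esub> p = (if even p then - p else p)"
  by (rule group.inv_equality[OF group_dih]) auto

definition c2c2_rels :: "c2c2_gen word set" where
  "c2c2_rels = {[(b, True), (b, True)] | b. b \<in> {b1, b2}}"

lemma c2_free_c2_eq: "c2_free_c2 = presented_group c2c2_rels"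
  by (simp add: c2_free_c2_def c2c2_rels_def)

text \<open>
  Both signs of a letter get the same value, since the generators are involutions.
\<close>

fun dih_gen :: "c2c2_gen \<Rightarrow> int" where
  "dih_gen b1 = 1"
| "dih_gen b2 = - 1"

fun dih_eval :: "c2c2_gen word \<Rightarrow> int" where
  "dih_eval [] = 0"
| "dih_eval ((b, s) # w) = dih_gen b - dih_eval w"

lemma odd_dih_gen: "odd (dih_gen b)"
  by (cases b) auto

lemma dih_eval_append: "dih_eval (u @ v) = dih_eval u \<otimes>\<^bsub>dih\<^esub> dih_eval v"
proof (induction u)
  case (Cons a u)
  then show ?case using odd_dih_gen by (cases a) auto
qed simp

lemma dih_eval_pres_eq: "pres_eq c2c2_rels u v \<Longrightarrow> dih_eval u = dih_eval v"
  by (induction rule: pres_eq.induct) (auto simp: dih_eval_append c2c2_rels_def)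

function dih_word :: "int \<Rightarrow> c2c2_gen word" where
  "dih_word p = (if p = 0 then [] else if p > 0 then (b1, True) # dih_word (1 - p)
     else (b2, True) # dih_word (- 1 - p))"
  by auto
termination by (relation "measure (\<lambda>p. nat \<bar>p\<bar>)") auto

declare dih_word.simps [simp del]

lemma dih_eval_word: "dih_eval (dih_word p) = p"
  by (induction p rule: dih_word.induct) (subst dih_word.simps, auto)

lemma pres_eq_Cons:
  assumes "pres_eq R u v"
  shows "pres_eq R (a # u) (a # v)"
  using pres_eq.subst_word[OF assms, of "[a]" "[]"] by simp

lemma c2c2_involution: "pres_eq c2c2_rels ((b, True) # (b, True) # w) w"
proof -
  have "[(b, True), (b, True)] \<in> c2c2_rels" by (cases b) (auto simp: c2c2_rels_def)
  from pres_eq.subst_word[OF pres_eq.relator[OF this], of "[]" w] show ?thesis by simp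
qed

lemma c2c2_sign: "pres_eq c2c2_rels ((b, s) # w) ((b, True) # w)"
proof (cases s)
  case True
  then show ?thesis by (simp add: pres_eq.refl)
next
  case False
  have "pres_eq c2c2_rels ((b, False) # w) ((b, False) # (b, True) # (b, True) # w)"
    by (intro pres_eq_Cons pres_eq.sym[OF c2c2_involution])
  moreover have "pres_eq c2c2_rels ((b, False) # (b, True) # (b, True) # w) ((b, True) # w)"
    using pres_eq.subst_word[OF pres_eq.cancel[of c2c2_rels b False], of "[]" "(b, True) # w"] by simp
  ultimately show ?thesis using False by (auto intro: pres_eq.trans)
qed

lemma dih_word_step: "pres_eq c2c2_rels ((b, True) # dih_word p) (dih_word (dih_gen b - p))"
proof (cases b)
  case b1
  show ?thesis
  proof (cases "p > 0")
    case True
    then have "dih_word p = (b1, True) # dih_word (1 - p)" by (subst dih_word.simps) simp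
    then show ?thesis using c2c2_involution[of "c2c2_gen.b1"] b1 by simp
  next
    case False
    then have "dih_word (1 - p) = (b1, True) # dih_word p" by (subst dih_word.simps) simp
    then show ?thesis using b1 by (simp add: pres_eq.refl)
  qed
next
  case b2
  show ?thesis
  proof (cases "p < 0")
    case True
    then have "dih_word p = (b2, True) # dih_word (- 1 - p)" by (subst dih_word.simps) simp
    then show ?thesis using c2c2_involution[of "c2c2_gen.b2"] b2 by simp
  next
    case False
    then have "dih_word (- 1 - p) = (b2, True) # dih_word p" by (subst dih_word.simps) simp
    then show ?thesis using b2 by (simp add: pres_eq.refl)
  qed
qed

text \<open>
  Together with \<open>dih_eval_pres_eq\<close> this solves the word problem: the alternating words are normal forms.
\<close>

lemma pres_eq_dih_word: "pres_eq c2c2_rels w (dih_word (dih_eval w))"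
proof (induction w)
  case Nil
  show ?case by (subst dih_word.simps) (simp add: pres_eq.refl)
next
  case (Cons a w)
  obtain b s where a: "a = (b, s)" by force
  have "pres_eq c2c2_rels (a # w) ((b, True) # dih_word (dih_eval w))"
    unfolding a by (rule pres_eq.trans[OF c2c2_sign pres_eq_Cons[OF Cons.IH]])
  then show ?case using dih_word_step[of b "dih_eval w"] unfolding a
    by (auto intro: pres_eq.trans)
qed

lemma pres_class_eq_iff_dih_eval:
  "pres_class c2c2_rels u = pres_class c2c2_rels v \<longleftrightarrow> dih_eval u = dih_eval v"
  unfolding pres_class_eq_iff
  by (metis dih_eval_pres_eq pres_eq_dih_word pres_eq.sym pres_eq.trans)

definition dih_to_c2c2 :: "int \<Rightarrow> c2c2_gen word set" where
  "dih_to_c2c2 p = pres_class c2c2_rels (dih_word p)"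

lemma dih_to_c2c2_iso: "dih_to_c2c2 \<in> iso dih c2_free_c2"
proof (rule isoI)
  show "dih_to_c2c2 \<in> hom dih c2_free_c2"
  proof (rule homI)
    fix p q
    show "dih_to_c2c2 (p \<otimes>\<^bsub>dih\<^esub> q) = dih_to_c2c2 p \<otimes>\<^bsub>c2_free_c2\<^esub> dih_to_c2c2 q"
      by (simp add: dih_to_c2c2_def c2_free_c2_eq mult_presented_group pres_class_eq_iff_dih_eval
          dih_eval_append dih_eval_word del: dih_simps)
  qed (simp add: dih_to_c2c2_def c2_free_c2_eq carrier_presented_group)
  have "inj dih_to_c2c2"
    by (rule injI) (simp add: dih_to_c2c2_def pres_class_eq_iff_dih_eval dih_eval_word)
  moreover have "range dih_to_c2c2 = carrier c2_free_c2"
  proof (rule equalityI)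
    show "carrier c2_free_c2 \<subseteq> range dih_to_c2c2"
    proof
      fix A assume "A \<in> carrier c2_free_c2"
      then obtain w where "A = pres_class c2c2_rels w"
        by (auto simp: c2_free_c2_eq carrier_presented_group)
      then have "A = dih_to_c2c2 (dih_eval w)"
        by (simp add: dih_to_c2c2_def pres_class_eq_iff_dih_eval dih_eval_word)
      then show "A \<in> range dih_to_c2c2" by simp
    qed
  qed (auto simp: dih_to_c2c2_def c2_free_c2_eq carrier_presented_group)
  ultimately show "bij_betw dih_to_c2c2 (carrier dih) (carrier c2_free_c2)"
    by (simp add: bij_betw_def)
qed

lemma dih_to_c2c2_gens: "dih_to_c2c2 ` {1, - 1} = c2_free_c2_gens"
proof -
  have "dih_to_c2c2 1 = pres_class c2c2_rels [(b1, True)]"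
    "dih_to_c2c2 (- 1) = pres_class c2c2_rels [(b2, True)]"
    unfolding dih_to_c2c2_def pres_class_eq_iff_dih_eval dih_eval_word by simp_all
  then show ?thesis unfolding c2_free_c2_gens_def c2c2_rels_def[symmetric] by auto
qed

section \<open>Wreath products over isomorphic groups\<close>

definition fin_supp_on :: "('g, 'm) monoid_scheme \<Rightarrow> 'l set \<Rightarrow> ('l \<Rightarrow> 'g) set" where
  "fin_supp_on G A = {f \<in> A \<rightarrow>\<^sub>E carrier G. finite {i \<in> A. f i \<noteq> \<one>\<^bsub>G\<^esub>}}"

lemma wreath_carrier:
  assumes "group G"
  shows "carrier (wreath G L) = fin_supp_on G (carrier L) \<times> carrier L"
  by (simp add: wreath_def Let_def carrier_sum_group assms fin_supp_on_def)

lemma wreath_mult: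
  "(f, m) \<otimes>\<^bsub>wreath G L\<^esub> (g, n) =
    (\<lambda>i\<in>carrier L. f i \<otimes>\<^bsub>G\<^esub> wreath_shift L m g i, m \<otimes>\<^bsub>L\<^esub> n)"
  by (simp add: wreath_def Let_def)

lemma wreath_one: "\<one>\<^bsub>wreath G L\<^esub> = (\<lambda>i\<in>carrier L. \<one>\<^bsub>G\<^esub>, \<one>\<^bsub>L\<^esub>)"
  by (simp add: wreath_def Let_def)

lemma wreath_gens_eq:
  "wreath_gens G L Y X = (\<lambda>x. (lamp G L \<one>\<^bsub>G\<^esub>, x)) ` X \<union> (\<lambda>y. (lamp G L y, \<one>\<^bsub>L\<^esub>)) ` Y"
  by (auto simp: wreath_gens_def)

definition wreath_map :: "('l, 'n) monoid_scheme \<Rightarrow> ('k, 'o) monoid_scheme \<Rightarrow> ('l \<Rightarrow> 'k) \<Rightarrow>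
    ('l \<Rightarrow> 'g) \<times> 'l \<Rightarrow> ('k \<Rightarrow> 'g) \<times> 'k" where
  "wreath_map L K k = (\<lambda>(f, m). (\<lambda>i\<in>carrier K. f (inv_into (carrier L) k i), k m))"

lemma
  assumes "group G" "group L" "group K" and k: "k \<in> iso L K"
  shows wreath_map_iso: "wreath_map L K k \<in> iso (wreath G L) (wreath G K)"
    and wreath_map_gens: "Y \<subseteq> carrier G \<Longrightarrow> X \<subseteq> carrier L \<Longrightarrow>
      wreath_map L K k ` wreath_gens G L Y X = wreath_gens G K Y (k ` X)"
proof -
  interpret L: group L by fact
  interpret K: group K by fact
  interpret G: group G by fact
  define g where "g = inv_into (carrier L) k"
  have khom: "k \<in> hom L K" and kbij: "bij_betw k (carrier L) (carrier K)"
    using k by (auto simp: iso_def)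
  have g: "g \<in> iso K L" using L.iso_set_sym[OF k] by (simp add: g_def)
  have ghom: "g \<in> hom K L" and gbij: "bij_betw g (carrier K) (carrier L)"
    using g by (auto simp: iso_def)
  have kc: "k x \<in> carrier K" and gk: "g (k x) = x" if "x \<in> carrier L" for x
    using that kbij by (auto simp: g_def bij_betw_def)
  have gc: "g y \<in> carrier L" and kg: "k (g y) = y" if "y \<in> carrier K" for y
    using that kbij gbij by (auto simp: g_def bij_betw_def f_inv_into_f)
  have one: "k \<one>\<^bsub>L\<^esub> = \<one>\<^bsub>K\<^esub>" "g \<one>\<^bsub>K\<^esub> = \<one>\<^bsub>L\<^esub>"
    using hom_one[OF khom] hom_one[OF ghom] assms by auto
  have supp: "(\<lambda>i\<in>B. f (u i)) \<in> fin_supp_on G B"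
    if "bij_betw u B A" "f \<in> fin_supp_on G A" for u :: "'x \<Rightarrow> 'y" and f A B
  proof -
    have "bij_betw u {i \<in> B. f (u i) \<noteq> \<one>\<^bsub>G\<^esub>} {i \<in> A. f i \<noteq> \<one>\<^bsub>G\<^esub>}"
      using that(1) by (auto simp: bij_betw_def inj_on_def)
    then have "finite {i \<in> B. f (u i) \<noteq> \<one>\<^bsub>G\<^esub>}"
      using that(2) by (simp add: fin_supp_on_def bij_betw_finite)
    moreover have "{i \<in> B. (\<lambda>i\<in>B. f (u i)) i \<noteq> \<one>\<^bsub>G\<^esub>} = {i \<in> B. f (u i) \<noteq> \<one>\<^bsub>G\<^esub>}" by auto
    ultimately show ?thesis using that by (auto simp: fin_supp_on_def bij_betw_def)
  qed
  have ext: "f i = undefined" if "f \<in> fin_supp_on G A" "i \<notin> A" for f A and i :: 'x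
    using that by (auto simp: fin_supp_on_def PiE_def extensional_def)
  show "wreath_map L K k \<in> iso (wreath G L) (wreath G K)"
  proof (rule isoI)
    show "bij_betw (wreath_map L K k) (carrier (wreath G L)) (carrier (wreath G K))"
    proof (rule bij_betwI[where g = "\<lambda>(f, m). (\<lambda>i\<in>carrier L. f (k i), g m)"])
      show "wreath_map L K k \<in> carrier (wreath G L) \<rightarrow> carrier (wreath G K)"
        using supp[OF gbij] kc by (auto simp: wreath_carrier assms wreath_map_def g_def)
      show "(\<lambda>(f, m). (\<lambda>i\<in>carrier L. f (k i), g m)) \<in> carrier (wreath G K) \<rightarrow> carrier (wreath G L)"
        using supp[OF kbij] gc by (auto simp: wreath_carrier assms)
    next
      fix x assume "x \<in> carrier (wreath G L)"
      then obtain f m where x: "x = (f, m)" "f \<in> fin_supp_on G (carrier L)" "m \<in> carrier L"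
        by (auto simp: wreath_carrier assms)
      have "(\<lambda>i\<in>carrier L. (\<lambda>i\<in>carrier K. f (g i)) (k i)) = f"
        using x(2) ext[OF x(2)] by (auto simp: fun_eq_iff kc gk)
      then show "(\<lambda>(f, m). (\<lambda>i\<in>carrier L. f (k i), g m)) (wreath_map L K k x) = x"
        using x by (simp add: wreath_map_def gk flip: g_def)
    next
      fix x assume "x \<in> carrier (wreath G K)"
      then obtain f m where x: "x = (f, m)" "f \<in> fin_supp_on G (carrier K)" "m \<in> carrier K"
        by (auto simp: wreath_carrier assms)
      have "(\<lambda>i\<in>carrier K. (\<lambda>i\<in>carrier L. f (k i)) (g i)) = f"
        using x(2) ext[OF x(2)] by (auto simp: fun_eq_iff gc kg)
      then show "wreath_map L K k ((\<lambda>(f, m). (\<lambda>i\<in>carrier L. f (k i), g m)) x) = x"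
        using x by (simp add: wreath_map_def kg flip: g_def)
    qed
    show "wreath_map L K k \<in> hom (wreath G L) (wreath G K)"
    proof (rule homI)
      fix x assume "x \<in> carrier (wreath G L)"
      then show "wreath_map L K k x \<in> carrier (wreath G K)"
        using supp[OF gbij] kc by (auto simp: wreath_carrier assms wreath_map_def g_def)
    next
      fix x y assume xy: "x \<in> carrier (wreath G L)" "y \<in> carrier (wreath G L)"
      obtain f m f' m' where x: "x = (f, m)" "y = (f', m')" by (cases x, cases y) auto
      have m: "m \<in> carrier L" "m' \<in> carrier L" using xy x by (auto simp: wreath_carrier assms)
      have "inv\<^bsub>L\<^esub> m \<otimes>\<^bsub>L\<^esub> g i = g (inv\<^bsub>K\<^esub> (k m) \<otimes>\<^bsub>K\<^esub> i)" if "i \<in> carrier K" for i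
      proof -
        have "g (inv\<^bsub>K\<^esub> (k m)) = inv\<^bsub>L\<^esub> (g (k m))"
          using group_hom.hom_inv[of K L g "k m"] assms ghom kc[OF m(1)]
          by (simp add: group_hom_def group_hom_axioms_def)
        then show ?thesis using that m kc by (simp add: hom_mult[OF ghom] gk)
      qed
      then show "wreath_map L K k (x \<otimes>\<^bsub>wreath G L\<^esub> y) =
          wreath_map L K k x \<otimes>\<^bsub>wreath G K\<^esub> wreath_map L K k y"
        using m kc gc by (auto simp: x wreath_map_def wreath_mult wreath_shift_def hom_mult[OF khom]
            fun_eq_iff simp flip: g_def)
    qed
  qed
  show "wreath_map L K k ` wreath_gens G L Y X = wreath_gens G K Y (k ` X)"
    if "Y \<subseteq> carrier G" "X \<subseteq> carrier L"
  proof -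
    have g1: "g i = \<one>\<^bsub>L\<^esub> \<longleftrightarrow> i = \<one>\<^bsub>K\<^esub>" if "i \<in> carrier K" for i
      using one kg[OF that] by metis
    have lamp: "(\<lambda>i\<in>carrier K. lamp G L y (g i)) = lamp G K y" for y
      using gc by (auto simp: lamp_def fun_eq_iff g1)
    have "wreath_map L K k (lamp G L y, x) = (lamp G K y, k x)" for x y
      by (simp add: wreath_map_def lamp flip: g_def)
    then show ?thesis by (simp add: wreath_gens_eq image_Un image_image one(1))
  qed
qed

text \<open>
  From here on, the integers replace the group given by generators and relators.
\<close>

lemma conj_growth_series_wreath_dih:
  assumes "group G" "Y \<subseteq> carrier G"
  shows "conj_growth_series (wreath G c2_free_c2) (wreath_gens G c2_free_c2 Y c2_free_c2_gens)
    = conj_growth_series (wreath G dih) (wreath_gens G dih Y {1, - 1})"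
proof -
  have c2: "group c2_free_c2" unfolding c2_free_c2_def by (rule group_presented_group)
  note iso = wreath_map_iso[OF assms(1) group_dih c2 dih_to_c2c2_iso]
  have gens: "wreath_map dih c2_free_c2 dih_to_c2c2 ` wreath_gens G dih Y {1, - 1}
      = wreath_gens G c2_free_c2 Y c2_free_c2_gens"
    using wreath_map_gens[OF assms(1) group_dih c2 dih_to_c2c2_iso assms(2), of "{1, - 1}"]
    by (simp only: dih_to_c2c2_gens) simp
  have lampc: "lamp G dih y \<in> fin_supp_on G UNIV" if "y \<in> carrier G" for y
  proof -
    have "{i. lamp G dih y i \<noteq> \<one>\<^bsub>G\<^esub>} \<subseteq> {0}" by (auto simp: lamp_def)
    then have "finite {i. lamp G dih y i \<noteq> \<one>\<^bsub>G\<^esub>}" using finite_subset by blast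
    then show ?thesis using that group.is_monoid[OF assms(1)]
      by (auto simp: fin_supp_on_def lamp_def monoid.one_closed)
  qed
  have "wreath_gens G dih Y {1, - 1} \<subseteq> carrier (wreath G dih)"
    using lampc assms(2) group.is_monoid[OF assms(1)]
    by (auto simp: wreath_gens_def wreath_carrier[OF assms(1)] monoid.one_closed)
  from conj_growth_series_iso[OF group_wreath[OF assms(1) group_dih] group_wreath[OF assms(1) c2] iso this]
  show ?thesis unfolding gens .
qed

section \<open>Lamp configurations on the integer line\<close>

text \<open>
  Left multiplication in \<open>dih\<close> and its inverse. Both are isometries of the line.
\<close>

definition act :: "int \<Rightarrow> int \<Rightarrow> int" where
  "act p i = (if even p then p + i else p - i)"

definition iact :: "int \<Rightarrow> int \<Rightarrow> int" where
  "iact p i = (if even p then i - p else p - i)"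

lemma act_iact [simp]: "act p (iact p i) = i" "iact p (act p i) = i"
  by (simp_all add: act_def iact_def)

lemma act_0 [simp]: "act 0 i = i" "iact 0 i = i" "act p 0 = p" "iact p p = 0"
  by (simp_all add: act_def iact_def)

lemma iact_eq_iff: "iact p i = j \<longleftrightarrow> i = act p j"
  by (auto simp: act_def iact_def)

lemma abs_act_diff: "\<bar>act p i - act p j\<bar> = \<bar>i - j\<bar>"
  by (auto simp: act_def)

lemma inj_act: "inj (act p)" and inj_iact: "inj (iact p)"
  by (auto simp: inj_def act_def iact_def split: if_splits)

context gen_group
begin

abbreviation "len \<equiv> word_length G Z"

definition lampF :: "(int \<Rightarrow> 'a) set" where
  "lampF = {f. (\<forall>i. f i \<in> carrier G) \<and> finite {i. f i \<noteq> \<one>}}"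

definition supp :: "(int \<Rightarrow> 'a) \<Rightarrow> int set" where
  "supp f = {i. f i \<noteq> \<one>}"

definition lamp_wt :: "(int \<Rightarrow> 'a) \<Rightarrow> nat" where
  "lamp_wt f = (\<Sum>i\<in>supp f. len (f i))"

text \<open>
  The names \<open>W\<close> and \<open>S\<close> stand for the wreath product over the integer model and for its generators.
  \<open>lampF\<close> is its base group and \<open>pt g\<close> the configuration with the value \<open>g\<close> at \<open>0\<close>.
\<close>

definition W :: "((int \<Rightarrow> 'a) \<times> int) monoid" where
  "W = wreath G dih"

definition S :: "((int \<Rightarrow> 'a) \<times> int) set" where
  "S = wreath_gens G dih Z {1, - 1}"

definition pt :: "'a \<Rightarrow> int \<Rightarrow> 'a" where
  "pt g = (\<lambda>i. if i = 0 then g else \<one>)"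

lemma lampF_closed: "f \<in> lampF \<Longrightarrow> f i \<in> carrier G"
  by (simp add: lampF_def)

lemma lampF_finite: "f \<in> lampF \<Longrightarrow> finite (supp f)"
  by (simp add: lampF_def supp_def)

lemma lampFI: "(\<And>i. f i \<in> carrier G) \<Longrightarrow> finite A \<Longrightarrow> supp f \<subseteq> A \<Longrightarrow> f \<in> lampF"
  unfolding lampF_def supp_def using finite_subset by blast

lemma lampF_one: "(\<lambda>_. \<one>) \<in> lampF"
  by (rule lampFI[of _ "{}"]) (auto simp: supp_def)

lemma supp_one [simp]: "supp (\<lambda>_. \<one>) = {}"
  by (simp add: supp_def)

lemma lamp_wt_one [simp]: "lamp_wt (\<lambda>_. \<one>) = 0"
  by (simp add: lamp_wt_def)

lemma pt_lampF: "g \<in> carrier G \<Longrightarrow> pt g \<in> lampF"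
  by (rule lampFI[of _ "{0}"]) (auto simp: supp_def pt_def)

lemma lampF_upd:
  assumes "f \<in> lampF" "g \<in> carrier G"
  shows "f(i := g) \<in> lampF"
proof (rule lampFI)
  show "supp (f(i := g)) \<subseteq> insert i (supp f)" by (auto simp: supp_def)
qed (use assms in \<open>auto simp: lampF_closed lampF_finite\<close>)

lemma supp_comp: "supp (\<lambda>i. f (iact q i)) = act q ` supp f"
  unfolding supp_def by (auto simp: image_iff) (metis act_iact(1))

lemma lampF_comp: "f \<in> lampF \<Longrightarrow> (\<lambda>i. f (iact q i)) \<in> lampF"
  by (rule lampFI[of _ "act q ` supp f"]) (auto simp: lampF_closed lampF_finite supp_comp)

lemma supp_comp_act: "supp (\<lambda>i. f (act q i)) = iact q ` supp f"
  unfolding supp_def by (auto simp: image_iff) (metis act_iact(2))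

lemma lampF_comp_act: "f \<in> lampF \<Longrightarrow> (\<lambda>i. f (act q i)) \<in> lampF"
  by (rule lampFI[of _ "iact q ` supp f"]) (auto simp: lampF_closed lampF_finite supp_comp_act)

lemma lamp_wt_superset:
  assumes "finite A" "supp f \<subseteq> A"
  shows "lamp_wt f = (\<Sum>i\<in>A. len (f i))"
  unfolding lamp_wt_def using assms by (intro sum.mono_neutral_left) (auto simp: supp_def)

lemma lamp_wt_comp: "lamp_wt (\<lambda>i. f (iact q i)) = lamp_wt f"
  unfolding lamp_wt_def supp_comp
  by (subst sum.reindex) (auto intro: inj_on_subset[OF inj_act])

lemma lamp_wt_comp_act: "lamp_wt (\<lambda>i. f (act q i)) = lamp_wt f"
  unfolding lamp_wt_def supp_comp_act
  by (subst sum.reindex) (auto intro: inj_on_subset[OF inj_iact])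

lemma lamp_wt_pt: "lamp_wt (pt g) = len g"
  by (subst lamp_wt_superset[of "{0}"]) (auto simp: supp_def pt_def)

text \<open>
  The weight estimate for merging two lamps into one, where \<open>g\<close> and \<open>h\<close> are the product and the neutral element.
\<close>

lemma lamp_wt_upd2:
  assumes f: "f \<in> lampF" and ij: "i \<noteq> j" and gh: "len g + len h \<le> len (f i) + len (f j)"
  shows "lamp_wt (f(i := g, j := h)) \<le> lamp_wt f"
proof -
  define B where "B = supp f - {i, j}"
  have fin: "finite B" using lampF_finite[OF f] by (simp add: B_def)
  have "lamp_wt (f(i := g, j := h)) = (\<Sum>k\<in>insert i (insert j B). len ((f(i := g, j := h)) k))"
    using fin by (intro lamp_wt_superset) (auto simp: supp_def B_def)
  also have "\<dots> = len g + (len h + (\<Sum>k\<in>B. len ((f(i := g, j := h)) k)))"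
    using fin ij by (simp add: B_def)
  also have "(\<Sum>k\<in>B. len ((f(i := g, j := h)) k)) = (\<Sum>k\<in>B. len (f k))"
    by (intro sum.cong) (auto simp: B_def)
  also have "len g + (len h + (\<Sum>k\<in>B. len (f k))) \<le> len (f i) + (len (f j) + (\<Sum>k\<in>B. len (f k)))"
    using gh by simp
  also have "\<dots> = (\<Sum>k\<in>insert i (insert j B). len (f k))"
    using fin ij by (simp add: B_def)
  also have "\<dots> = lamp_wt f"
    using fin by (intro lamp_wt_superset[symmetric]) (auto simp: supp_def B_def)
  finally show ?thesis .
qed

lemma lamp_wt_upd_1:
  assumes "f \<in> lampF"
  shows "lamp_wt f = lamp_wt (f(i := \<one>)) + len (f i)"
proof -
  define B where "B = supp f - {i}"
  have fin: "finite B" "i \<notin> B" using lampF_finite[OF assms] by (auto simp: B_def)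
  have "lamp_wt f = (\<Sum>k\<in>insert i B. len (f k))"
    using fin by (intro lamp_wt_superset) (auto simp: B_def)
  also have "\<dots> = len (f i) + (\<Sum>k\<in>B. len (f k))"
    using fin by simp
  also have "(\<Sum>k\<in>B. len (f k)) = (\<Sum>k\<in>B. len ((f(i := \<one>)) k))"
    using fin by (intro sum.cong) auto
  also have "\<dots> = lamp_wt (f(i := \<one>))"
    using fin by (intro lamp_wt_superset[symmetric]) (auto simp: supp_def B_def)
  finally show ?thesis by simp
qed

lemma W_carrier: "carrier W = lampF \<times> UNIV"
  by (auto simp: W_def wreath_carrier[OF group_axioms] fin_supp_on_def lampF_def)

lemma W_mult: "(f, p) \<otimes>\<^bsub>W\<^esub> (g, q) = (\<lambda>i. f i \<otimes> g (iact p i), act p q)"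
  by (auto simp: W_def wreath_mult wreath_shift_def iact_def act_def restrict_def)

lemma W_one: "\<one>\<^bsub>W\<^esub> = (\<lambda>_. \<one>, 0)"
  by (simp add: W_def wreath_one restrict_def)

lemma group_W: "group W"
  unfolding W_def by (intro group_wreath group_dih group_axioms)

lemma S_eq: "S = {(\<lambda>_. \<one>, 1), (\<lambda>_. \<one>, - 1)} \<union> (\<lambda>y. (pt y, 0)) ` Z"
  by (simp add: S_def wreath_gens_eq lamp_def pt_def restrict_def)

lemma S_closed: "S \<subseteq> carrier W"
  using gens_closed pt_lampF by (auto simp: S_eq W_carrier lampF_one)

interpretation W: marked_group W S
  by (simp add: marked_group_def marked_group_axioms_def group_W S_closed)

subsection \<open>Short words for lamp configurations\<close>

lemma spelled_pt:
  assumes "g \<in> carrier G"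
  shows "W.spelled (len g) (pt g, 0)"
proof -
  have "\<exists>vs. set vs \<subseteq> S \<and> foldr (\<otimes>\<^bsub>W\<^esub>) vs \<one>\<^bsub>W\<^esub> = (pt (foldr (\<otimes>) ws \<one>), 0) \<and> length vs = length ws"
    if "set ws \<subseteq> Z" for ws
    using that
  proof (induction ws)
    case Nil
    have "pt \<one> = (\<lambda>_. \<one>)" by (auto simp: pt_def)
    then show ?case by (simp add: W_one)
  next
    case (Cons w ws)
    then obtain vs where vs: "set vs \<subseteq> S" "foldr (\<otimes>\<^bsub>W\<^esub>) vs \<one>\<^bsub>W\<^esub> = (pt (foldr (\<otimes>) ws \<one>), 0)"
      "length vs = length ws" by auto
    have "(pt w, 0) \<in> S" using Cons.prems by (auto simp: S_eq)
    moreover have "(pt w, 0) \<otimes>\<^bsub>W\<^esub> (pt (foldr (\<otimes>) ws \<one>), 0) = (pt (w \<otimes> foldr (\<otimes>) ws \<one>), 0)"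
      by (auto simp: W_mult pt_def)
    ultimately show ?case using vs by (intro exI[of _ "(pt w, 0) # vs"]) auto
  qed
  then show ?thesis using shortest_word[OF assms] unfolding W.spelled_def by (metis le_refl)
qed

lemma spelled_step: "\<bar>d\<bar> = 1 \<Longrightarrow> W.spelled 1 (\<lambda>_. \<one>, d)"
  using W.spelled_gen[of "(\<lambda>_. \<one>, d)"] by (auto simp: S_eq abs_if split: if_splits)

text \<open>
  A straight walk of length \<open>n\<close> in one direction can set every lamp on its way.
\<close>

lemma spelled_segment:
  assumes "\<sigma> = 1 \<or> \<sigma> = - 1" "f \<in> lampF" "supp f \<subseteq> (\<lambda>k. \<sigma> * int k) ` {..n}"
  shows "W.spelled (n + lamp_wt f) (f, \<sigma> * int n)"
  using assms(2,3)
proof (induction n arbitrary: f)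
  case 0
  then have "f = pt (f 0)" by (auto simp: pt_def fun_eq_iff supp_def)
  then show ?case using spelled_pt[of "f 0"] lampF_closed[OF 0(1), of 0] lamp_wt_pt[of "f 0"] by simp
next
  case (Suc n)
  define P where "P = \<sigma> * int (Suc n)"
  define h where "h = f(P := \<one>)"
  define d where "d = iact (\<sigma> * int n) P"
  have h: "h \<in> lampF" using Suc.prems by (simp add: h_def lampF_upd)
  have "supp h \<subseteq> (\<lambda>k. \<sigma> * int k) ` {..n}"
  proof
    fix i assume "i \<in> supp h"
    then have "i \<in> supp f" "i \<noteq> P" by (auto simp: h_def supp_def split: if_splits)
    then show "i \<in> (\<lambda>k. \<sigma> * int k) ` {..n}" using Suc.prems(2) by (auto simp: P_def le_Suc_eq)
  qed
  note IH = Suc.IH[OF h this]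
  have "\<bar>d\<bar> = 1" using assms(1) by (auto simp: d_def iact_def P_def algebra_simps)
  then have d: "W.spelled 1 (\<lambda>_. \<one>, d)" by (rule spelled_step)
  have fP: "f P \<in> carrier G" using Suc.prems by (simp add: lampF_closed)
  have "(h, \<sigma> * int n) \<otimes>\<^bsub>W\<^esub> (\<lambda>_. \<one>, d) = (h, P)"
    using h by (simp add: W_mult lampF_closed d_def)
  moreover have "(h, P) \<otimes>\<^bsub>W\<^esub> (pt (f P), 0) = (f, P)"
    using Suc.prems fP by (auto simp: W_mult h_def pt_def fun_eq_iff lampF_closed iact_eq_iff)
  moreover have "W.spelled (n + lamp_wt h + 1 + len (f P)) ((h, \<sigma> * int n) \<otimes>\<^bsub>W\<^esub> (\<lambda>_. \<one>, d) \<otimes>\<^bsub>W\<^esub> (pt (f P), 0))"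
    by (rule W.spelled_mult[OF W.spelled_mult[OF IH d le_refl] spelled_pt[OF fP] le_refl])
  moreover have "lamp_wt f = lamp_wt h + len (f P)"
    unfolding h_def by (rule lamp_wt_upd_1) (rule Suc.prems)
  ultimately show ?case by (simp add: P_def algebra_simps)
qed

lemma spelled_between:
  assumes "f \<in> lampF" "supp f \<subseteq> {min 0 p..max 0 p}"
  shows "W.spelled (nat \<bar>p\<bar> + lamp_wt f) (f, p)"
proof -
  define \<sigma> :: int where "\<sigma> = (if p < 0 then - 1 else 1)"
  have p: "p = \<sigma> * int (nat \<bar>p\<bar>)" by (simp add: \<sigma>_def)
  have "supp f \<subseteq> (\<lambda>k. \<sigma> * int k) ` {..nat \<bar>p\<bar>}"
  proof
    fix i assume "i \<in> supp f"
    then have "min 0 p \<le> i" "i \<le> max 0 p" using assms(2) by auto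
    then show "i \<in> (\<lambda>k. \<sigma> * int k) ` {..nat \<bar>p\<bar>}"
      by (intro image_eqI[of _ _ "nat \<bar>i\<bar>"]) (auto simp: \<sigma>_def)
  qed
  from spelled_segment[OF _ assms(1) this] show ?thesis by (subst (2) p) (auto simp: \<sigma>_def)
qed

lemma spelled_move: "W.spelled (nat \<bar>p\<bar>) (\<lambda>_. \<one>, p)"
  using spelled_between[OF lampF_one, of p] by simp

lemma spelled_there_and_back:
  assumes "f \<in> lampF" "supp f \<subseteq> {0..b}" "b \<ge> 0"
  shows "W.spelled (nat (b + \<bar>p - b\<bar>) + lamp_wt f) (f, p)"
proof -
  have "W.spelled (nat b + lamp_wt f) (f, b)"
    using spelled_between[OF assms(1), of b] assms(2,3) by simp
  moreover have "\<bar>iact b p\<bar> = \<bar>p - b\<bar>" by (auto simp: iact_def)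
  with spelled_move[of "iact b p"] have "W.spelled (nat \<bar>p - b\<bar>) (\<lambda>_. \<one>, iact b p)" by simp
  ultimately have "W.spelled (nat (b + \<bar>p - b\<bar>) + lamp_wt f) ((f, b) \<otimes>\<^bsub>W\<^esub> (\<lambda>_. \<one>, iact b p))"
    by (rule W.spelled_mult) (use assms(3) in simp)
  then show ?thesis using assms(1) by (simp add: W_mult lampF_closed)
qed

text \<open>
  The walk goes to \<open>a\<close>, then straight to \<open>b\<close>, and back to \<open>0\<close>. The middle part, seen from \<open>a\<close>, is again
  a walk in one direction that starts at \<open>0\<close>.
\<close>

lemma spelled_closed:
  assumes f: "f \<in> lampF" "supp f \<subseteq> {a..b}" and ab: "a \<le> 0" "0 \<le> b"
  shows "W.spelled (nat (2 * (b - a)) + lamp_wt f) (f, 0)"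
proof -
  define g where "g = (\<lambda>i. f (act a i))"
  define c where "c = iact a b"
  have g: "g \<in> lampF" "lamp_wt g = lamp_wt f"
    using f(1) by (simp_all add: g_def lampF_comp_act lamp_wt_comp_act)
  have "supp g \<subseteq> {min 0 c..max 0 c}"
    using f(2) ab by (auto simp: g_def supp_comp_act c_def iact_def)
  from spelled_between[OF g(1) this] have gc: "W.spelled (nat (b - a) + lamp_wt f) (g, c)"
    using ab by (auto simp: g(2) c_def iact_def)
  have ma: "W.spelled (nat (- a)) (\<lambda>_. \<one>, a)" using spelled_move[of a] ab by simp
  have "\<bar>iact b 0\<bar> = b" using ab by (auto simp: iact_def)
  with spelled_move[of "iact b 0"] have mb: "W.spelled (nat b) (\<lambda>_. \<one>, iact b 0)" by simp
  have "W.spelled (nat (2 * (b - a)) + lamp_wt f)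
      ((\<lambda>_. \<one>, a) \<otimes>\<^bsub>W\<^esub> (g, c) \<otimes>\<^bsub>W\<^esub> (\<lambda>_. \<one>, iact b 0))"
    by (rule W.spelled_mult[OF W.spelled_mult[OF ma gc le_refl] mb]) (use ab in simp)
  moreover have "(\<lambda>_. \<one>, a) \<otimes>\<^bsub>W\<^esub> (g, c) = (f, b)"
    using f by (simp add: W_mult g_def c_def lampF_closed)
  moreover have "(f, b) \<otimes>\<^bsub>W\<^esub> (\<lambda>_. \<one>, iact b 0) = (f, 0)"
    using f by (simp add: W_mult lampF_closed)
  ultimately show ?thesis by simp
qed

text \<open>
  Every configuration is supported in some interval around \<open>0\<close>, so \<open>spelled_closed\<close> provides a word.
\<close>

lemma gen_group_W: "gen_group W S"
proof
  show "finite S" using finite_gens by (simp add: S_eq)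
  fix x assume "x \<in> carrier W"
  then obtain f p where x: "x = (f, p)" "f \<in> lampF" by (auto simp: W_carrier)
  define N where "N = (\<Sum>i\<in>supp f. \<bar>i\<bar>)"
  have "\<bar>i\<bar> \<le> N" if "i \<in> supp f" for i
    unfolding N_def using lampF_finite[OF x(2)] that by (intro member_le_sum) auto
  then have "supp f \<subseteq> {- N..N}" by (auto simp: abs_le_iff) (meson minus_le_iff)
  moreover have "N \<ge> 0" by (simp add: N_def sum_nonneg)
  ultimately have "W.spelled (nat (2 * (N - - N)) + lamp_wt f) (f, 0)"
    by (intro spelled_closed x(2)) auto
  from W.spelled_mult[OF this spelled_move[of p] le_refl]
  show "\<exists>n. W.spelled n x" using x by (auto simp: W_mult lampF_closed)
qed

interpretation W: gen_group W S
  by (rule gen_group_W)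

subsection \<open>Lower bounds for word length\<close>

text \<open>
  Here \<open>l\<close> and \<open>m\<close> are the numbers of lamp letters and of moves in a word for \<open>(f, p)\<close>. The third condition says
  that a walk from \<open>0\<close> to \<open>p\<close> must pass every position \<open>i\<close> of a lamp. The fourth says that the walk, once closed up
  by \<open>\<bar>p\<bar>\<close> further moves, must visit both \<open>a\<close> and \<open>b\<close>. These conditions are just strong enough to be preserved when
  a letter is put in front of a word.
\<close>

definition cost_bound :: "nat \<Rightarrow> nat \<Rightarrow> (int \<Rightarrow> 'a) \<Rightarrow> int \<Rightarrow> bool" where
  "cost_bound l m f p \<longleftrightarrow> lamp_wt f \<le> l \<and> \<bar>p\<bar> \<le> int m \<and>
    (\<forall>i\<in>supp f. \<bar>i\<bar> + \<bar>p - i\<bar> \<le> int m) \<and>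
    (\<forall>a\<in>supp f. \<forall>b\<in>supp f. 2 * \<bar>b - a\<bar> \<le> int m + \<bar>p\<bar>)"

text \<open>
  A lamp at \<open>0\<close> is new. Its distance to a lamp at \<open>b\<close> satisfies the last condition because
  \<open>\<bar>b\<bar> \<le> \<bar>p - b\<bar> + \<bar>p\<bar>\<close>, which combines with the third condition for \<open>b\<close>.
\<close>

lemma cost_bound_lamp:
  assumes cb: "cost_bound l m f p" and f: "f \<in> lampF" and y: "y \<in> Z"
  shows "cost_bound (Suc l) m (\<lambda>i. pt y i \<otimes> f i) p"
proof -
  let ?g = "\<lambda>i. pt y i \<otimes> f i"
  have yc: "y \<in> carrier G" using y gens_closed by auto
  have gupd: "?g = f(0 := y \<otimes> f 0)" using f by (auto simp: pt_def fun_eq_iff lampF_closed)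
  have g: "?g \<in> lampF" unfolding gupd using f yc by (simp add: lampF_upd lampF_closed)
  have sup: "supp ?g \<subseteq> insert 0 (supp f)" unfolding gupd by (auto simp: supp_def)
  have "lamp_wt ?g = lamp_wt (?g(0 := \<one>)) + len (?g 0)" by (rule lamp_wt_upd_1[OF g])
  also have "?g(0 := \<one>) = f(0 := \<one>)" unfolding gupd by simp
  also have "len (?g 0) \<le> Suc (len (f 0))"
    using word_length_mult[OF yc lampF_closed[OF f, of 0]] word_length_le_spelled[OF spelled_gen[OF y]]
    by (simp add: pt_def)
  also have "lamp_wt (f(0 := \<one>)) + Suc (len (f 0)) = Suc (lamp_wt f)"
    using lamp_wt_upd_1[OF f, of 0] by simp
  finally have wt: "lamp_wt ?g \<le> Suc l" using cb by (simp add: cost_bound_def)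
  have m: "\<bar>p\<bar> \<le> int m" and 1: "\<And>i. i \<in> supp f \<Longrightarrow> \<bar>i\<bar> + \<bar>p - i\<bar> \<le> int m"
    and 2: "\<And>a b. a \<in> supp f \<Longrightarrow> b \<in> supp f \<Longrightarrow> 2 * \<bar>b - a\<bar> \<le> int m + \<bar>p\<bar>"
    using cb by (auto simp: cost_bound_def)
  have 3: "2 * \<bar>b\<bar> \<le> int m + \<bar>p\<bar>" if "b \<in> supp f" for b using 1[OF that] by arith
  have 4: "2 * \<bar>b - a\<bar> \<le> int m + \<bar>p\<bar>" if "a \<in> insert 0 (supp f)" "b \<in> insert 0 (supp f)" for a b
    using that 2[of a b] 3[of a] 3[of b] m by auto
  have 5: "\<bar>i\<bar> + \<bar>p - i\<bar> \<le> int m" if "i \<in> insert 0 (supp f)" for i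
    using that 1 m by auto
  show ?thesis unfolding cost_bound_def
    by (intro conjI ballI wt m 4 5) (use sup in auto)
qed

text \<open>
  A move reflects the picture in the midpoint of the edge between \<open>0\<close> and \<open>d\<close>. Distances between lamps and to the cursor stay the
  same, and distances to \<open>0\<close> change by at most one.
\<close>

lemma cost_bound_move:
  assumes cb: "cost_bound l m f p" and d: "d = 1 \<or> d = - 1"
  shows "cost_bound l (Suc m) (\<lambda>i. f (iact d i)) (act d p)"
proof -
  have d': "act d i = d - i" for i using d by (auto simp: act_def)
  have m: "\<bar>p\<bar> \<le> int m" and 1: "\<And>i. i \<in> supp f \<Longrightarrow> \<bar>i\<bar> + \<bar>p - i\<bar> \<le> int m"
    and 2: "\<And>a b. a \<in> supp f \<Longrightarrow> b \<in> supp f \<Longrightarrow> 2 * \<bar>b - a\<bar> \<le> int m + \<bar>p\<bar>"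
    using cb by (auto simp: cost_bound_def)
  have "2 * \<bar>(d - b) - (d - a)\<bar> \<le> int (Suc m) + \<bar>d - p\<bar>" if "a \<in> supp f" "b \<in> supp f" for a b
  proof -
    have "\<bar>p\<bar> \<le> \<bar>d - p\<bar> + 1" using d by arith
    moreover have "\<bar>(d - b) - (d - a)\<bar> = \<bar>b - a\<bar>" by simp
    ultimately show ?thesis using 2[OF that] by simp
  qed
  moreover have "\<bar>d - i\<bar> + \<bar>(d - p) - (d - i)\<bar> \<le> int (Suc m)" if "i \<in> supp f" for i
    using 1[OF that] d by arith
  moreover have "\<bar>d - p\<bar> \<le> int (Suc m)" using m d by arith
  ultimately show ?thesis
    using cb by (simp add: cost_bound_def supp_comp lamp_wt_comp d')
qed

lemma cost_bound_word:
  assumes "f \<in> lampF"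
  obtains l m where "l + m = word_length W S (f, p)" "cost_bound l m f p"
proof -
  have "\<exists>l m g q. l + m = length ws \<and> foldr (\<otimes>\<^bsub>W\<^esub>) ws \<one>\<^bsub>W\<^esub> = (g, q) \<and> cost_bound l m g q"
    if "set ws \<subseteq> S" for ws
    using that
  proof (induction ws)
    case Nil
    have "cost_bound 0 0 (\<lambda>_. \<one>) 0" by (simp add: cost_bound_def)
    then show ?case by (auto simp: W_one)
  next
    case (Cons w ws)
    then obtain l m g q where IH: "l + m = length ws" "foldr (\<otimes>\<^bsub>W\<^esub>) ws \<one>\<^bsub>W\<^esub> = (g, q)" "cost_bound l m g q"
      by auto
    have g: "g \<in> lampF" using W.foldr_closed[of ws] Cons.prems IH(2) by (auto simp: W_carrier)
    consider d where "w = (\<lambda>_. \<one>, d)" "d = 1 \<or> d = - 1" | y where "w = (pt y, 0)" "y \<in> Z"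
      using Cons.prems by (auto simp: S_eq)
    then show ?case
    proof cases
      case 1
      have "foldr (\<otimes>\<^bsub>W\<^esub>) (w # ws) \<one>\<^bsub>W\<^esub> = (\<lambda>i. g (iact d i), act d q)"
        using IH(2) g 1 by (simp add: W_mult lampF_closed)
      then show ?thesis using cost_bound_move[OF IH(3) 1(2)] IH(1)
        by - (rule exI[of _ l], rule exI[of _ "Suc m"], simp)
    next
      case 2
      have "foldr (\<otimes>\<^bsub>W\<^esub>) (w # ws) \<one>\<^bsub>W\<^esub> = (\<lambda>i. pt y i \<otimes> g i, q)"
        using IH(2) 2 by (simp add: W_mult)
      then show ?thesis using cost_bound_lamp[OF IH(3) g 2(2)] IH(1)
        by - (rule exI[of _ "Suc l"], rule exI[of _ m], simp)
    qed
  qed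
  moreover obtain ws where ws: "set ws \<subseteq> S" "foldr (\<otimes>\<^bsub>W\<^esub>) ws \<one>\<^bsub>W\<^esub> = (f, p)"
    "length ws = word_length W S (f, p)"
    using W.shortest_word[of "(f, p)"] assms by (auto simp: W_carrier)
  ultimately obtain l m where "l + m = length ws" "cost_bound l m f p" by fastforce
  then show ?thesis using that ws(3) by simp
qed

subsection \<open>Conjugacy\<close>

lemma conj_W_iff:
  "conj_rel W (f, p) (f', p') \<longleftrightarrow> f \<in> lampF \<and> f' \<in> lampF \<and>
    (\<exists>\<theta>\<in>lampF. \<exists>q. (\<forall>i. \<theta> i \<otimes> f (iact q i) = f' i \<otimes> \<theta> (iact p' i)) \<and> act q p = act p' q)"
  unfolding conj_rel_def by (auto simp: W_carrier W_mult fun_eq_iff Bex_def)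

text \<open>
  Conjugation by the element with trivial lamps and cursor \<open>q\<close>.
\<close>

lemma conj_shift:
  assumes "f \<in> lampF" "act q p = act p' q"
  shows "conj_rel W (f, p) (\<lambda>i. f (iact q i), p')"
  unfolding conj_W_iff using assms lampF_comp[OF assms(1), of q]
  by (auto intro!: bexI[OF _ lampF_one] exI[of _ q] simp: lampF_closed)

text \<open>
  Conjugacy by an element \<open>(\<theta>, 0)\<close> of the base group. It leaves the cursor \<open>p\<close> in place.
\<close>

definition base_conj :: "(int \<Rightarrow> 'a) \<Rightarrow> (int \<Rightarrow> 'a) \<Rightarrow> int \<Rightarrow> bool" where
  "base_conj f f' p \<longleftrightarrow> f \<in> lampF \<and> f' \<in> lampF \<and>
    (\<exists>\<theta>\<in>lampF. \<forall>i. \<theta> i \<otimes> f i = f' i \<otimes> \<theta> (iact p i))"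

lemma base_conjD: "base_conj f f' p \<Longrightarrow> conj_rel W (f, p) (f', p)"
  unfolding base_conj_def conj_W_iff by (auto intro!: bexI exI[of _ 0])

text \<open>
  Every conjugation is a shift followed by a conjugation in the base group.
\<close>

lemma conj_W_shift_base:
  assumes "conj_rel W (f, p) (f', p')"
  obtains q where "act q p = act p' q" "base_conj (\<lambda>i. f (iact q i)) f' p'"
  using assms unfolding conj_W_iff base_conj_def by (blast intro: lampF_comp)

lemma base_conj_refl: "f \<in> lampF \<Longrightarrow> base_conj f f p"
  unfolding base_conj_def by (auto intro!: bexI[OF _ lampF_one] simp: lampF_closed)

lemma base_conj_trans:
  assumes "base_conj f g p" "base_conj g h p"
  shows "base_conj f h p"
proof -
  obtain \<theta> \<eta> where t: "\<theta> \<in> lampF" "\<eta> \<in> lampF" "\<And>i. \<theta> i \<otimes> f i = g i \<otimes> \<theta> (iact p i)"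
    "\<And>i. \<eta> i \<otimes> g i = h i \<otimes> \<eta> (iact p i)" and fgh: "f \<in> lampF" "g \<in> lampF" "h \<in> lampF"
    using assms unfolding base_conj_def by blast
  have "(\<lambda>i. \<eta> i \<otimes> \<theta> i) \<in> lampF"
  proof (rule lampFI)
    show "supp (\<lambda>i. \<eta> i \<otimes> \<theta> i) \<subseteq> supp \<theta> \<union> supp \<eta>" by (auto simp: supp_def)
  qed (use t(1,2) in \<open>auto simp: lampF_closed lampF_finite\<close>)
  moreover have "(\<eta> i \<otimes> \<theta> i) \<otimes> f i = h i \<otimes> (\<eta> (iact p i) \<otimes> \<theta> (iact p i))" for i
  proof -
    note c = lampF_closed[OF t(1)] lampF_closed[OF t(2)] lampF_closed[OF fgh(1)]
      lampF_closed[OF fgh(2)] lampF_closed[OF fgh(3)]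
    have "(\<eta> i \<otimes> \<theta> i) \<otimes> f i = \<eta> i \<otimes> (g i \<otimes> \<theta> (iact p i))" using c t(3) by (simp add: m_assoc)
    also have "\<dots> = h i \<otimes> \<eta> (iact p i) \<otimes> \<theta> (iact p i)" using c t(4)[symmetric] by (simp add: m_assoc)
    finally show ?thesis using c by (simp add: m_assoc)
  qed
  ultimately show ?thesis using fgh unfolding base_conj_def
    by (intro conjI bexI[of _ "\<lambda>i. \<eta> i \<otimes> \<theta> i"]) auto
qed

lemma base_conj_shift:
  assumes "base_conj f g p" "act q p = act p' q"
  shows "base_conj (\<lambda>i. f (iact q i)) (\<lambda>i. g (iact q i)) p'"
proof -
  obtain \<theta> where t: "\<theta> \<in> lampF" "\<And>i. \<theta> i \<otimes> f i = g i \<otimes> \<theta> (iact p i)"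
    and fg: "f \<in> lampF" "g \<in> lampF"
    using assms unfolding base_conj_def by blast
  have "iact p (iact q i) = iact q (iact p' i)" for i
    using assms(2) by (auto simp: act_def iact_def split: if_splits; presburger)
  then show ?thesis unfolding base_conj_def
    using fg t lampF_comp by (auto intro!: bexI[of _ "\<lambda>i. \<theta> (iact q i)"])
qed

text \<open>
  If the cursor moves \<open>j\<close> to a different position, the lamps at \<open>j\<close> and at its image can be merged at either of
  the two. The conjugating configuration has a single lamp, at \<open>j\<close>, and cancels the one that disappears.
\<close>

lemma base_conj_move:
  assumes f: "f \<in> lampF" and j: "act p j \<noteq> j"
  shows "base_conj f (f(act p j := \<one>, j := f (act p j) \<otimes> f j)) p"
    and "base_conj f (f(j := \<one>, act p j := f (act p j) \<otimes> f j)) p"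
proof -
  note c = lampF_closed[OF f]
  have ij: "iact p j \<noteq> j" using j iact_eq_iff[of p j j] by auto
  show "base_conj f (f(act p j := \<one>, j := f (act p j) \<otimes> f j)) p"
    unfolding base_conj_def
  proof (intro conjI bexI allI)
    show "(\<lambda>_. \<one>)(j := f (act p j)) \<in> lampF" by (intro lampF_upd lampF_one c)
    show "f(act p j := \<one>, j := f (act p j) \<otimes> f j) \<in> lampF" using c f by (intro lampF_upd) auto
    fix i
    show "((\<lambda>_. \<one>)(j := f (act p j))) i \<otimes> f i =
        (f(act p j := \<one>, j := f (act p j) \<otimes> f j)) i \<otimes> ((\<lambda>_. \<one>)(j := f (act p j))) (iact p i)"
      using c j ij by (auto simp: iact_eq_iff)
  qed (rule f)
  show "base_conj f (f(j := \<one>, act p j := f (act p j) \<otimes> f j)) p"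
    unfolding base_conj_def
  proof (intro conjI bexI allI)
    show "(\<lambda>_. \<one>)(j := inv (f j)) \<in> lampF" using c by (intro lampF_upd lampF_one) auto
    show "f(j := \<one>, act p j := f (act p j) \<otimes> f j) \<in> lampF" using c f by (intro lampF_upd) auto
    fix i
    show "((\<lambda>_. \<one>)(j := inv (f j))) i \<otimes> f i =
        (f(j := \<one>, act p j := f (act p j) \<otimes> f j)) i \<otimes> ((\<lambda>_. \<one>)(j := inv (f j))) (iact p i)"
      using c j ij by (auto simp: iact_eq_iff m_assoc)
  qed (rule f)
qed

end

section \<open>Normal forms of lamp configurations\<close>

lemma even_act: "even (act p q) \<longleftrightarrow> (even p \<longleftrightarrow> even q)"
  by (simp add: act_def)

text \<open>
  In the infinite dihedral group, a translation is conjugate only to itself and its inverse. Reflections are conjugate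
  only to reflections, and only if their numbers agree modulo \<open>4\<close>.
\<close>

lemma conj_cursor:
  assumes "act q p = act p' q"
  shows "p' = (if even p then (if even q then p else - p) else (if even q then p + 2 * q else 2 * q - p))"
proof -
  have "even p' \<longleftrightarrow> even p" using even_act[of q p] even_act[of p' q] assms by auto
  then show ?thesis using assms unfolding act_def by (auto split: if_splits)
qed

text \<open>
  The list \<open>xs\<close> written on the line from position \<open>a\<close> on, with the default value \<open>d\<close> elsewhere.
\<close>

definition place :: "'b \<Rightarrow> int \<Rightarrow> 'b list \<Rightarrow> int \<Rightarrow> 'b" where
  "place d a xs i = (if a \<le> i \<and> i < a + int (length xs) then xs ! nat (i - a) else d)"

lemma place_window:
  assumes "\<And>i. i \<notin> {a..<a + int n} \<Longrightarrow> f i = d"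
  shows "place d a (map (\<lambda>k. f (a + int k)) [0..<n]) = f"
  using assms by (fastforce simp: place_def fun_eq_iff)

lemma place_inj:
  assumes "place d a xs = place d a ys" "length xs = length ys"
  shows "xs = ys"
proof (rule nth_equalityI)
  fix k assume "k < length xs"
  then show "xs ! k = ys ! k"
    using fun_cong[OF assms(1), of "a + int k"] assms(2) by (simp add: place_def)
qed (rule assms(2))

context gen_group
begin

interpretation W: gen_group W S
  by (rule gen_group_W)

lemma supp_place: "supp (place \<one> a xs) \<subseteq> {a..<a + int (length xs)}"
  by (auto simp: supp_def place_def split: if_splits)

lemma place_lampF: "xs \<in> lists (carrier G) \<Longrightarrow> place \<one> a xs \<in> lampF"
  by (rule lampFI[OF _ _ supp_place]) (auto simp: place_def in_lists_conv_set)

lemma lamp_wt_place: "lamp_wt (place \<one> a xs) = lwt len xs"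
proof -
  have "lamp_wt (place \<one> a xs) = (\<Sum>i\<in>{a..<a + int (length xs)}. len (place \<one> a xs i))"
    by (rule lamp_wt_superset[OF _ supp_place]) simp
  also have "\<dots> = (\<Sum>k<length xs. len (place \<one> a xs (a + int k)))"
    by (rule sum.reindex_bij_witness[of _ "\<lambda>k. a + int k" "\<lambda>i. nat (i - a)"]) auto
  also have "\<dots> = (\<Sum>k<length xs. len (xs ! k))"
    by (intro sum.cong) (auto simp: place_def)
  finally show ?thesis by (simp add: lwt_nth)
qed

lemma base_conj_sym:
  assumes "base_conj f g p"
  shows "base_conj g f p"
proof -
  obtain \<theta> where t: "\<theta> \<in> lampF" "\<And>i. \<theta> i \<otimes> f i = g i \<otimes> \<theta> (iact p i)"
    and fg: "f \<in> lampF" "g \<in> lampF"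
    using assms unfolding base_conj_def by blast
  have "(\<lambda>i. inv (\<theta> i)) \<in> lampF"
  proof (rule lampFI)
    show "supp (\<lambda>i. inv (\<theta> i)) \<subseteq> supp \<theta>" by (auto simp: supp_def)
  qed (use t(1) in \<open>auto simp: lampF_closed lampF_finite\<close>)
  moreover have "inv (\<theta> i) \<otimes> g i = f i \<otimes> inv (\<theta> (iact p i))" for i
  proof -
    note c = lampF_closed[OF t(1)] lampF_closed[OF fg(1)] lampF_closed[OF fg(2)]
    have "inv (\<theta> i) \<otimes> g i = inv (\<theta> i) \<otimes> (g i \<otimes> \<theta> (iact p i)) \<otimes> inv (\<theta> (iact p i))"
      using c by (simp add: m_assoc)
    also have "\<dots> = inv (\<theta> i) \<otimes> (\<theta> i \<otimes> f i) \<otimes> inv (\<theta> (iact p i))" by (simp only: t(2))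
    also have "\<dots> = f i \<otimes> inv (\<theta> (iact p i))" using c by (simp flip: m_assoc)
    finally show ?thesis .
  qed
  ultimately show ?thesis using fg unfolding base_conj_def
    by (intro conjI bexI[of _ "\<lambda>i. inv (\<theta> i)"]) auto
qed

text \<open>
  Lamps outside \<open>A\<close> are moved one at a time along the cursor, within \<open>B\<close>. Each move lowers the measure
  \<open>e\<close>, and merging never increases the total weight.
\<close>

lemma gather:
  fixes e :: "int \<Rightarrow> nat"
  assumes "f \<in> lampF" "supp f \<subseteq> B"
    and step: "\<And>i. i \<in> B \<Longrightarrow> i \<notin> A \<Longrightarrow> \<exists>j\<in>B. j \<noteq> i \<and> (act p j = i \<or> act p i = j) \<and> e j < e i"
  shows "\<exists>f'. base_conj f f' p \<and> lamp_wt f' \<le> lamp_wt f \<and> supp f' \<subseteq> A \<inter> B"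
  using assms(1,2)
proof (induction "\<Sum>i\<in>supp f. e i" arbitrary: f rule: less_induct)
  case less
  show ?case
  proof (cases "supp f \<subseteq> A")
    case True
    then show ?thesis using less.prems base_conj_refl by blast
  next
    case False
    then obtain i where i: "i \<in> supp f" "i \<notin> A" by blast
    then obtain j where j: "j \<in> B" "j \<noteq> i" "act p j = i \<or> act p i = j" "e j < e i"
      using step less.prems(2) by blast
    note c = lampF_closed[OF less.prems(1)]
    obtain g where g: "g \<in> carrier G" "len g \<le> len (f i) + len (f j)"
      "base_conj f (f(i := \<one>, j := g)) p"
    proof (cases "act p j = i")
      case True
      show ?thesis
        using that[of "f i \<otimes> f j"] base_conj_move(1)[OF less.prems(1), of p j] True j(2) c
          word_length_mult[of "f i" "f j"] by auto
    next
      case False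
      then have "act p i = j" using j(3) by simp
      then show ?thesis
        using that[of "f j \<otimes> f i"] base_conj_move(2)[OF less.prems(1), of p i] j(2) c
          word_length_mult[of "f j" "f i"] by auto
    qed
    let ?f = "f(i := \<one>, j := g)"
    have f': "?f \<in> lampF" using g(3) by (simp add: base_conj_def)
    have sup: "supp ?f \<subseteq> insert j (supp f - {i})" using j(2) by (auto simp: supp_def split: if_splits)
    have fin: "finite (supp f)" using less.prems(1) by (rule lampF_finite)
    have "(\<Sum>k\<in>supp ?f. e k) \<le> (\<Sum>k\<in>insert j (supp f - {i}). e k)"
      using sup fin by (intro sum_mono2) auto
    also have "\<dots> \<le> e j + (\<Sum>k\<in>supp f - {i}. e k)"
      using fin by (simp add: sum.insert_if)
    also have "\<dots> < e i + (\<Sum>k\<in>supp f - {i}. e k)" using j(4) by simp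
    also have "\<dots> = (\<Sum>k\<in>supp f. e k)" using fin i(1) by (simp add: sum.remove)
    finally have "(\<Sum>k\<in>supp ?f. e k) < (\<Sum>k\<in>supp f. e k)" .
    moreover have "supp ?f \<subseteq> B" using sup less.prems(2) j(1) by auto
    ultimately obtain f' where "base_conj ?f f' p" "lamp_wt f' \<le> lamp_wt ?f" "supp f' \<subseteq> A \<inter> B"
      using less.hyps f' by blast
    moreover have "lamp_wt ?f \<le> lamp_wt f"
      using lamp_wt_upd2[OF less.prems(1), of i j \<one> g] j(2) g by simp
    ultimately show ?thesis using base_conj_trans[OF g(3)] le_trans by blast
  qed
qed

subsection \<open>Cursor a translation\<close>

definition trans_part :: "nat \<Rightarrow> ((int \<Rightarrow> 'a) \<times> int) set" where
  "trans_part n = {(f, p). f \<in> lampF \<and> \<bar>p\<bar> = 2 * int n}"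

lemma conj_closed_trans_part: "conj_closed W (trans_part n)"
  unfolding conj_closed_def
proof (intro conjI ballI allI impI)
  fix x y assume x: "x \<in> trans_part n" and xy: "conj_rel W x y"
  obtain f p g q where fg: "x = (f, p)" "y = (g, q)" by (cases x, cases y) auto
  then obtain r where "act r p = act q r" "g \<in> lampF" using xy by (auto simp: conj_W_iff)
  moreover have "\<bar>p\<bar> = 2 * int n" using x fg by (simp add: trans_part_def)
  moreover have "even p" using \<open>\<bar>p\<bar> = 2 * int n\<close> by presburger
  ultimately show "y \<in> trans_part n"
    using conj_cursor[of r p q] fg by (auto simp: trans_part_def split: if_splits)
qed (auto simp: trans_part_def W_carrier)

text \<open>
  The conjugating \<open>\<theta>\<close> is invariant under the translation by \<open>2 * n\<close> wherever both configurations are trivial, that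
  is, outside the window. Its finite support can then have no least element below \<open>0\<close> and no greatest
  element from \<open>0\<close> on, so it is empty.
\<close>

lemma base_conj_translation_unique:
  assumes "base_conj f g (2 * int n)" "n > 0" "supp f \<subseteq> {0..<2 * int n}" "supp g \<subseteq> {0..<2 * int n}"
  shows "f = g"
proof -
  obtain \<theta> where t: "\<theta> \<in> lampF" "\<And>i. \<theta> i \<otimes> f i = g i \<otimes> \<theta> (i - 2 * int n)"
    and fg: "f \<in> lampF" "g \<in> lampF"
    using assms(1) unfolding base_conj_def iact_def by auto
  note c = lampF_closed[OF t(1)] lampF_closed[OF fg(1)] lampF_closed[OF fg(2)]
  have outside: "\<theta> i = \<theta> (i - 2 * int n)" if "i \<notin> {0..<2 * int n}" for i
  proof -
    have "f i = \<one>" "g i = \<one>" using that assms(3,4) by (auto simp: supp_def)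
    then show ?thesis using t(2)[of i] c by simp
  qed
  have fin: "finite (supp \<theta>)" using t(1) by (rule lampF_finite)
  have "supp \<theta> = {}"
  proof (rule ccontr)
    assume ne: "supp \<theta> \<noteq> {}"
    have lo: "Min (supp \<theta>) \<in> supp \<theta>" and hi: "Max (supp \<theta>) \<in> supp \<theta>"
      using ne fin by auto
    have "\<not> Min (supp \<theta>) < 0"
    proof
      assume "Min (supp \<theta>) < 0"
      then have "Min (supp \<theta>) - 2 * int n \<in> supp \<theta>"
        using lo outside[of "Min (supp \<theta>)"] by (auto simp: supp_def)
      then show False using Min_le[OF fin] assms(2) by fastforce
    qed
    then have "Max (supp \<theta>) \<ge> 0" using Min_le[OF fin hi] by linarith
    then have "Max (supp \<theta>) + 2 * int n \<in> supp \<theta>"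
      using hi outside[of "Max (supp \<theta>) + 2 * int n"] by (auto simp: supp_def)
    then show False using Max_ge[OF fin] assms(2) by fastforce
  qed
  then have "\<theta> i = \<one>" for i by (auto simp: supp_def)
  then show ?thesis using t(2) c by (auto simp: fun_eq_iff)
qed

text \<open>
  After a shift by two places to the left, the two lamps that left the window \<open>{0..<2 * n}\<close> reenter it at the right
  end.
\<close>

lemma base_conj_rotate:
  assumes xs: "xs \<in> lists (carrier G)" "length xs = 2 * n" and n: "n > 0"
  shows "base_conj (\<lambda>i. place \<one> 0 xs (i + 2)) (place \<one> 0 (rotate 2 xs)) (2 * int n)"
proof -
  define g where "g = (\<lambda>i. place \<one> 0 xs (i + 2))"
  define g1 where "g1 = g(- 2 := \<one>, 2 * int n - 2 := g (- 2))"
  define g2 where "g2 = g1(- 1 := \<one>, 2 * int n - 1 := g1 (- 1))"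
  have "g = (\<lambda>i. place \<one> 0 xs (iact (- 2) i))" by (simp add: g_def iact_def)
  then have g: "g \<in> lampF" using lampF_comp[OF place_lampF[OF xs(1)]] by simp
  have "g (2 * int n - 2) = \<one>" by (simp add: g_def place_def xs)
  then have 1: "base_conj g g1 (2 * int n)"
    using base_conj_move(2)[OF g, of "2 * int n" "- 2"] n lampF_closed[OF g]
    by (simp add: act_def g1_def)
  then have g1: "g1 \<in> lampF" by (simp add: base_conj_def)
  have "g1 (2 * int n - 1) = \<one>" using n by (simp add: g1_def g_def place_def xs)
  then have 2: "base_conj g1 g2 (2 * int n)"
    using base_conj_move(2)[OF g1, of "2 * int n" "- 1"] n lampF_closed[OF g1]
    by (simp add: act_def g2_def)
  have "g2 = place \<one> 0 (rotate 2 xs)"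
  proof
    fix i :: int
    consider "i < 0 \<or> i \<ge> 2 * int n" | "0 \<le> i \<and> i < 2 * int n - 2"
      | "i = 2 * int n - 2" | "i = 2 * int n - 1" by linarith
    then show "g2 i = place \<one> 0 (rotate 2 xs) i"
    proof cases
      case 1
      then show ?thesis using n by (auto simp: g2_def g1_def g_def place_def xs)
    next
      case 2
      then have "rotate 2 xs ! nat i = xs ! nat (i + 2)"
        using xs by (subst nth_rotate) (auto simp: nat_add_distrib add.commute)
      with 2 show ?thesis using n by (auto simp: g2_def g1_def g_def place_def xs)
    next
      case 3
      then have "nat i < 2 * n" "nat i + 2 = 2 * n" using n by auto
      then have "nat i < 2 * n" "(nat i + 2) mod (2 * n) = 0" by simp_all
      then have "rotate 2 xs ! nat i = xs ! 0"
        using xs by (subst nth_rotate) (auto simp: add.commute)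
      with 3 show ?thesis using n by (auto simp: g2_def g1_def g_def place_def xs)
    next
      case 4
      then have "nat i < 2 * n" "nat i + 2 = 2 * n + 1" using n by auto
      then have "nat i < 2 * n" "(nat i + 2) mod (2 * n) = 1"
        using n mod_add_self1[of "2 * n" 1] by simp_all
      then have "rotate 2 xs ! nat i = xs ! 1"
        using xs by (subst nth_rotate) (auto simp: add.commute)
      with 4 show ?thesis using n by (auto simp: g2_def g1_def g_def place_def xs)
    qed
  qed
  with base_conj_trans[OF 1 2] show ?thesis by (simp add: g_def)
qed

lemma base_conj_rotate_iter:
  assumes xs: "xs \<in> lists (carrier G)" "length xs = 2 * n" and n: "n > 0"
  shows "base_conj (\<lambda>i. place \<one> 0 xs (iact (- 2 * int k) i)) (place \<one> 0 ((rotate 2 ^^ k) xs)) (2 * int n)"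
proof (induction k)
  case 0
  show ?case using base_conj_refl[OF place_lampF[OF xs(1)]] by simp
next
  case (Suc k)
  let ?ys = "(rotate 2 ^^ k) xs"
  have ys: "?ys \<in> lists (carrier G)" "length ?ys = 2 * n"
    using xs by (induction k) (auto simp: in_lists_conv_set)
  have "base_conj (\<lambda>i. place \<one> 0 xs (iact (- 2 * int k) (iact (- 2) i)))
      (\<lambda>i. place \<one> 0 ?ys (iact (- 2) i)) (2 * int n)"
    by (rule base_conj_shift[OF Suc]) (simp add: act_def)
  moreover have "iact (- 2 * int k) (iact (- 2) i) = iact (- 2 * int (Suc k)) i" for i
    by (simp add: iact_def)
  ultimately have 1: "base_conj (\<lambda>i. place \<one> 0 xs (iact (- 2 * int (Suc k)) i))
      (\<lambda>i. place \<one> 0 ?ys (iact (- 2) i)) (2 * int n)" by (simp only:)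
  have 2: "base_conj (\<lambda>i. place \<one> 0 ?ys (iact (- 2) i)) (place \<one> 0 (rotate 2 ?ys)) (2 * int n)"
    using base_conj_rotate[OF ys n] by (simp add: iact_def)
  show ?case unfolding funpow.simps comp_apply by (rule base_conj_trans[OF 1 2])
qed

definition trans_lists :: "nat \<Rightarrow> 'a list set" where
  "trans_lists n = {xs \<in> lists (carrier G). length xs = 2 * n}"

lemma rotate_trans_lists: "rotate 2 ` trans_lists n \<subseteq> trans_lists n"
  by (auto simp: trans_lists_def in_lists_conv_set)

lemma rotate_2_iter: "(rotate 2 ^^ k) xs = rotate (2 * k) xs"
  by (induction k) (simp_all add: rotate_rotate)

lemma rotate_iter_trans_lists: "xs \<in> trans_lists n \<Longrightarrow> (rotate 2 ^^ k) xs \<in> trans_lists n"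
  by (simp add: rotate_2_iter trans_lists_def in_lists_conv_set)

lemma rotate_period_trans_lists: "xs \<in> trans_lists n \<Longrightarrow> (rotate 2 ^^ n) xs = xs"
  by (simp add: rotate_2_iter trans_lists_def)

text \<open>
  A cursor that commutes with the translation is itself an even translation, and such shifts act on
  the window by rotations of two places. Shifts to the left suffice, by symmetry of conjugacy.
\<close>

lemma conj_trans_iff:
  assumes xs: "xs \<in> trans_lists n" and ys: "ys \<in> trans_lists n" and n: "n > 0"
  shows "conj_rel W (place \<one> 0 xs, 2 * int n) (place \<one> 0 ys, 2 * int n)
    \<longleftrightarrow> (xs, ys) \<in> iterate_rel (trans_lists n) (rotate 2)"
proof
  have one: "(us, vs) \<in> iterate_rel (trans_lists n) (rotate 2)"
    if us: "us \<in> trans_lists n" and vs: "vs \<in> trans_lists n"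
      and b: "base_conj (\<lambda>i. place \<one> 0 us (iact (- 2 * int k) i)) (place \<one> 0 vs) (2 * int n)" for us vs k
  proof -
    let ?us = "(rotate 2 ^^ k) us"
    have "base_conj (place \<one> 0 ?us) (place \<one> 0 vs) (2 * int n)"
      using base_conj_rotate_iter[of us n k] us n b
      by (blast intro: base_conj_trans base_conj_sym dest: trans_lists_def[THEN equalityD1, THEN subsetD])
    moreover have "?us \<in> trans_lists n" using us by (rule rotate_iter_trans_lists)
    ultimately have "place \<one> 0 ?us = place \<one> 0 vs"
      using supp_place[of 0 ?us] supp_place[of 0 vs] vs n
      by (intro base_conj_translation_unique) (auto simp: trans_lists_def)
    then have "?us = vs" using \<open>?us \<in> trans_lists n\<close> vs
      by (intro place_inj) (auto simp: trans_lists_def)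
    then show ?thesis using us vs by (auto simp: iterate_rel_def)
  qed
  assume conj: "conj_rel W (place \<one> 0 xs, 2 * int n) (place \<one> 0 ys, 2 * int n)"
  obtain q where q: "act q (2 * int n) = act (2 * int n) q"
    and b: "base_conj (\<lambda>i. place \<one> 0 xs (iact q i)) (place \<one> 0 ys) (2 * int n)"
    using conj_W_shift_base[OF conj] by blast
  have ev: "even q" using q n by (auto simp: act_def split: if_splits)
  show "(xs, ys) \<in> iterate_rel (trans_lists n) (rotate 2)"
  proof (cases "q \<le> 0")
    case True
    with ev have "q = - 2 * int (nat (- q div 2))" by (auto elim: evenE)
    with b show ?thesis using one[OF xs ys, of "nat (- q div 2)"] by simp
  next
    case False
    with ev have q': "- q = - 2 * int (nat (q div 2))" by (auto elim: evenE)
    have "base_conj (\<lambda>i. place \<one> 0 xs (iact q (iact (- q) i))) (\<lambda>i. place \<one> 0 ys (iact (- q) i)) (2 * int n)"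
      by (rule base_conj_shift[OF b]) (use ev in \<open>simp add: act_def\<close>)
    moreover have "iact q (iact (- q) i) = i" for i using ev by (simp add: iact_def)
    ultimately have "base_conj (\<lambda>i. place \<one> 0 ys (iact (- q) i)) (place \<one> 0 xs) (2 * int n)"
      by (simp add: base_conj_sym)
    then have "(ys, xs) \<in> iterate_rel (trans_lists n) (rotate 2)"
      using one[OF ys xs, of "nat (q div 2)"] q' by simp
    then show ?thesis
      using iterate_rel_equiv[OF rotate_trans_lists n rotate_period_trans_lists]
      by (meson equivE symD)
  qed
next
  assume "(xs, ys) \<in> iterate_rel (trans_lists n) (rotate 2)"
  then obtain k where k: "ys = (rotate 2 ^^ k) xs" by (auto simp: iterate_rel_def)
  have xs': "xs \<in> lists (carrier G)" "length xs = 2 * n" using xs by (auto simp: trans_lists_def)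
  have "conj_rel W (place \<one> 0 xs, 2 * int n) (\<lambda>i. place \<one> 0 xs (iact (- 2 * int k) i), 2 * int n)"
    by (rule conj_shift[OF place_lampF[OF xs'(1)]]) (simp add: act_def)
  moreover note base_conjD[OF base_conj_rotate_iter[OF xs' n, of k]]
  ultimately show "conj_rel W (place \<one> 0 xs, 2 * int n) (place \<one> 0 ys, 2 * int n)"
    unfolding k by (rule W.conj_rel_trans)
qed

text \<open>
  The walk from \<open>0\<close> to \<open>2 * n\<close> passes the whole window, so the length is \<open>2 * n\<close> plus the weight of the
  lamps. No word is shorter, since the cursor has to travel that far and gathering does not add weight.
\<close>

lemma conj_gf_trans_quotient:
  assumes n: "n > 0"
  shows "conj_gf W S (trans_part n) =
    gf (trans_lists n // iterate_rel (trans_lists n) (rotate 2)) (qwt (\<lambda>xs. 2 * n + lwt len xs))"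
proof (rule W.conj_gf_quotient[OF conj_closed_trans_part])
  let ?rep = "\<lambda>xs. (place \<one> 0 xs, 2 * int n)"
  fix xs assume xs: "xs \<in> trans_lists n"
  then have f: "place \<one> 0 xs \<in> lampF" "supp (place \<one> 0 xs) \<subseteq> {0..<2 * int n}"
    using place_lampF[of xs 0] supp_place[of 0 xs] by (auto simp: trans_lists_def)
  then show "?rep xs \<in> trans_part n" by (simp add: trans_part_def)
  have "supp (place \<one> 0 xs) \<subseteq> {min 0 (2 * int n)..max 0 (2 * int n)}" using f(2) by auto
  from W.word_length_le_spelled[OF spelled_between[OF f(1) this]]
  show "word_length W S (?rep xs) \<le> 2 * n + lwt len xs" by (simp add: lamp_wt_place nat_mult_distrib)
next
  fix x assume "x \<in> trans_part n"
  then obtain f p where x: "x = (f, p)" "f \<in> lampF" "\<bar>p\<bar> = 2 * int n" by (auto simp: trans_part_def)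
  obtain l m where lm: "l + m = word_length W S (f, p)" "cost_bound l m f p"
    using cost_bound_word[OF x(2)] .
  have "even p" using x(3) by presburger
  obtain g where g: "g \<in> lampF" "lamp_wt g = lamp_wt f" "conj_rel W (f, p) (g, 2 * int n)"
  proof (cases "p \<ge> 0")
    case True
    then show ?thesis using that[of f] x W.conj_rel_refl[of "(f, p)"] by (auto simp: W_carrier)
  next
    case False
    have "conj_rel W (f, p) (\<lambda>i. f (iact 1 i), 2 * int n)"
      using x False by (intro conj_shift) (auto simp: act_def)
    then show ?thesis using that[of "\<lambda>i. f (iact 1 i)"] lampF_comp[OF x(2)] lamp_wt_comp by auto
  qed
  have "\<exists>h. base_conj g h (2 * int n) \<and> lamp_wt h \<le> lamp_wt g \<and> supp h \<subseteq> {0..<2 * int n} \<inter> UNIV"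
    \<comment> \<open>The measure is twice the distance from the midpoint of the window.\<close>
  proof (rule gather[OF g(1), where e = "\<lambda>i. nat \<bar>2 * i - 2 * int n + 1\<bar>"])
    fix i :: int assume i: "i \<notin> {0..<2 * int n}"
    show "\<exists>j\<in>UNIV. j \<noteq> i \<and> (act (2 * int n) j = i \<or> act (2 * int n) i = j) \<and>
        nat \<bar>2 * j - 2 * int n + 1\<bar> < nat \<bar>2 * i - 2 * int n + 1\<bar>"
    proof (cases "i < 0")
      case True
      then show ?thesis using n by (intro bexI[of _ "i + 2 * int n"]) (auto simp: act_def)
    next
      case False
      then show ?thesis using n i by (intro bexI[of _ "i - 2 * int n"]) (auto simp: act_def)
    qed
  qed simp
  then obtain h where h: "base_conj g h (2 * int n)" "lamp_wt h \<le> lamp_wt g" "supp h \<subseteq> {0..<2 * int n}"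
    by auto
  define xs where "xs = map (\<lambda>k. h (0 + int k)) [0..<2 * n]"
  have hF: "h \<in> lampF" using h(1) by (simp add: base_conj_def)
  have "xs \<in> trans_lists n" using lampF_closed[OF hF] by (auto simp: xs_def trans_lists_def)
  moreover have hxs: "place \<one> 0 xs = h"
    unfolding xs_def by (rule place_window) (use h(3) in \<open>auto simp: supp_def\<close>)
  moreover have "conj_rel W (h, 2 * int n) x"
    using W.conj_rel_trans[OF g(3) base_conjD[OF h(1)]] x(1) W.conj_rel_sym by blast
  moreover have "2 * n + lwt len xs \<le> word_length W S x"
    using lm h(2) g(2) x(1,3) lamp_wt_place[of 0 xs] hxs by (auto simp: cost_bound_def)
  ultimately show "\<exists>xs\<in>trans_lists n. conj_rel W (place \<one> 0 xs, 2 * int n) x \<and>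
      2 * n + lwt len xs \<le> word_length W S x" by auto
next
  fix xs ys assume "(xs, ys) \<in> iterate_rel (trans_lists n) (rotate 2)"
  then obtain k where "ys = rotate (2 * k) xs" by (auto simp: iterate_rel_def rotate_2_iter)
  moreover have "lwt len (rotate j xs) = lwt len xs" for j
  proof -
    have "sum_list (rotate1 zs) = sum_list zs" for zs :: "nat list" by (cases zs) auto
    then have "sum_list (rotate j zs) = sum_list zs" for zs :: "nat list"
      by (induction j) simp_all
    then show ?thesis by (simp flip: rotate_map)
  qed
  ultimately show "2 * n + lwt len xs = 2 * n + lwt len ys" by simp
qed (use conj_trans_iff[OF _ _ n] in \<open>auto simp: iterate_rel_def\<close>)

end

section \<open>Counting lists\<close>

text \<open>
  Lists whose last entry is not the default value \<open>d\<close>; these encode the finitely supported sequences.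
\<close>

definition trimmed :: "'b \<Rightarrow> 'b set \<Rightarrow> 'b list set" where
  "trimmed d K = {xs \<in> lists K. xs \<noteq> [] \<longrightarrow> last xs \<noteq> d}"

definition even_lists :: "'b set \<Rightarrow> 'b list set" where
  "even_lists K = {xs \<in> lists K. even (length xs)}"

definition odd_lists :: "'b set \<Rightarrow> 'b list set" where
  "odd_lists K = {xs \<in> lists K. odd (length xs)}"

text \<open>
  The weight of a list that is written on the line and visited by a closed walk.
\<close>

definition span_wt :: "('b \<Rightarrow> nat) \<Rightarrow> 'b list \<Rightarrow> nat" where
  "span_wt w xs = 2 * (length xs - 1) + lwt w xs"

text \<open>
  The empty list stands for the trivial configuration. Its weight \<open>span_wt\<close> is \<open>0\<close>, because subtraction is truncated.
\<close>

definition odd_spans :: "'b \<Rightarrow> 'b set \<Rightarrow> 'b list set" where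
  "odd_spans d K = {xs \<in> lists K. xs = [] \<or> odd (length xs) \<and> hd xs \<noteq> d \<and> last xs \<noteq> d}"

definition even_spans :: "'b \<Rightarrow> 'b set \<Rightarrow> 'b list set" where
  "even_spans d K = {xs \<in> lists K. xs \<noteq> [] \<and> even (length xs) \<and> hd xs \<noteq> d \<and> last xs \<noteq> d}"

lemma lwt_add: "lwt (\<lambda>c. w c + k) xs = lwt w xs + k * length xs"
  by (induction xs) auto

lemma list_sandwich:
  assumes "length xs \<ge> 2"
  obtains x ys y where "xs = x # ys @ [y]"
proof -
  obtain x zs where "xs = x # zs" using assms by (cases xs) auto
  moreover obtain ys y where "zs = ys @ [y]" using assms \<open>xs = x # zs\<close> by (cases zs rule: rev_cases) auto
  ultimately show ?thesis using that by blast
qed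

locale weighted_set =
  fixes K :: "'b set" and w :: "'b \<Rightarrow> nat" and d :: 'b
  assumes fin: "fin_wt K w" and d: "d \<in> K" "w d = 0"
begin

abbreviation "T \<equiv> gf K w"

text \<open>
  The cost of an entry together with the two moves, there and back, that pay for its position.
\<close>

definition v :: "'b \<Rightarrow> nat" where
  "v c = w c + 2"

lemma v_eq: "v = (\<lambda>c. w c + 2)"
  by (rule ext) (rule v_def)

lemma lwt_v: "lwt v xs = lwt w xs + 2 * length xs"
  unfolding v_eq by (rule lwt_add)

lemma fin_v: "fin_wt K v"
  using fin by (rule fin_wt_mono) (simp add: v_def)

lemma gf_v: "gf K v = fps_X ^ 2 * T"
  unfolding v_eq by (rule gf_shift)

lemma fin_lists_v: "fin_wt (lists K) (lwt v)"
  using fin_v by (rule fin_wt_lists) (simp add: v_def)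

lemma fin_nontriv: "fin_wt (K - {d}) w"
  using fin by (rule fin_wt_subset) simp

lemma gf_nontriv: "gf (K - {d}) w = T - 1"
  using gf_Diff_singleton[OF fin d(1)] d(2) by simp

lemma
  shows gf_trimmed: "gf (trimmed d K) (lwt v) = (1 - fps_X ^ 2) / (1 - fps_X ^ 2 * T)"
    and fin_trimmed: "fin_wt (trimmed d K) (lwt v)"
proof -
  let ?h = "\<lambda>(xs, c). xs @ [c]"
  have eq: "trimmed d K = {[]} \<union> ?h ` (lists K \<times> (K - {d}))"
  proof (rule equalityI; rule subsetI)
    fix xs assume "xs \<in> trimmed d K"
    then show "xs \<in> {[]} \<union> ?h ` (lists K \<times> (K - {d}))"
      by (cases xs rule: rev_cases) (auto simp: trimmed_def image_iff)
  qed (auto simp: trimmed_def)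
  have inj: "inj_on ?h (lists K \<times> (K - {d}))" by (auto simp: inj_on_def)
  have fin_nv: "fin_wt (K - {d}) v" using fin_v by (rule fin_wt_subset) simp
  note I = fin_lists_v fin_nv inj
  have finI: "fin_wt (?h ` (lists K \<times> (K - {d}))) (lwt v)"
    by (rule fin_wt_image_Times[OF I]) auto
  show "fin_wt (trimmed d K) (lwt v)"
    unfolding eq by (rule fin_wt_Un[OF fin_wt_finite finI]) simp
  define i where "i = inverse (1 - fps_X ^ 2 * T)"
  have i: "(1 - fps_X ^ 2 * T) * i = 1"
    unfolding i_def by (rule inverse_mult_eq_1') (simp add: power2_eq_square mult.assoc)
  have "gf (trimmed d K) (lwt v) = gf {[]} (lwt v) + gf (?h ` (lists K \<times> (K - {d}))) (lwt v)"
    unfolding eq by (rule gf_Un[OF fin_wt_finite finI]) auto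
  also have "gf (?h ` (lists K \<times> (K - {d}))) (lwt v) = gf (lists K) (lwt v) * gf (K - {d}) v"
    by (rule gf_image_Times[OF I]) auto
  also have "gf (lists K) (lwt v) = i"
    using gf_lists[OF fin_v] by (simp add: gf_v i_def v_def)
  also have "gf (K - {d}) v = fps_X ^ 2 * (T - 1)"
    unfolding v_eq gf_shift gf_nontriv ..
  also have "gf {[]} (lwt v) = (1 - fps_X ^ 2 * T) * i"
    by (simp add: gf_singleton i)
  also have "(1 - fps_X ^ 2 * T) * i + i * (fps_X ^ 2 * (T - 1)) = (1 - fps_X ^ 2) * i"
    by (simp add: algebra_simps)
  finally show "gf (trimmed d K) (lwt v) = (1 - fps_X ^ 2) / (1 - fps_X ^ 2 * T)"
    unfolding i_def by (subst fps_divide_unit) (simp_all add: power2_eq_square mult.assoc)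
qed

text \<open>
  The configurations on a half-line: \<open>c\<close> is next to the axis, \<open>xs\<close> lists the positions further out, and the
  additional move crosses the axis.
\<close>

lemma gf_rays:
  "gf (K \<times> trimmed d K) (\<lambda>(c, xs). 1 + 2 * length xs + (w c + lwt w xs))
    = fps_X * T * ((1 - fps_X ^ 2) / (1 - fps_X ^ 2 * T))"
proof -
  have "gf (K \<times> trimmed d K) (\<lambda>(c, xs). 1 + 2 * length xs + (w c + lwt w xs))
      = gf (K \<times> trimmed d K) (\<lambda>x. (\<lambda>(c, xs). w c + lwt v xs) x + 1)"
    by (rule gf_cong) (auto simp: lwt_v)
  also have "\<dots> = fps_X ^ 1 * (T * gf (trimmed d K) (lwt v))"
    by (subst gf_shift, subst gf_Times[OF fin fin_trimmed]) (rule HOL.refl)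
  finally show ?thesis by (simp only: gf_trimmed power_one_right mult.assoc)
qed

lemma
  shows gf_even_lists: "gf (even_lists K) (lwt v) = inverse (1 - fps_X ^ 4 * T ^ 2)"
    and fin_even_lists: "fin_wt (even_lists K) (lwt v)"
    and gf_odd_lists: "gf (odd_lists K) (lwt v) = fps_X ^ 2 * T * inverse (1 - fps_X ^ 4 * T ^ 2)"
    and fin_odd_lists: "fin_wt (odd_lists K) (lwt v)"
proof -
  let ?vv = "\<lambda>(a, b). v a + v b"
  let ?h = "\<lambda>(ab, xs). fst ab # snd ab # xs" and ?g = "\<lambda>(a, xs). a # xs"
  show fe: "fin_wt (even_lists K) (lwt v)" and fo: "fin_wt (odd_lists K) (lwt v)"
    using fin_lists_v by (auto intro: fin_wt_subset simp: even_lists_def odd_lists_def)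
  have eqo: "odd_lists K = ?g ` (K \<times> even_lists K)"
  proof (rule equalityI; rule subsetI)
    fix xs assume "xs \<in> odd_lists K"
    then show "xs \<in> ?g ` (K \<times> even_lists K)"
      by (cases xs) (auto simp: odd_lists_def even_lists_def image_iff)
  qed (auto simp: odd_lists_def even_lists_def)
  have eqe: "even_lists K = {[]} \<union> ?h ` ((K \<times> K) \<times> even_lists K)"
  proof (rule equalityI; rule subsetI)
    fix xs assume xs: "xs \<in> even_lists K"
    show "xs \<in> {[]} \<union> ?h ` ((K \<times> K) \<times> even_lists K)"
    proof (cases xs)
      case (Cons a ys)
      with xs obtain b zs where "ys = b # zs" by (cases ys) (auto simp: even_lists_def)
      with Cons xs have "xs = ?h ((a, b), zs)" "((a, b), zs) \<in> (K \<times> K) \<times> even_lists K"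
        by (auto simp: even_lists_def)
      then show ?thesis by blast
    qed simp
  qed (auto simp: even_lists_def)
  have injh: "inj_on ?h ((K \<times> K) \<times> even_lists K)" by (auto simp: inj_on_def)
  note I = fin_wt_Times[OF fin_v fin_v] fe injh
  have *: "gf (even_lists K) (lwt v) = inverse (1 - gf (K \<times> K) ?vv)"
  proof (rule geometric_eq)
    have finI: "fin_wt (?h ` ((K \<times> K) \<times> even_lists K)) (lwt v)"
      by (rule fin_wt_image_Times[OF I]) auto
    have "gf (even_lists K) (lwt v) = gf {[]} (lwt v) + gf (?h ` ((K \<times> K) \<times> even_lists K)) (lwt v)"
      by (subst (1) eqe, rule gf_Un[OF fin_wt_finite finI]) auto
    also have "gf (?h ` ((K \<times> K) \<times> even_lists K)) (lwt v) = gf (K \<times> K) ?vv * gf (even_lists K) (lwt v)"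
      by (rule gf_image_Times[OF I]) auto
    also have "gf {[]} (lwt v) = 1" by (simp add: gf_singleton)
    finally show "gf (even_lists K) (lwt v) = 1 + gf (K \<times> K) ?vv * gf (even_lists K) (lwt v)" .
    have "{a \<in> K \<times> K. ?vv a = 0} = {}" by (auto simp: v_def)
    then show "fps_nth (gf (K \<times> K) ?vv) 0 = 0" by (simp add: gf_nth del: Collect_empty_eq)
  qed
  have "gf (K \<times> K) ?vv = fps_X ^ 2 * T * (fps_X ^ 2 * T)"
    unfolding gf_Times[OF fin_v fin_v] gf_v ..
  also have "\<dots> = fps_X ^ 4 * T ^ 2" by (simp add: power2_eq_square power4_eq_xxxx mult_ac)
  finally show e: "gf (even_lists K) (lwt v) = inverse (1 - fps_X ^ 4 * T ^ 2)" using * by simp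
  have injg: "inj_on ?g (K \<times> even_lists K)" by (auto simp: inj_on_def)
  have "gf (odd_lists K) (lwt v) = gf K v * gf (even_lists K) (lwt v)"
    unfolding eqo by (rule gf_image_Times[OF fin_v fe injg]) auto
  then show "gf (odd_lists K) (lwt v) = fps_X ^ 2 * T * inverse (1 - fps_X ^ 4 * T ^ 2)"
    by (simp add: e gf_v)
qed

text \<open>
  A list with nontrivial ends, decomposed into its two ends and an arbitrary middle part.
\<close>

definition ended :: "'b list set \<Rightarrow> 'b list set" where
  "ended P = (\<lambda>(xy, ys). fst xy # ys @ [snd xy]) ` (((K - {d}) \<times> (K - {d})) \<times> P)"

lemma
  assumes "fin_wt P (lwt v)"
  shows gf_ended: "gf (ended P) (span_wt w) = fps_X ^ 2 * (T - 1) ^ 2 * gf P (lwt v)"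
    and fin_ended: "fin_wt (ended P) (span_wt w)"
proof -
  let ?h = "\<lambda>(xy, ys). fst xy # ys @ [snd xy]"
  let ?A = "(K - {d}) \<times> (K - {d})" and ?u = "\<lambda>x. (\<lambda>(x, y). w x + w y) x + 2"
  have inj: "inj_on ?h (?A \<times> P)" by (auto simp: inj_on_def)
  have finA: "fin_wt ?A ?u" using fin_wt_Times[OF fin_nontriv fin_nontriv] by (rule fin_wt_mono) simp
  have wt: "span_wt w (?h (a, b)) = ?u a + lwt v b" for a b
    by (cases a) (simp add: span_wt_def lwt_v)
  show "fin_wt (ended P) (span_wt w)"
    unfolding ended_def by (rule fin_wt_image_Times[OF finA assms inj wt])
  have "gf (ended P) (span_wt w) = gf ?A ?u * gf P (lwt v)"
    unfolding ended_def by (rule gf_image_Times[OF finA assms inj wt])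
  also have "gf ?A ?u = fps_X ^ 2 * ((T - 1) * (T - 1))"
    by (simp only: gf_shift gf_Times[OF fin_nontriv fin_nontriv] gf_nontriv)
  finally show "gf (ended P) (span_wt w) = fps_X ^ 2 * (T - 1) ^ 2 * gf P (lwt v)"
    by (simp add: power2_eq_square)
qed

lemma even_spans_eq: "even_spans d K = ended (even_lists K)"
proof (rule equalityI; rule subsetI)
  fix xs assume xs: "xs \<in> even_spans d K"
  then have "length xs \<ge> 2" by (cases xs; cases "tl xs") (auto simp: even_spans_def)
  then obtain x ys y where "xs = x # ys @ [y]" using list_sandwich by blast
  with xs have "xs = (\<lambda>(xy, ys). fst xy # ys @ [snd xy]) ((x, y), ys)"
    "((x, y), ys) \<in> ((K - {d}) \<times> (K - {d})) \<times> even_lists K"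
    by (auto simp: even_spans_def even_lists_def)
  then show "xs \<in> ended (even_lists K)" unfolding ended_def by blast
qed (auto simp: ended_def even_spans_def even_lists_def)

lemma odd_spans_eq: "odd_spans d K = {[]} \<union> ((\<lambda>x. [x]) ` (K - {d}) \<union> ended (odd_lists K))"
proof (rule equalityI; rule subsetI)
  fix xs assume xs: "xs \<in> odd_spans d K"
  consider "xs = []" | x where "xs = [x]" | "length xs \<ge> 2"
    by (cases xs; cases "tl xs") auto
  then show "xs \<in> {[]} \<union> ((\<lambda>x. [x]) ` (K - {d}) \<union> ended (odd_lists K))"
  proof cases
    case 3
    then obtain x ys y where "xs = x # ys @ [y]" using list_sandwich by blast
    with xs have "xs = (\<lambda>(xy, ys). fst xy # ys @ [snd xy]) ((x, y), ys)"
      "((x, y), ys) \<in> ((K - {d}) \<times> (K - {d})) \<times> odd_lists K"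
      by (auto simp: odd_spans_def odd_lists_def)
    then show ?thesis unfolding ended_def by blast
  qed (use xs in \<open>auto simp: odd_spans_def\<close>)
qed (auto simp: ended_def odd_spans_def odd_lists_def)

lemma gf_even_spans:
  "gf (even_spans d K) (span_wt w) = fps_X ^ 2 * (T - 1) ^ 2 * inverse (1 - fps_X ^ 4 * T ^ 2)"
  unfolding even_spans_eq gf_ended[OF fin_even_lists] gf_even_lists ..

lemma fin_even_spans: "fin_wt (even_spans d K) (span_wt w)"
  unfolding even_spans_eq by (rule fin_ended[OF fin_even_lists])

lemma gf_odd_spans:
  "gf (odd_spans d K) (span_wt w)
    = T + fps_X ^ 4 * T * (T - 1) ^ 2 * inverse (1 - fps_X ^ 4 * T ^ 2)"
proof -
  let ?s = "\<lambda>x. [x]"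
  have inj: "inj_on ?s (K - {d})" by (auto simp: inj_on_def)
  have wt: "span_wt w [x] = w x" for x by (simp add: span_wt_def)
  have fs: "fin_wt (?s ` (K - {d})) (span_wt w)"
    using inj wt fin_nontriv by (rule fin_wt_image)
  note fe = fin_ended[OF fin_odd_lists]
  have "gf (odd_spans d K) (span_wt w)
      = gf {[]} (span_wt w) + gf (?s ` (K - {d}) \<union> ended (odd_lists K)) (span_wt w)"
    unfolding odd_spans_eq by (rule gf_Un[OF fin_wt_finite fin_wt_Un[OF fs fe]]) (auto simp: ended_def)
  also have "gf (?s ` (K - {d}) \<union> ended (odd_lists K)) (span_wt w)
      = gf (?s ` (K - {d})) (span_wt w) + gf (ended (odd_lists K)) (span_wt w)"
    by (rule gf_Un[OF fs fe]) (auto simp: ended_def)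
  also have "gf (?s ` (K - {d})) (span_wt w) = T - 1"
    unfolding gf_nontriv[symmetric] using inj wt by (rule gf_image)
  also have "gf (ended (odd_lists K)) (span_wt w)
      = fps_X ^ 4 * T * (T - 1) ^ 2 * inverse (1 - fps_X ^ 4 * T ^ 2)"
    unfolding gf_ended[OF fin_odd_lists] gf_odd_lists
    by (simp add: power2_eq_square power4_eq_xxxx mult_ac)
  also have "gf {[]} (span_wt w) = 1" by (simp add: gf_singleton span_wt_def)
  finally show ?thesis by simp
qed

text \<open>
  A palindrome of even length is twice its first half, and its first letter is also the last.
\<close>

lemma gf_palindromes:
  "gf {xs \<in> even_spans d K. rev xs = xs} (span_wt w)
    = fps_X ^ 2 * ((T oo fps_X ^ 2) - 1) * inverse (1 - fps_X ^ 4 * (T oo fps_X ^ 2))"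
proof -
  let ?h = "\<lambda>(x, us). (x # us) @ rev (x # us)"
  let ?a = "\<lambda>x. 2 * w x + 2" and ?b = "\<lambda>c. 2 * w c + 4"
  have eq: "{xs \<in> even_spans d K. rev xs = xs} = ?h ` ((K - {d}) \<times> lists K)"
  proof (rule equalityI; rule subsetI)
    fix xs assume "xs \<in> {xs \<in> even_spans d K. rev xs = xs}"
    then have xs: "xs \<in> even_spans d K" "rev xs = xs" by auto
    then obtain m where m: "length xs = m + m" by (auto simp: even_spans_def mult_2 elim!: evenE)
    have "drop m xs = rev (take m xs)"
      using xs(2) m by (metis add_diff_cancel_left' rev_take)
    then have split: "xs = take m xs @ rev (take m xs)" by (metis append_take_drop_id)
    obtain x us where "take m xs = x # us"
      using xs(1) m by (cases "take m xs") (auto simp: even_spans_def)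
    with split xs(1) have "xs = ?h (x, us)" "(x, us) \<in> (K - {d}) \<times> lists K"
      by (auto simp: even_spans_def)
    then show "xs \<in> ?h ` ((K - {d}) \<times> lists K)" by blast
  qed (auto simp: even_spans_def)
  have inj: "inj_on ?h ((K - {d}) \<times> lists K)"
  proof (rule inj_onI)
    fix p q assume pq: "?h p = ?h q"
    obtain x us y vs where p: "p = (x, us)" "q = (y, vs)" by (cases p, cases q) auto
    have eq: "(x # us) @ rev (x # us) = (y # vs) @ rev (y # vs)" using pq unfolding p by simp
    from arg_cong[OF eq, of length] have "length (x # us) = length (y # vs)" by simp
    with eq have "x # us = y # vs" by (metis append_eq_append_conv)
    then show "p = q" using p by simp
  qed
  have fa: "fin_wt (K - {d}) ?a" using fin_nontriv by (rule fin_wt_mono) simp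
  have fb: "fin_wt K ?b" using fin by (rule fin_wt_mono) simp
  have fl: "fin_wt (lists K) (lwt ?b)" using fb by (rule fin_wt_lists) simp
  have "lwt ?b us = 2 * lwt w us + 4 * length us" for us by (induction us) auto
  then have wt: "span_wt w (?h (x, us)) = ?a x + lwt ?b us" for x us
    by (simp add: span_wt_def rev_map[symmetric] sum_list_rev)
  have "gf {xs \<in> even_spans d K. rev xs = xs} (span_wt w) = gf (K - {d}) ?a * gf (lists K) (lwt ?b)"
    unfolding eq by (rule gf_image_Times[OF fa fl inj wt])
  also have "gf (lists K) (lwt ?b) = inverse (1 - gf K ?b)"
    using fb by (rule gf_lists) simp
  also have "gf K ?b = fps_X ^ 4 * (T oo fps_X ^ 2)"
    by (simp add: gf_shift gf_scale)
  also have "gf (K - {d}) ?a = fps_X ^ 2 * ((T - 1) oo fps_X ^ 2)"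
    unfolding gf_shift by (simp add: gf_scale gf_nontriv)
  also have "(T - 1) oo fps_X ^ 2 = (T oo fps_X ^ 2) - 1"
    by (simp add: fps_compose_sub_distrib)
  finally show ?thesis .
qed

lemma gf_reversal_classes:
  "2 * gf (even_spans d K // iterate_rel (even_spans d K) rev) (qwt (span_wt w))
    = fps_X ^ 2 * (T - 1) ^ 2 * inverse (1 - fps_X ^ 4 * T ^ 2)
      + fps_X ^ 2 * ((T oo fps_X ^ 2) - 1) * inverse (1 - fps_X ^ 4 * (T oo fps_X ^ 2))"
proof -
  have "of_nat 2 * gf (even_spans d K // iterate_rel (even_spans d K) rev) (qwt (span_wt w))
      = (\<Sum>k<2. gf {xs \<in> even_spans d K. (rev ^^ k) xs = xs} (span_wt w))"
  proof (rule gf_burnside[OF _ _ _ _ fin_even_spans])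
    show "rev ` even_spans d K \<subseteq> even_spans d K"
      by (auto simp: even_spans_def hd_rev last_rev)
  qed (auto simp: numeral_2_eq_2 span_wt_def rev_map[symmetric] sum_list_rev)
  also have "\<dots> = gf (even_spans d K) (span_wt w) + gf {xs \<in> even_spans d K. rev xs = xs} (span_wt w)"
    by (simp add: numeral_2_eq_2)
  finally show ?thesis by (simp add: gf_even_spans gf_palindromes)
qed

end

context gen_group
begin

interpretation W: gen_group W S
  by (rule gen_group_W)

abbreviation "Cls \<equiv> conj_classes G"
abbreviation "class_len \<equiv> class_length G Z"

lemma weighted_classes: "weighted_set Cls class_len {\<one>}"
  by unfold_locales (auto simp: fin_wt_class_length one_class class_length_one)

text \<open>
  A list of conjugacy classes as a lamp configuration, with a shortest element for each class.
\<close>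

definition class_lamps :: "int \<Rightarrow> 'a set list \<Rightarrow> int \<Rightarrow> 'a" where
  "class_lamps a xs = place \<one> a (map min_rep xs)"

lemma class_lamps_lampF: "xs \<in> lists Cls \<Longrightarrow> class_lamps a xs \<in> lampF"
  unfolding class_lamps_def by (rule place_lampF) (auto simp: min_rep)

lemma supp_class_lamps: "supp (class_lamps a xs) \<subseteq> {a..<a + int (length xs)}"
  using supp_place[of a "map min_rep xs"] by (simp add: class_lamps_def)

lemma lamp_wt_class_lamps: "xs \<in> lists Cls \<Longrightarrow> lamp_wt (class_lamps a xs) = lwt class_len xs"
  unfolding class_lamps_def lamp_wt_place
  by (auto simp: min_rep intro!: arg_cong[of _ _ sum_list] map_cong)

lemma conj_class_class_lamps:
  assumes "xs \<in> lists Cls"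
  shows "conj_class G (class_lamps a xs i) = place {\<one>} a xs i"
proof (cases "a \<le> i \<and> i < a + int (length xs)")
  case True
  then have k: "nat (i - a) < length xs" by linarith
  then have "xs ! nat (i - a) \<in> Cls" using assms by (auto simp: in_lists_conv_set)
  then show ?thesis using True k by (simp add: class_lamps_def place_def min_rep)
next
  case False
  then show ?thesis by (auto simp: class_lamps_def place_def conj_class_one)
qed

lemma conj_class_in_classes: "f \<in> lampF \<Longrightarrow> conj_class G (f i) \<in> Cls"
  using lampF_closed by (auto simp: conj_classes_eq)

lemma conj_class_lamp_one_iff: "f \<in> lampF \<Longrightarrow> conj_class G (f i) = {\<one>} \<longleftrightarrow> i \<notin> supp f"
  using lampF_closed conj_class_eq_one_iff by (auto simp: supp_def)

lemma class_len_le: "g \<in> carrier G \<Longrightarrow> class_len (conj_class G g) \<le> len g"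
  using class_length_le[OF conj_class_self] by blast

text \<open>
  The support of \<open>\<theta>\<close> stays finite because \<open>\<theta>\<close> can be chosen trivial where \<open>f\<close>, and hence \<open>g\<close>, is trivial.
\<close>

lemma pointwise_conjugator:
  assumes fg: "f \<in> lampF" "g \<in> lampF" and eq: "\<And>i. conj_class G (f i) = conj_class G (g i)"
  obtains \<theta> where "\<theta> \<in> lampF" "\<And>i. \<theta> i \<otimes> f i = g i \<otimes> \<theta> i" "supp \<theta> \<subseteq> supp f"
proof -
  have "\<exists>t\<in>carrier G. t \<otimes> f i = g i \<otimes> t \<and> (f i = \<one> \<longrightarrow> t = \<one>)" for i
  proof (cases "f i = \<one>")
    case True
    have "conj_class G (g i) = {\<one>}" using eq[of i] by (simp only: True conj_class_one)
    then have "g i = \<one>" using conj_class_eq_one_iff[OF lampF_closed[OF fg(2)]] by blast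
    then show ?thesis using True by auto
  next
    case False
    have "conj_rel G (f i) (g i)"
      using eq[of i] conj_class_eq_iff lampF_closed[OF fg(1)] lampF_closed[OF fg(2)] by blast
    then show ?thesis using False by (auto simp: conj_rel_def)
  qed
  then have "\<forall>i. \<exists>t. t \<in> carrier G \<and> t \<otimes> f i = g i \<otimes> t \<and> (f i = \<one> \<longrightarrow> t = \<one>)" by blast
  from choice[OF this] obtain \<theta> where
    "\<forall>i. \<theta> i \<in> carrier G \<and> \<theta> i \<otimes> f i = g i \<otimes> \<theta> i \<and> (f i = \<one> \<longrightarrow> \<theta> i = \<one>)" ..
  then have t: "\<theta> i \<in> carrier G" "\<theta> i \<otimes> f i = g i \<otimes> \<theta> i" "f i = \<one> \<Longrightarrow> \<theta> i = \<one>" for i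
    by simp_all
  have "supp \<theta> \<subseteq> supp f" using t(3) by (auto simp: supp_def)
  moreover have "\<theta> \<in> lampF"
    by (rule lampFI[OF t(1) lampF_finite[OF fg(1)] calculation])
  ultimately show ?thesis using that[of \<theta>] t(2) by simp
qed

subsection \<open>Cursor a reflection\<close>

definition refl_part :: "int \<Rightarrow> ((int \<Rightarrow> 'a) \<times> int) set" where
  "refl_part \<epsilon> = {(f, p). f \<in> lampF \<and> p mod 4 = \<epsilon> mod 4}"

lemma conj_closed_refl_part:
  assumes "odd \<epsilon>"
  shows "conj_closed W (refl_part \<epsilon>)"
  unfolding conj_closed_def
proof (intro conjI ballI allI impI)
  fix x y assume x: "x \<in> refl_part \<epsilon>" and xy: "conj_rel W x y"
  obtain f p g q where fg: "x = (f, p)" "y = (g, q)" by (cases x, cases y) auto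
  obtain r where r: "act r p = act q r" "g \<in> lampF" using xy fg by (auto simp: conj_W_iff)
  have p: "p mod 4 = \<epsilon> mod 4" using x fg by (simp add: refl_part_def)
  have "odd p" using p assms by presburger
  then have "q = (if even r then p + 2 * r else 2 * r - p)" using conj_cursor[OF r(1)] by simp
  moreover have "(p + 2 * r) mod 4 = p mod 4" if "even r" using that by presburger
  moreover have "(2 * r - p) mod 4 = p mod 4" if "odd r" using that \<open>odd p\<close> by presburger
  ultimately have "q mod 4 = \<epsilon> mod 4" using p by simp
  then show "y \<in> refl_part \<epsilon>" using fg r(2) by (simp add: refl_part_def)
qed (auto simp: refl_part_def W_carrier)

text \<open>
  On the empty side of the axis the equation for \<open>\<theta>\<close> makes \<open>\<theta>\<close> symmetric, and on the other side it then
  says that \<open>\<theta> i\<close> conjugates \<open>f i\<close> to \<open>g i\<close>.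
\<close>

lemma base_conj_reflection:
  assumes "base_conj f g \<epsilon>" "odd \<epsilon>" "supp f \<subseteq> {i. \<epsilon> < 2 * i}" "supp g \<subseteq> {i. \<epsilon> < 2 * i}"
  shows "conj_class G (f i) = conj_class G (g i)"
proof -
  obtain \<theta> where t: "\<theta> \<in> lampF" "\<And>i. \<theta> i \<otimes> f i = g i \<otimes> \<theta> (\<epsilon> - i)"
    and fg: "f \<in> lampF" "g \<in> lampF"
    using assms(1,2) unfolding base_conj_def iact_def by auto
  note c = lampF_closed[OF t(1)] lampF_closed[OF fg(1)] lampF_closed[OF fg(2)]
  have low: "f i = \<one>" "g i = \<one>" if "2 * i < \<epsilon>" for i
  proof -
    have "i \<notin> supp f" "i \<notin> supp g" using that assms(3,4) by auto
    then show "f i = \<one>" "g i = \<one>" by (simp_all add: supp_def)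
  qed
  show ?thesis
  proof (cases "\<epsilon> < 2 * i")
    case True
    then have "\<theta> (\<epsilon> - i) = \<theta> i" using t(2)[of "\<epsilon> - i"] low[of "\<epsilon> - i"] c by simp
    then have "\<theta> i \<otimes> f i = g i \<otimes> \<theta> i" using t(2)[of i] by simp
    then have "conj_rel G (f i) (g i)" using c by (intro conj_relI[of "\<theta> i"]) auto
    then show ?thesis using conj_class_eq_iff c by blast
  next
    case False
    then have "2 * i < \<epsilon>" using assms(2) by presburger
    then show ?thesis using low by simp
  qed
qed

lemma base_conj_reflectionI:
  assumes fg: "f \<in> lampF" "g \<in> lampF" and \<epsilon>: "odd \<epsilon>"
    and sub: "supp f \<subseteq> {i. \<epsilon> < 2 * i}" "supp g \<subseteq> {i. \<epsilon> < 2 * i}"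
    and eq: "\<And>i. conj_class G (f i) = conj_class G (g i)"
  shows "base_conj f g \<epsilon>"
proof -
  obtain \<theta> where t: "\<theta> \<in> lampF" "\<And>i. \<theta> i \<otimes> f i = g i \<otimes> \<theta> i" "supp \<theta> \<subseteq> supp f"
    using pointwise_conjugator[OF fg eq] by blast
  define \<eta> where "\<eta> = (\<lambda>i. if \<epsilon> < 2 * i then \<theta> i else \<theta> (\<epsilon> - i))"
  have "\<eta> \<in> lampF"
  proof (rule lampFI)
    show "finite (supp \<theta> \<union> (\<lambda>i. \<epsilon> - i) ` supp \<theta>)" using lampF_finite[OF t(1)] by simp
    have "\<epsilon> - i \<in> supp \<theta> \<Longrightarrow> i \<in> (\<lambda>i. \<epsilon> - i) ` supp \<theta>" for i
      by (rule image_eqI[of _ _ "\<epsilon> - i"]) auto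
    then show "supp \<eta> \<subseteq> supp \<theta> \<union> (\<lambda>i. \<epsilon> - i) ` supp \<theta>"
      unfolding \<eta>_def by (auto simp: supp_def split: if_splits)
  qed (use lampF_closed[OF t(1)] in \<open>auto simp: \<eta>_def\<close>)
  moreover have "\<eta> i \<otimes> f i = g i \<otimes> \<eta> (\<epsilon> - i)" for i
  proof (cases "\<epsilon> < 2 * i")
    case True
    then show ?thesis using t(2) by (simp add: \<eta>_def)
  next
    case False
    then have "2 * i < \<epsilon>" using \<epsilon> by presburger
    moreover have "f i = \<one>" "g i = \<one>" using False sub by (auto simp: supp_def)
    ultimately show ?thesis using lampF_closed[OF t(1)] by (simp add: \<eta>_def)
  qed
  ultimately show ?thesis using fg \<epsilon> unfolding base_conj_def by (auto simp: iact_def)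
qed

text \<open>
  The element \<open>(f, \<epsilon>)\<close> commutes with itself, so conjugation by it can be used to replace a conjugating element with cursor
  \<open>\<epsilon>\<close> by one with neutral cursor.
\<close>

lemma base_conj_reflect:
  assumes f: "f \<in> lampF" and \<epsilon>: "odd \<epsilon>"
  shows "base_conj f (\<lambda>i. f (iact \<epsilon> i)) \<epsilon>"
  unfolding base_conj_def
proof (intro conjI bexI allI)
  show "(\<lambda>i. f (iact \<epsilon> i)) \<in> lampF" using f by (rule lampF_comp)
  then show "(\<lambda>i. f (iact \<epsilon> i)) \<in> lampF" .
  show "f (iact \<epsilon> i) \<otimes> f i = f (iact \<epsilon> i) \<otimes> f (iact \<epsilon> (iact \<epsilon> i))" for i
    using \<epsilon> by (simp add: iact_def)
qed (rule f)

lemma trimmed_list_of_fun: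
  assumes "\<And>k. n \<le> k \<Longrightarrow> c k = d" "\<And>k. c k \<in> K"
  shows "\<exists>m\<le>n. map c [0..<m] \<in> trimmed d K \<and> (\<forall>k\<ge>m. c k = d)"
proof -
  define m where "m = (LEAST m. \<forall>k\<ge>m. c k = d)"
  have ex: "\<forall>k\<ge>n. c k = d" using assms(1) by blast
  have m: "\<forall>k\<ge>m. c k = d" unfolding m_def by (rule LeastI) (rule ex)
  have "m \<le> n" unfolding m_def by (rule Least_le) (rule ex)
  moreover have "map c [0..<m] \<in> trimmed d K"
  proof (cases m)
    case (Suc j)
    have "c j \<noteq> d"
    proof
      assume "c j = d"
      then have "\<forall>k\<ge>j. c k = d" using m Suc by (metis Suc_leI le_neq_implies_less)
      then have "m \<le> j" unfolding m_def by (rule Least_le)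
      then show False using Suc by simp
    qed
    then show ?thesis using Suc assms(2) by (auto simp: trimmed_def)
  qed (simp add: trimmed_def)
  ultimately show ?thesis using m by blast
qed

lemma place_trimmed_inj:
  assumes "place d a (c # xs) = place d a (c' # ys)" "xs \<in> trimmed d K" "ys \<in> trimmed d K"
  shows "c # xs = c' # ys"
proof -
  have le: "length ys \<le> length xs"
    if eq: "place d a (c # xs) = place d a (c' # ys)" and ys: "ys \<in> trimmed d K" for c xs c' ys
  proof (rule ccontr)
    assume "\<not> length ys \<le> length xs"
    then have lt: "length xs < length ys" and ne: "ys \<noteq> []" by auto
    have "place d a (c # xs) (a + int (length ys)) = d" using lt by (simp add: place_def)
    moreover have "place d a (c' # ys) (a + int (length ys)) = last ys"
      using ne by (simp add: place_def last_conv_nth nth_Cons')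
    ultimately show False using eq ys ne by (simp add: trimmed_def)
  qed
  have "length xs = length ys" using le[OF assms(1,3)] le[OF assms(1)[symmetric] assms(2)] by simp
  then show ?thesis by (intro place_inj[OF assms(1)]) simp
qed

text \<open>
  The lamps are gathered on the side \<open>\<epsilon> < 2 * i\<close> of the axis, which begins at \<open>h\<close>. With \<open>length xs\<close> positions
  beyond \<open>h\<close>, the walk there and back that crosses the axis has \<open>1 + 2 * length xs\<close> moves. The quantity \<open>\<bar>2 * i - p\<bar>\<close>
  is twice the distance of \<open>i\<close> from the axis; it is at most the number of moves of any word and is kept by
  shifts and by gathering.
\<close>

lemma conj_gf_refl_part:
  assumes "\<epsilon> = 1 \<or> \<epsilon> = - 1"
  shows "conj_gf W S (refl_part \<epsilon>) =
    gf (Cls \<times> trimmed {\<one>} Cls) (\<lambda>(c, xs). 1 + 2 * length xs + (class_len c + lwt class_len xs))"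
proof -
  have \<epsilon>: "odd \<epsilon>" using assms by auto
  define h where "h = (\<epsilon> + 1) div 2"
  have h: "2 * h = \<epsilon> + 1" "h \<ge> 0" using assms by (auto simp: h_def)
  define rep where "rep = (\<lambda>(c, xs). (class_lamps h (c # xs), \<epsilon>))"
  have tl: "c # xs \<in> lists Cls" if "(c, xs) \<in> Cls \<times> trimmed {\<one>} Cls" for c xs
    using that by (auto simp: trimmed_def)
  have half: "supp (class_lamps h (c # xs)) \<subseteq> {i. \<epsilon> < 2 * i}" for c xs
    using supp_class_lamps[of h "c # xs"] h(1) by fastforce
  show ?thesis
  proof (rule W.conj_gf_transversal[OF conj_closed_refl_part[OF \<epsilon>], where rep = rep])
    fix d assume d: "d \<in> Cls \<times> trimmed {\<one>} Cls"
    obtain c xs where cx: "d = (c, xs)" by (cases d) auto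
    have F: "class_lamps h (c # xs) \<in> lampF" using class_lamps_lampF[OF tl] d cx by simp
    then show "rep d \<in> refl_part \<epsilon>" by (simp add: rep_def refl_part_def cx)
    have "W.spelled (nat (h + int (length xs) + \<bar>\<epsilon> - (h + int (length xs))\<bar>) + lamp_wt (class_lamps h (c # xs)))
        (class_lamps h (c # xs), \<epsilon>)"
      using supp_class_lamps[of h "c # xs"] h(2) by (intro spelled_there_and_back F) auto
    moreover have "nat (h + int (length xs) + \<bar>\<epsilon> - (h + int (length xs))\<bar>) = 1 + 2 * length xs"
      using assms h(1) by auto
    ultimately have "W.spelled (1 + 2 * length xs + lwt class_len (c # xs)) (rep d)"
      using lamp_wt_class_lamps[OF tl] d cx by (simp add: rep_def)
    from W.word_length_le_spelled[OF this]
    show "word_length W S (rep d)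
        \<le> (case d of (c, xs) \<Rightarrow> 1 + 2 * length xs + (class_len c + lwt class_len xs))"
      by (simp add: cx)
  next
    fix d e assume d: "d \<in> Cls \<times> trimmed {\<one>} Cls" and e: "e \<in> Cls \<times> trimmed {\<one>} Cls"
      and conj: "conj_rel W (rep d) (rep e)"
    obtain c xs c' ys where cx: "d = (c, xs)" "e = (c', ys)" by (cases d, cases e) auto
    let ?f = "class_lamps h (c # xs)" and ?g = "class_lamps h (c' # ys)"
    have F: "?f \<in> lampF" using class_lamps_lampF[OF tl] d cx by simp
    have "conj_rel W (?f, \<epsilon>) (?g, \<epsilon>)" using conj by (simp add: rep_def cx)
    then obtain q where q: "act q \<epsilon> = act \<epsilon> q" "base_conj (\<lambda>i. ?f (iact q i)) ?g \<epsilon>"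
      using conj_W_shift_base by blast
    have "q = 0 \<or> q = \<epsilon>" using q(1) \<epsilon> by (auto simp: act_def split: if_splits)
    then have "base_conj ?f ?g \<epsilon>"
    proof
      assume "q = \<epsilon>"
      then show ?thesis using base_conj_trans[OF base_conj_reflect[OF F \<epsilon>]] q(2) by simp
    qed (use q(2) in simp)
    from base_conj_reflection[OF this \<epsilon> half half]
    have "conj_class G (?f i) = conj_class G (?g i)" for i .
    then have "place {\<one>} h (c # xs) = place {\<one>} h (c' # ys)"
      using conj_class_class_lamps[OF tl] d e cx by (simp add: fun_eq_iff)
    then have "c # xs = c' # ys" using d e cx by (intro place_trimmed_inj) auto
    then show "d = e" using cx by simp
  next
    fix x assume "x \<in> refl_part \<epsilon>"
    then obtain f p where x: "x = (f, p)" "f \<in> lampF" "p mod 4 = \<epsilon> mod 4" by (auto simp: refl_part_def)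
    obtain l m where lm: "l + m = word_length W S (f, p)" "cost_bound l m f p"
      using cost_bound_word[OF x(2)] .
    have "odd p" using x(3) \<epsilon> by presburger
    \<comment> \<open>As \<open>p\<close> and \<open>\<epsilon>\<close> agree modulo 4, this is an even translation; it moves the axis of \<open>p\<close> to that of \<open>\<epsilon>\<close>.\<close>
    define q where "q = (\<epsilon> - p) div 2"
    have "4 dvd \<epsilon> - p" using x(3) by (metis mod_eq_dvd_iff)
    then have q: "even q" "2 * q = \<epsilon> - p" by (auto simp: q_def elim!: dvdE)
    define g where "g = (\<lambda>i. f (iact q i))"
    have g: "g \<in> lampF" "lamp_wt g = lamp_wt f"
      using lampF_comp[OF x(2)] lamp_wt_comp by (auto simp: g_def)
    have fg: "conj_rel W (f, p) (g, \<epsilon>)"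
      unfolding g_def using q \<epsilon> x(2) by (intro conj_shift) (auto simp: act_def)
    have m: "1 \<le> m" using lm(2) \<open>odd p\<close> by (cases "p = 0") (auto simp: cost_bound_def)
    have "supp g \<subseteq> {i. \<bar>2 * i - \<epsilon>\<bar> \<le> int m}"
    proof
      fix i assume "i \<in> supp g"
      then obtain j where j: "j \<in> supp f" "i = j + q" using q(1) by (auto simp: g_def supp_comp act_def)
      have "\<bar>j\<bar> + \<bar>p - j\<bar> \<le> int m" using lm(2) j(1) by (simp add: cost_bound_def)
      moreover have "2 * i - \<epsilon> = j - (p - j)" using j(2) q(2) by simp
      ultimately show "i \<in> {i. \<bar>2 * i - \<epsilon>\<bar> \<le> int m}" by simp
    qed
    then have "\<exists>k. base_conj g k \<epsilon> \<and> lamp_wt k \<le> lamp_wt g \<and>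
        supp k \<subseteq> {i. \<epsilon> < 2 * i} \<inter> {i. \<bar>2 * i - \<epsilon>\<bar> \<le> int m}"
    proof (rule gather[OF g(1), where e = "\<lambda>i. if 2 * i < \<epsilon> then 1 else 0"])
      fix i assume i: "i \<in> {i. \<bar>2 * i - \<epsilon>\<bar> \<le> int m}" "i \<notin> {i. \<epsilon> < 2 * i}"
      then have "2 * i < \<epsilon>" using \<epsilon> by (simp, presburger)
      with i show "\<exists>j\<in>{i. \<bar>2 * i - \<epsilon>\<bar> \<le> int m}. j \<noteq> i \<and> (act \<epsilon> j = i \<or> act \<epsilon> i = j) \<and>
          (if 2 * j < \<epsilon> then 1 else 0 :: nat) < (if 2 * i < \<epsilon> then 1 else 0)"
        using \<epsilon> by (intro bexI[of _ "\<epsilon> - i"]) (auto simp: act_def)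
    qed
    then obtain k where k: "base_conj g k \<epsilon>" "lamp_wt k \<le> lamp_wt g" "supp k \<subseteq> {i. \<epsilon> < 2 * i}"
      "supp k \<subseteq> {i. \<bar>2 * i - \<epsilon>\<bar> \<le> int m}" by blast
    have kF: "k \<in> lampF" using k(1) by (simp add: base_conj_def)
    define c where "c = (\<lambda>j. conj_class G (k (h + int j)))"
    have cK: "c j \<in> Cls" for j unfolding c_def by (rule conj_class_in_classes[OF kF])
    have c0: "c j = {\<one>}" if "m < 2 * j + 1" for j
    proof -
      have "h + int j \<notin> supp k" using that k(4) h(1) by auto
      then show ?thesis unfolding c_def by (simp add: conj_class_lamp_one_iff[OF kF])
    qed
    have "\<exists>n\<le>(m - 1) div 2. map (\<lambda>j. c (Suc j)) [0..<n] \<in> trimmed {\<one>} Cls \<and>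
        (\<forall>j\<ge>n. c (Suc j) = {\<one>})"
      by (rule trimmed_list_of_fun) (use c0 cK m in auto)
    then obtain n where n: "n \<le> (m - 1) div 2" "map (\<lambda>j. c (Suc j)) [0..<n] \<in> trimmed {\<one>} Cls"
      "\<And>j. j \<ge> n \<Longrightarrow> c (Suc j) = {\<one>}" by blast
    define xs where "xs = map (\<lambda>j. c (Suc j)) [0..<n]"
    have d: "(c 0, xs) \<in> Cls \<times> trimmed {\<one>} Cls" using n(2) cK by (simp add: xs_def)
    have cxs: "c 0 # xs = map (\<lambda>j. conj_class G (k (h + int j))) [0..<Suc n]"
      unfolding xs_def c_def by (simp add: upt_conv_Cons map_Suc_upt[symmetric] del: upt_Suc)
    have pl: "place {\<one>} h (c 0 # xs) = (\<lambda>i. conj_class G (k i))"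
      unfolding cxs
    proof (rule place_window)
      fix i assume i: "i \<notin> {h..<h + int (Suc n)}"
      show "conj_class G (k i) = {\<one>}"
      proof (cases "i < h")
        case True
        then have "i \<notin> supp k" using k(3) h(1) by auto
        then show ?thesis by (simp add: conj_class_lamp_one_iff[OF kF])
      next
        case False
        then have "i = h + int (Suc (nat (i - h - 1)))" "nat (i - h - 1) \<ge> n" using i by auto
        then show ?thesis using n(3)[of "nat (i - h - 1)"] unfolding c_def by metis
      qed
    qed
    have rF: "class_lamps h (c 0 # xs) \<in> lampF" by (rule class_lamps_lampF[OF tl[OF d]])
    have "base_conj (class_lamps h (c 0 # xs)) k \<epsilon>"
      by (rule base_conj_reflectionI[OF rF kF \<epsilon> half k(3)])
        (simp only: conj_class_class_lamps[OF tl[OF d]] pl)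
    then have "conj_rel W (rep (c 0, xs)) x"
      using base_conjD[of "class_lamps h (c 0 # xs)" k \<epsilon>] base_conjD[OF k(1)] fg x(1) W.conj_rel_trans W.conj_rel_sym
      unfolding rep_def prod.case by blast
    moreover have "1 + 2 * length xs + (class_len (c 0) + lwt class_len xs) \<le> word_length W S x"
    proof -
      have "class_len (c 0) + lwt class_len xs = lwt class_len (c 0 # xs)" by simp
      also have "\<dots> = (\<Sum>j<Suc n. class_len (conj_class G (k (h + int j))))"
        unfolding cxs by (simp add: lwt_nth del: upt_Suc)
      also have "\<dots> \<le> (\<Sum>j<Suc n. len (k (h + int j)))"
        by (intro sum_mono class_len_le lampF_closed[OF kF])
      also have "\<dots> = (\<Sum>i\<in>(\<lambda>j. h + int j) ` {..<Suc n}. len (k i))"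
        by (subst sum.reindex) (auto simp: inj_on_def)
      also have "\<dots> \<le> (\<Sum>i\<in>supp k \<union> (\<lambda>j. h + int j) ` {..<Suc n}. len (k i))"
        using lampF_finite[OF kF] by (intro sum_mono2) auto
      also have "\<dots> = lamp_wt k"
        using lampF_finite[OF kF] by (intro lamp_wt_superset[symmetric]) auto
      also have "\<dots> \<le> l" using k(2) g(2) lm(2) by (simp add: cost_bound_def)
      finally show ?thesis using lm(1) x(1) n(1) m by (simp add: xs_def)
    qed
    ultimately show "\<exists>d\<in>Cls \<times> trimmed {\<one>} Cls. conj_rel W (rep d) x \<and>
        (case d of (c, xs) \<Rightarrow> 1 + 2 * length xs + (class_len c + lwt class_len xs)) \<le> word_length W S x"
      using d by (intro bexI[of _ "(c 0, xs)"]) auto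
  qed
qed

end

text \<open>
  Twice the centre of a finite set of positions.
\<close>

definition span_sum :: "int set \<Rightarrow> int" where
  "span_sum A = Min A + Max A"

lemma
  assumes "finite A" "A \<noteq> {}"
  shows Min_act_even: "even q \<Longrightarrow> Min (act q ` A) = q + Min A"
    and Max_act_even: "even q \<Longrightarrow> Max (act q ` A) = q + Max A"
    and Min_act_odd: "odd q \<Longrightarrow> Min (act q ` A) = q - Max A"
    and Max_act_odd: "odd q \<Longrightarrow> Max (act q ` A) = q - Min A"
proof -
  have m: "Min A \<in> A" "Max A \<in> A" using assms by simp_all
  have img: "act q x \<in> act q ` A" if "x \<in> A" for x using that by simp
  note bounds = Min_le[OF assms(1)] Max_ge[OF assms(1)]
  show "Min (act q ` A) = q + Min A" if "even q"
    using assms(1) img[OF m(1)] bounds that by (intro Min_eqI) (auto simp: act_def)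
  show "Max (act q ` A) = q + Max A" if "even q"
    using assms(1) img[OF m(2)] bounds that by (intro Max_eqI) (auto simp: act_def)
  show "Min (act q ` A) = q - Max A" if "odd q"
    using assms(1) img[OF m(2)] bounds that by (intro Min_eqI) (auto simp: act_def)
  show "Max (act q ` A) = q - Min A" if "odd q"
    using assms(1) img[OF m(1)] bounds that by (intro Max_eqI) (auto simp: act_def)
qed

lemma span_sum_act:
  assumes "finite A" "A \<noteq> {}"
  shows "span_sum (act q ` A) = (if even q then span_sum A + 2 * q else 2 * q - span_sum A)"
  using Min_act_even[OF assms, of q] Max_act_even[OF assms, of q]
    Min_act_odd[OF assms, of q] Max_act_odd[OF assms, of q]
  unfolding span_sum_def by auto

text \<open>
  The first position of a list that is written so that its first and last position have sum \<open>s\<close>.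
\<close>

definition span_start :: "int \<Rightarrow> 'b list \<Rightarrow> int" where
  "span_start s xs = (s + 1 - int (length xs)) div 2"

lemma place_rev:
  assumes "2 * a + int (length xs) - 1 = s"
  shows "place d a (rev xs) i = place d a xs (s - i)"
proof (cases "a \<le> i \<and> i < a + int (length xs)")
  case True
  then have "nat (i - a) < length xs" "length xs - Suc (nat (i - a)) = nat (s - i - a)"
    using assms by auto
  then show ?thesis using True assms by (simp add: place_def rev_nth)
qed (use assms in \<open>auto simp: place_def\<close>)

context gen_group
begin

interpretation W: gen_group W S
  by (rule gen_group_W)

interpretation weighted_set Cls class_len "{\<one>}"
  by (rule weighted_classes)

lemma class_lamps_Nil: "class_lamps a [] = (\<lambda>_. \<one>)"
  by (auto simp: class_lamps_def place_def fun_eq_iff)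

subsection \<open>Trivial cursor\<close>

text \<open>
  The value of \<open>span_sum\<close> on the support modulo \<open>4\<close>, with the even values taken together, is invariant under conjugation. The parts
  are represented by \<open>s = 0\<close>, \<open>s = 1\<close> and \<open>s = - 1\<close>.
\<close>
definition id_part :: "int \<Rightarrow> ((int \<Rightarrow> 'a) \<times> int) set" where
  "id_part s = {(f, p). f \<in> lampF \<and> p = 0 \<and>
    (if s = 0 then supp f = {} \<or> even (span_sum (supp f))
     else supp f \<noteq> {} \<and> span_sum (supp f) mod 4 = s mod 4)}"

definition spans :: "int \<Rightarrow> 'a set list set" where
  "spans s = (if s = 0 then odd_spans {\<one>} Cls else even_spans {\<one>} Cls)"

definition span_rep :: "int \<Rightarrow> 'a set list \<Rightarrow> int \<Rightarrow> 'a" where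
  "span_rep s xs = class_lamps (span_start s xs) xs"

text \<open>
  With neutral cursor, conjugacy in the base group is conjugacy of the lamps one by one.
\<close>

lemma base_conj_0:
  assumes "base_conj f g 0"
  shows "conj_class G (f i) = conj_class G (g i)"
proof -
  obtain \<theta> where t: "\<theta> \<in> lampF" "\<And>i. \<theta> i \<otimes> f i = g i \<otimes> \<theta> i" and fg: "f \<in> lampF" "g \<in> lampF"
    using assms unfolding base_conj_def by auto
  then have "conj_rel G (f i) (g i)"
    using lampF_closed by (intro conj_relI[of "\<theta> i"]) auto
  then show ?thesis using conj_class_eq_iff fg lampF_closed by blast
qed

lemma base_conj_0I:
  assumes "f \<in> lampF" "g \<in> lampF" "\<And>i. conj_class G (f i) = conj_class G (g i)"
  shows "base_conj f g 0"
proof -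
  obtain \<theta> where "\<theta> \<in> lampF" "\<And>i. \<theta> i \<otimes> f i = g i \<otimes> \<theta> i" "supp \<theta> \<subseteq> supp f"
    using pointwise_conjugator[OF assms] by blast
  then show ?thesis using assms(1,2) unfolding base_conj_def by auto
qed

lemma base_conj_0_supp:
  assumes "base_conj f g 0"
  shows "supp f = supp g"
proof -
  have "f \<in> lampF" "g \<in> lampF" using assms by (auto simp: base_conj_def)
  then have "i \<notin> supp f \<longleftrightarrow> i \<notin> supp g" for i
    using base_conj_0[OF assms, of i] conj_class_lamp_one_iff by blast
  then show ?thesis by blast
qed

lemma conj_closed_id_part:
  assumes "s = 0 \<or> odd s"
  shows "conj_closed W (id_part s)"
  unfolding conj_closed_def
proof (intro conjI ballI allI impI)
  fix x y assume x: "x \<in> id_part s" and xy: "conj_rel W x y"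
  obtain f p g p' where fg: "x = (f, p)" "y = (g, p')" by (cases x, cases y) auto
  obtain q where q: "act q p = act p' q" "base_conj (\<lambda>i. f (iact q i)) g p'"
    using conj_W_shift_base xy fg by blast
  have f: "f \<in> lampF" "p = 0" using x fg by (auto simp: id_part_def)
  then have p': "p' = 0" using conj_cursor[OF q(1)] by simp
  have g: "g \<in> lampF" using q(2) by (simp add: base_conj_def)
  have sup: "supp g = act q ` supp f"
    using base_conj_0_supp[of "\<lambda>i. f (iact q i)" g] q(2) p' by (simp add: supp_comp)
  show "y \<in> id_part s"
  proof (cases "supp f = {}")
    case True
    then show ?thesis using x fg g p' sup by (auto simp: id_part_def split: if_splits)
  next
    case False
    then have S: "span_sum (supp g) = (if even q then span_sum (supp f) + 2 * q else 2 * q - span_sum (supp f))"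
      using span_sum_act[OF lampF_finite[OF f(1)]] sup by simp
    have ev: "even (span_sum (supp f)) \<Longrightarrow> even (span_sum (supp g))" using S by simp
    have od: "span_sum (supp g) mod 4 = s mod 4" if o: "odd s" "span_sum (supp f) mod 4 = s mod 4"
    proof -
      have "odd (span_sum (supp f))" using o by presburger
      then have "(2 * q - span_sum (supp f)) mod 4 = span_sum (supp f) mod 4" if "odd q"
        using that by presburger
      moreover have "(span_sum (supp f) + 2 * q) mod 4 = span_sum (supp f) mod 4" if "even q"
        using that by presburger
      ultimately show ?thesis using S o(2) by simp
    qed
    have ne: "supp g \<noteq> {}" using False sup by simp
    show ?thesis
    proof (cases "s = 0")
      case True
      then have "even (span_sum (supp f))" using x fg False by (simp add: id_part_def)
      from ev[OF this] show ?thesis using True fg g p' by (simp add: id_part_def)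
    next
      case s: False
      then have "span_sum (supp f) mod 4 = s mod 4" using x fg by (simp add: id_part_def)
      from od[OF _ this] show ?thesis using s assms fg g p' ne by (simp add: id_part_def)
    qed
  qed
qed (auto simp: id_part_def W_carrier)

lemma spans_iff:
  assumes "s = 0 \<or> s = 1 \<or> s = - 1"
  shows "xs \<in> spans s \<longleftrightarrow> xs \<in> lists Cls \<and>
    (s = 0 \<and> xs = [] \<or> xs \<noteq> [] \<and> even (s + 1 - int (length xs)) \<and> hd xs \<noteq> {\<one>} \<and> last xs \<noteq> {\<one>})"
  using assms by (auto simp: spans_def odd_spans_def even_spans_def)

lemma span_start:
  assumes "s = 0 \<or> s = 1 \<or> s = - 1" "xs \<in> spans s" "xs \<noteq> []"
  shows "2 * span_start s xs + int (length xs) - 1 = s"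
  using assms spans_iff[OF assms(1)] by (auto simp: span_start_def)

lemma span_rep_lampF: "xs \<in> lists Cls \<Longrightarrow> span_rep s xs \<in> lampF"
  unfolding span_rep_def by (rule class_lamps_lampF)

lemma
  assumes s: "s = 0 \<or> s = 1 \<or> s = - 1" and xs: "xs \<in> spans s" "xs \<noteq> []"
  shows supp_span_rep_nonempty: "supp (span_rep s xs) \<noteq> {}"
    and Min_supp_span_rep: "Min (supp (span_rep s xs)) = span_start s xs"
    and Max_supp_span_rep: "Max (supp (span_rep s xs)) = s - span_start s xs"
proof -
  let ?f = "span_rep s xs" and ?a = "span_start s xs"
  have l: "xs \<in> lists Cls" "hd xs \<noteq> {\<one>}" "last xs \<noteq> {\<one>}" using xs spans_iff[OF s] by auto
  note F = span_rep_lampF[OF l(1), of s]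
  have b: "2 * ?a + int (length xs) - 1 = s" by (rule span_start[OF assms])
  have cls: "conj_class G (?f i) = place {\<one>} ?a xs i" for i
    unfolding span_rep_def by (rule conj_class_class_lamps[OF l(1)])
  have "place {\<one>} ?a xs ?a = hd xs" using xs(2) by (simp add: place_def hd_conv_nth)
  then have a: "?a \<in> supp ?f" using l(2) cls conj_class_lamp_one_iff[OF F] by metis
  have e: "s - ?a - ?a = int (length xs - 1)" using b xs(2) by (cases xs) auto
  then have "nat (s - ?a - ?a) = length xs - 1" by simp
  moreover have "?a \<le> s - ?a" using e by linarith
  moreover have "s - ?a < ?a + int (length xs)" using b by linarith
  ultimately have "place {\<one>} ?a xs (s - ?a) = last xs" using xs(2) by (simp add: place_def last_conv_nth)
  then have b': "s - ?a \<in> supp ?f" using l(3) cls conj_class_lamp_one_iff[OF F] by metis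
  have sub: "supp ?f \<subseteq> {?a..s - ?a}"
    using supp_class_lamps[of ?a xs] b unfolding span_rep_def by fastforce
  show "supp ?f \<noteq> {}" using a by blast
  show "Min (supp ?f) = ?a" using a sub lampF_finite[OF F] by (intro Min_eqI) auto
  show "Max (supp ?f) = s - ?a" using b' sub lampF_finite[OF F] by (intro Max_eqI) auto
qed

lemma word_length_span_rep:
  assumes s: "s = 0 \<or> s = 1 \<or> s = - 1" and xs: "xs \<in> spans s"
  shows "word_length W S (span_rep s xs, 0) \<le> span_wt class_len xs"
proof (cases "xs = []")
  case True
  then have "span_rep s xs = (\<lambda>_. \<one>)" by (simp add: span_rep_def class_lamps_Nil)
  then show ?thesis using W.word_length_one by (simp add: W_one)
next
  case False
  let ?a = "span_start s xs"
  have l: "xs \<in> lists Cls" using xs spans_iff[OF s] by blast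
  have b: "2 * ?a + int (length xs) - 1 = s" by (rule span_start[OF s xs False])
  have len: "length xs \<ge> 1" using False by (cases xs) auto
  have "?a \<le> 0" "0 \<le> s - ?a" using b len s by auto
  moreover have "supp (span_rep s xs) \<subseteq> {?a..s - ?a}"
    using supp_class_lamps[of ?a xs] b unfolding span_rep_def by fastforce
  ultimately have "W.spelled (nat (2 * (s - ?a - ?a)) + lamp_wt (span_rep s xs)) (span_rep s xs, 0)"
    by (intro spelled_closed span_rep_lampF l)
  moreover have "nat (2 * (s - ?a - ?a)) = 2 * (length xs - 1)" using b len by auto
  moreover have "lamp_wt (span_rep s xs) = lwt class_len xs"
    unfolding span_rep_def by (rule lamp_wt_class_lamps[OF l])
  ultimately show ?thesis using W.word_length_le_spelled by (simp add: span_wt_def)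
qed

lemma span_rep_in_id_part:
  assumes s: "s = 0 \<or> s = 1 \<or> s = - 1" and xs: "xs \<in> spans s"
  shows "(span_rep s xs, 0) \<in> id_part s"
proof (cases "xs = []")
  case True
  then have "span_rep s xs = (\<lambda>_. \<one>)" by (simp add: span_rep_def class_lamps_Nil)
  moreover have "s = 0" using True xs spans_iff[OF s] by blast
  ultimately show ?thesis by (simp add: id_part_def lampF_one)
next
  case False
  have "xs \<in> lists Cls" using xs spans_iff[OF s] by blast
  moreover have "span_sum (supp (span_rep s xs)) = s"
    unfolding span_sum_def Min_supp_span_rep[OF s xs False] Max_supp_span_rep[OF s xs False] by simp
  ultimately show ?thesis
    using supp_span_rep_nonempty[OF s xs False] span_rep_lampF by (auto simp: id_part_def)
qed

text \<open>
  A shift that keeps \<open>span_sum\<close> equal to \<open>s\<close> is trivial or, for odd \<open>s\<close>, the reflection \<open>i \<mapsto> s - i\<close>, which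
  reverses the list.
\<close>

lemma conj_span_rep_iff:
  assumes s: "s = 0 \<or> s = 1 \<or> s = - 1" and xs: "xs \<in> spans s" and ys: "ys \<in> spans s"
  shows "conj_rel W (span_rep s xs, 0) (span_rep s ys, 0) \<longleftrightarrow> ys = xs \<or> s \<noteq> 0 \<and> ys = rev xs"
proof
  have l: "xs \<in> lists Cls" "ys \<in> lists Cls" using xs ys spans_iff[OF s, of xs] spans_iff[OF s, of ys] by auto
  let ?f = "span_rep s xs" and ?g = "span_rep s ys"
  assume conj: "conj_rel W (?f, 0) (?g, 0)"
  obtain q where q: "base_conj (\<lambda>i. ?f (iact q i)) ?g 0"
    using conj_W_shift_base[OF conj] by blast
  have sup: "supp ?g = act q ` supp ?f" using base_conj_0_supp[OF q] by (simp add: supp_comp)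
  have fin: "finite (supp ?f)" using lampF_finite span_rep_lampF l by blast
  have cls: "place {\<one>} (span_start s ys) ys i = place {\<one>} (span_start s xs) xs (iact q i)" for i
    using base_conj_0[OF q, of i] conj_class_class_lamps[OF l(1)] conj_class_class_lamps[OF l(2)]
    by (simp add: span_rep_def)
  show "ys = xs \<or> s \<noteq> 0 \<and> ys = rev xs"
  proof (cases "xs = [] \<or> ys = []")
    case True
    have "supp (span_rep s []) = {}" by (simp add: span_rep_def class_lamps_Nil)
    then have "xs = [] \<and> ys = []"
      using True sup supp_span_rep_nonempty[OF s xs] supp_span_rep_nonempty[OF s ys] by auto
    then show ?thesis by simp
  next
    case False
    then have ne: "xs \<noteq> []" "ys \<noteq> []" by auto
    note nef = supp_span_rep_nonempty[OF s xs ne(1)]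
    note mm = Min_supp_span_rep[OF s xs ne(1)] Max_supp_span_rep[OF s xs ne(1)]
      Min_supp_span_rep[OF s ys ne(2)] Max_supp_span_rep[OF s ys ne(2)]
    have "s = (if even q then s + 2 * q else 2 * q - s)"
    proof -
      have "span_sum (supp ?f) = s" "span_sum (supp ?g) = s"
        by (simp_all add: span_sum_def mm)
      then show ?thesis using span_sum_act[OF fin nef, of q] by (cases "even q") (simp_all add: sup)
    qed
    then have "q = 0 \<or> q = s \<and> odd s" by (auto split: if_splits)
    then have a: "span_start s ys = span_start s xs" and q': "q = 0 \<or> q = s \<and> odd s"
      using Min_act_even[OF fin nef, of q] Min_act_odd[OF fin nef, of q]
      by (auto simp: sup[symmetric] mm)
    have bx: "2 * span_start s xs + int (length xs) - 1 = s" by (rule span_start[OF s xs ne(1)])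
    have len: "length ys = length xs" using bx span_start[OF s ys ne(2)] a by simp
    from q' show ?thesis
    proof
      assume "q = 0"
      then have "place {\<one>} (span_start s xs) ys = place {\<one>} (span_start s xs) xs"
        using cls a by (simp add: fun_eq_iff)
      then have "ys = xs" using len by (rule place_inj)
      then show ?thesis by simp
    next
      assume qs: "q = s \<and> odd s"
      have "place {\<one>} (span_start s xs) ys i = place {\<one>} (span_start s xs) (rev xs) i" for i
        using cls[of i] qs a place_rev[OF bx] by (simp add: iact_def)
      then have "ys = rev xs" using len by (intro place_inj[of "{\<one>}" "span_start s xs"]) auto
      then show ?thesis using qs by auto
    qed
  qed
next
  have l: "xs \<in> lists Cls" using xs spans_iff[OF s] by blast
  assume "ys = xs \<or> s \<noteq> 0 \<and> ys = rev xs"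
  then show "conj_rel W (span_rep s xs, 0) (span_rep s ys, 0)"
  proof
    assume "ys = xs"
    then show ?thesis using W.conj_rel_refl span_rep_lampF[OF l] by (simp add: W_carrier)
  next
    assume ysr: "s \<noteq> 0 \<and> ys = rev xs"
    then have ne: "xs \<noteq> []" using xs spans_iff[OF s] by blast
    have bx: "2 * span_start s xs + int (length (map min_rep xs)) - 1 = s"
      using span_start[OF s xs ne] by simp
    have "odd s" using s ysr by auto
    then have "(\<lambda>i. span_rep s xs (iact s i)) = span_rep s ys"
      using place_rev[OF bx] ysr
      by (auto simp: span_rep_def class_lamps_def span_start_def rev_map iact_def fun_eq_iff)
    moreover have "conj_rel W (span_rep s xs, 0) (\<lambda>i. span_rep s xs (iact s i), 0)"
      by (rule conj_shift[OF span_rep_lampF[OF l]]) simp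
    ultimately show ?thesis by simp
  qed
qed

text \<open>
  The support is first shifted so that its minimum and maximum have sum \<open>s\<close>. The weight of the list that is read off
  is bounded by the last condition in \<open>cost_bound\<close>, where the cursor is \<open>0\<close>.
\<close>

lemma span_rep_exists:
  assumes s: "s = 0 \<or> s = 1 \<or> s = - 1" and x: "x \<in> id_part s"
  shows "\<exists>xs\<in>spans s. conj_rel W (span_rep s xs, 0) x \<and> span_wt class_len xs \<le> word_length W S x"
proof -
  obtain f where f: "x = (f, 0)" "f \<in> lampF" using x by (auto simp: id_part_def)
  show ?thesis
  proof (cases "supp f = {}")
    case True
    then have "s = 0" using x f by (auto simp: id_part_def split: if_splits)
    then have "[] \<in> spans s" by (simp add: spans_def odd_spans_def)
    moreover have "span_rep s [] = f"
      using True by (auto simp: span_rep_def class_lamps_Nil supp_def)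
    moreover have "conj_rel W (f, 0) x" using f W.conj_rel_refl by (simp add: W_carrier)
    ultimately show ?thesis by (intro bexI[of _ "[]"]) (auto simp: span_wt_def)
  next
    case False
    define t where "t = span_sum (supp f)"
    have fin: "finite (supp f)" using f(2) by (rule lampF_finite)
    have st: "s = 0 \<and> even t \<or> s \<noteq> 0 \<and> t mod 4 = s mod 4"
      using x f False by (auto simp: id_part_def t_def split: if_splits)
    \<comment> \<open>For even \<open>t\<close>, the midpoint \<open>t div 2\<close> is moved to \<open>0\<close>, by a translation or a reflection according to its parity.\<close>
    obtain q where q: "(if even q then t + 2 * q else 2 * q - t) = s"
    proof (cases "s = 0")
      case True
      then obtain r where r: "t = 2 * r" using st by (auto elim: evenE)
      show ?thesis
      proof (cases "even r")
        case True
        then show ?thesis using that[of "- r"] r \<open>s = 0\<close> by simp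
      next
        case False
        then show ?thesis using that[of r] r \<open>s = 0\<close> by simp
      qed
    next
      case False
      then have "4 dvd s - t" using st by (metis mod_eq_dvd_iff)
      then obtain r where "s - t = 4 * r" by (auto elim: dvdE)
      then show ?thesis using that[of "2 * r"] by simp
    qed
    define g where "g = (\<lambda>i. f (iact q i))"
    have g: "g \<in> lampF" "lamp_wt g = lamp_wt f" "supp g = act q ` supp f"
      using lampF_comp[OF f(2)] by (simp_all add: g_def lamp_wt_comp supp_comp)
    have fg: "conj_rel W x (g, 0)" unfolding f(1) g_def by (rule conj_shift[OF f(2)]) simp
    have neg: "supp g \<noteq> {}" and fing: "finite (supp g)" using g False fin by auto
    define a where "a = Min (supp g)"
    define b where "b = Max (supp g)"
    have ab: "a \<in> supp g" "b \<in> supp g" using neg fing by (auto simp: a_def b_def)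
    have sub: "supp g \<subseteq> {a..b}" using fing by (auto simp: a_def b_def)
    have "a + b = span_sum (act q ` supp f)" by (simp add: a_def b_def g(3) span_sum_def)
    also have "\<dots> = s" using span_sum_act[OF fin False, of q] q by (cases "even q") (simp_all add: t_def)
    finally have "a + b = s" .
    have "a \<le> b" using ab sub by auto
    define n where "n = nat (b - a + 1)"
    have n: "int n = b - a + 1" "n \<ge> 1" using \<open>a \<le> b\<close> by (auto simp: n_def)
    define xs where "xs = map (\<lambda>k. conj_class G (g (a + int k))) [0..<n]"
    have len: "length xs = n" by (simp add: xs_def)
    have st: "span_start s xs = a" using \<open>a + b = s\<close> n by (simp add: span_start_def len)
    have l: "xs \<in> lists Cls" using conj_class_in_classes[OF g(1)] by (auto simp: xs_def)
    have "hd xs = conj_class G (g a)" using n(2) by (simp add: xs_def hd_map)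
    moreover have "last xs = conj_class G (g b)"
      using n by (simp add: xs_def last_map)
    ultimately have "hd xs \<noteq> {\<one>}" "last xs \<noteq> {\<one>}"
      using ab conj_class_lamp_one_iff[OF g(1)] by simp_all
    moreover have "s + 1 - int (length xs) = 2 * a" using \<open>a + b = s\<close> n len by simp
    moreover have "xs \<noteq> []" using n(2) len by auto
    ultimately have xsS: "xs \<in> spans s" using l by (simp add: spans_iff[OF s])
    have pl: "place {\<one>} a xs = (\<lambda>i. conj_class G (g i))"
      unfolding xs_def
    proof (rule place_window)
      fix i assume "i \<notin> {a..<a + int n}"
      then have "i \<notin> supp g" using sub n by auto
      then show "conj_class G (g i) = {\<one>}" by (simp add: conj_class_lamp_one_iff[OF g(1)])
    qed
    have "base_conj (span_rep s xs) g 0"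
      unfolding span_rep_def st
      by (rule base_conj_0I[OF class_lamps_lampF[OF l] g(1)])
        (simp only: conj_class_class_lamps[OF l] pl)
    then have "conj_rel W (span_rep s xs, 0) x"
      using base_conjD fg W.conj_rel_sym W.conj_rel_trans by blast
    moreover have "span_wt class_len xs \<le> word_length W S x"
    proof -
      obtain l m where lm: "l + m = word_length W S (f, 0)" "cost_bound l m f 0"
        using cost_bound_word[OF f(2)] .
      obtain a' b' where ab': "a' \<in> supp f" "b' \<in> supp f" "a = act q a'" "b = act q b'"
        using ab g(3) by auto
      have "2 * \<bar>b' - a'\<bar> \<le> int m" using lm(2) ab'(1,2) by (simp add: cost_bound_def)
      moreover have "\<bar>b - a\<bar> = \<bar>b' - a'\<bar>" unfolding ab' by (rule abs_act_diff)
      moreover have "int (length xs - 1) = \<bar>b - a\<bar>" using n len by (simp add: of_nat_diff)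
      ultimately have "int (2 * (length xs - 1)) \<le> int m" by simp
      then have 1: "2 * (length xs - 1) \<le> m" by (simp only: of_nat_le_iff)
      have "lwt class_len xs = (\<Sum>k<n. class_len (conj_class G (g (a + int k))))"
        by (simp add: lwt_nth xs_def)
      also have "\<dots> \<le> (\<Sum>k<n. len (g (a + int k)))"
        by (intro sum_mono class_len_le lampF_closed[OF g(1)])
      also have "\<dots> = (\<Sum>i\<in>(\<lambda>k. a + int k) ` {..<n}. len (g i))"
        by (subst sum.reindex) (auto simp: inj_on_def)
      also have "\<dots> \<le> (\<Sum>i\<in>supp g \<union> (\<lambda>k. a + int k) ` {..<n}. len (g i))"
        using fing by (intro sum_mono2) auto
      also have "\<dots> = lamp_wt g"
        using fing by (intro lamp_wt_superset[symmetric]) auto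
      also have "\<dots> \<le> l" using g(2) lm(2) by (simp add: cost_bound_def)
      finally show ?thesis using 1 lm(1) f(1) by (simp add: span_wt_def)
    qed
    ultimately show ?thesis using xsS by blast
  qed
qed

lemma conj_gf_id_part_0: "conj_gf W S (id_part 0) = gf (odd_spans {\<one>} Cls) (span_wt class_len)"
proof -
  have "conj_gf W S (id_part 0) = gf (spans 0) (span_wt class_len)"
  proof (rule W.conj_gf_transversal[where rep = "\<lambda>xs. (span_rep 0 xs, 0)"])
    show "\<exists>d\<in>spans 0. conj_rel W (span_rep 0 d, 0) x \<and> span_wt class_len d \<le> word_length W S x"
      if "x \<in> id_part 0" for x
      using span_rep_exists[OF _ that] by simp
    show "d = e" if "d \<in> spans 0" "e \<in> spans 0" "conj_rel W (span_rep 0 d, 0) (span_rep 0 e, 0)" for d e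
      using conj_span_rep_iff[OF _ that(1,2)] that(3) by simp
  qed (simp_all add: conj_closed_id_part span_rep_in_id_part word_length_span_rep)
  then show ?thesis by (simp add: spans_def)
qed

lemma conj_gf_id_part_odd:
  assumes "s = 1 \<or> s = - 1"
  shows "conj_gf W S (id_part s)
    = gf (even_spans {\<one>} Cls // iterate_rel (even_spans {\<one>} Cls) rev) (qwt (span_wt class_len))"
proof -
  let ?N = "even_spans {\<one>} Cls"
  have N: "?N = spans s" using assms by (auto simp: spans_def)
  have s: "s = 0 \<or> s = 1 \<or> s = - 1" using assms by auto
  have iter: "(rev ^^ k) xs = xs \<or> (rev ^^ k) xs = rev xs" for k and xs :: "'a set list"
    by (induction k) auto
  have R: "(xs, ys) \<in> iterate_rel ?N rev \<longleftrightarrow> xs \<in> ?N \<and> ys \<in> ?N \<and> (ys = xs \<or> ys = rev xs)" for xs ys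
  proof
    assume "xs \<in> ?N \<and> ys \<in> ?N \<and> (ys = xs \<or> ys = rev xs)"
    moreover have "xs = (rev ^^ 0) xs" "rev xs = (rev ^^ 1) xs" by simp_all
    ultimately show "(xs, ys) \<in> iterate_rel ?N rev" unfolding iterate_rel_def by blast
  qed (use iter in \<open>auto simp: iterate_rel_def\<close>)
  show ?thesis
  proof (rule W.conj_gf_quotient[where rep = "\<lambda>xs. (span_rep s xs, 0)"])
    show "conj_closed W (id_part s)" using assms by (intro conj_closed_id_part) auto
    show "(span_rep s d, 0) \<in> id_part s" if "d \<in> ?N" for d
      using span_rep_in_id_part[OF s] that N by simp
    show "\<exists>d\<in>?N. conj_rel W (span_rep s d, 0) x \<and> span_wt class_len d \<le> word_length W S x"
      if "x \<in> id_part s" for x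
      using span_rep_exists[OF s that] N by simp
    show "word_length W S (span_rep s d, 0) \<le> span_wt class_len d" if "d \<in> ?N" for d
      using word_length_span_rep[OF s] that N by simp
    show "iterate_rel ?N rev \<subseteq> ?N \<times> ?N" by (auto simp: iterate_rel_def)
    show "conj_rel W (span_rep s d, 0) (span_rep s e, 0) \<longleftrightarrow> (d, e) \<in> iterate_rel ?N rev"
      if "d \<in> ?N" "e \<in> ?N" for d e
      unfolding R using conj_span_rep_iff[OF s, of d e] that assms unfolding N by auto
    show "span_wt class_len d = span_wt class_len e" if "(d, e) \<in> iterate_rel ?N rev" for d e
      using that by (auto simp: R span_wt_def rev_map[symmetric] sum_list_rev)
  qed
qed

end

section \<open>Summation of the series\<close>

lemma suminf_low_coeffs_zero:
  fixes f :: "nat \<Rightarrow> 'a::ab_group_add fps"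
  assumes "\<And>n k. k < n \<Longrightarrow> fps_nth (f n) k = 0"
  shows "suminf f = Abs_fps (\<lambda>k. \<Sum>n\<le>k. fps_nth (f n) k)"
  by (rule sums_unique[symmetric, OF fps_sums_of_low_coeffs_zero[OF assms]])

lemma sum_gcd_totient:
  fixes h :: "nat \<Rightarrow> rat fps"
  assumes "n > 0"
  shows "(\<Sum>k<n. h (gcd k n)) = (\<Sum>d | d dvd n. of_nat (totient (n div d)) * h d)"
proof -
  have "(\<Sum>k<n. h (gcd k n)) = (\<Sum>k\<in>{0<..n}. h (gcd k n))"
    by (rule sum.reindex_bij_witness[of _ "\<lambda>k. if k = n then 0 else k" "\<lambda>k. if k = 0 then n else k"])
      (use assms in auto)
  also have "\<dots> = (\<Sum>d\<in>{d. d dvd n}. \<Sum>k\<in>{k \<in> {0<..n}. gcd k n = d}. h (gcd k n))"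
    using assms by (intro sum.group[symmetric]) auto
  also have "\<dots> = (\<Sum>d | d dvd n. of_nat (totient (n div d)) * h d)"
  proof (rule sum.cong[OF HOL.refl])
    fix d assume "d \<in> {d. d dvd n}"
    then have "card {k \<in> {0<..n}. gcd k n = d} = totient (n div d)"
      using assms by (intro card_gcd_eq_totient) auto
    then show "(\<Sum>k\<in>{k \<in> {0<..n}. gcd k n = d}. h (gcd k n)) = of_nat (totient (n div d)) * h d"
      by simp
  qed
  finally show ?thesis .
qed

definition necklace_term :: "rat fps \<Rightarrow> nat \<Rightarrow> nat \<Rightarrow> rat fps" where
  "necklace_term \<sigma> r s = fps_const (of_nat (totient r) / of_nat r) *
     (fps_const (1 / of_nat s) * (fps_X ^ (2 * r * s) * (\<sigma> oo fps_X ^ r) ^ (2 * s)))"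

lemma necklace_term_low: "k < 2 * r * s \<Longrightarrow> fps_nth (necklace_term \<sigma> r s) k = 0"
  by (simp add: necklace_term_def fps_X_power_mult_nth)

text \<open>
  Up to the coefficient \<open>N\<close>, only pairs with product at most \<open>Suc N\<close> contribute, and these are the pairs of
  complementary divisors of the numbers up to \<open>Suc N\<close>.
\<close>

lemma sum_divisor_pairs:
  fixes t :: "nat \<Rightarrow> nat \<Rightarrow> 'a::comm_monoid_add"
  assumes "\<And>r s. r * s > Suc N \<Longrightarrow> t r s = 0"
  shows "(\<Sum>n\<le>N. \<Sum>d | d dvd Suc n. t (Suc n div d) d) = (\<Sum>k\<le>N. \<Sum>l\<le>N. t (Suc k) (Suc l))"
proof -
  let ?A = "Sigma {..N} (\<lambda>n. {d. d dvd Suc n})"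
  let ?B = "{(k, l). k \<le> N \<and> l \<le> N \<and> Suc k * Suc l \<le> Suc N}"
  have "(\<Sum>n\<le>N. \<Sum>d | d dvd Suc n. t (Suc n div d) d) = (\<Sum>(n, d)\<in>?A. t (Suc n div d) d)"
    by (rule sum.Sigma) auto
  also have "\<dots> = (\<Sum>(k, l)\<in>?B. t (Suc k) (Suc l))"
  proof (rule sum.reindex_bij_witness[of _ "\<lambda>(k, l). (Suc k * Suc l - 1, Suc l)" "\<lambda>(n, d). (Suc n div d - 1, d - 1)"])
    fix a assume "a \<in> ?A"
    then obtain n d where a: "a = (n, d)" "n \<le> N" "d dvd Suc n" by auto
    then obtain e where e: "Suc n = d * e" by (elim dvdE)
    then have pos: "d > 0" "e > 0" by (auto intro!: Nat.gr0I)
    then have ed: "Suc (e - 1) = e" "Suc (d - 1) = d" "Suc n div d = e" using e by auto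
    show "(case case a of (n, d) \<Rightarrow> (Suc n div d - 1, d - 1) of (k, l) \<Rightarrow> (Suc k * Suc l - 1, Suc l)) = a"
      unfolding a(1) prod.case ed using e by (simp add: mult.commute[of e d] flip: e)
    have "e \<le> d * e" "d \<le> d * e" using pos by simp_all
    then have "e \<le> Suc N" "d \<le> Suc N" using a(2) unfolding e[symmetric] by auto
    then have "e - 1 \<le> N" "d - 1 \<le> N" by simp_all
    moreover have "e * d \<le> Suc N" using e a(2) by (simp add: mult.commute)
    ultimately show "(case a of (n, d) \<Rightarrow> (Suc n div d - 1, d - 1)) \<in> ?B"
      unfolding a(1) prod.case ed by (simp only: mem_Collect_eq prod.case ed)
    show "(case case a of (n, d) \<Rightarrow> (Suc n div d - 1, d - 1) of (k, l) \<Rightarrow> t (Suc k) (Suc l))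
        = (case a of (n, d) \<Rightarrow> t (Suc n div d) d)"
      unfolding a(1) prod.case ed ..
  next
    fix b assume "b \<in> ?B"
    then obtain k l where b: "b = (k, l)" "Suc k * Suc l \<le> Suc N" by auto
    have 1: "Suc (Suc k * Suc l - 1) = Suc k * Suc l" by simp
    have 2: "Suc k * Suc l div Suc l = Suc k" by (rule nonzero_mult_div_cancel_right) simp
    have "Suc k * Suc l - 1 \<le> N" using b(2) by linarith
    moreover have "Suc l dvd Suc k * Suc l" by (rule dvd_triv_right)
    ultimately show "(case b of (k, l) \<Rightarrow> (Suc k * Suc l - 1, Suc l)) \<in> ?A"
      unfolding b(1) prod.case by (simp only: mem_Sigma_iff atMost_iff mem_Collect_eq 1)
    show "(case case b of (k, l) \<Rightarrow> (Suc k * Suc l - 1, Suc l) of (n, d) \<Rightarrow> (Suc n div d - 1, d - 1)) = b"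
      unfolding b(1) prod.case 1 2 by simp
  qed
  also have "\<dots> = (\<Sum>(k, l)\<in>{..N} \<times> {..N}. t (Suc k) (Suc l))"
    by (rule sum.mono_neutral_left)
      (auto simp: not_le intro!: assms simp del: mult_Suc mult_Suc_right)
  also have "\<dots> = (\<Sum>k\<le>N. \<Sum>l\<le>N. t (Suc k) (Suc l))"
    by (rule sum.cartesian_product[symmetric])
  finally show ?thesis .
qed

context gen_group
begin

interpretation W: gen_group W S
  by (rule gen_group_W)

lemma growth_series_eq: "growth_series G Z = gf (carrier G) len"
  by (simp add: growth_series_def gf_def)

lemma conj_growth_series_gf: "conj_growth_series G Z = gf Cls class_len"
  by (simp add: conj_growth_series_def gf_def)

text \<open>
  Orbits of rotations by two places on lists of length \<open>2 * n\<close>. The rotation by \<open>2 * k\<close> has period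
  \<open>2 * gcd k n\<close>, and each divisor \<open>d\<close> of \<open>n\<close> is \<open>gcd k n\<close> for \<open>totient (n div d)\<close> values of \<open>k\<close>.
\<close>

lemma conj_gf_trans_part:
  assumes n: "n > 0"
  shows "conj_gf W S (trans_part n) = (\<Sum>d | d dvd n. necklace_term (growth_series G Z) (n div d) d)"
proof -
  let ?\<sigma> = "growth_series G Z" and ?N = "trans_lists n"
  define Q where "Q = gf (?N // iterate_rel ?N (rotate 2)) (qwt (lwt len))"
  have "qwt (\<lambda>xs. 2 * n + lwt len xs) = (\<lambda>C. qwt (lwt len) C + 2 * n)"
    by (simp add: qwt_def fun_eq_iff)
  then have 1: "conj_gf W S (trans_part n) = fps_X ^ (2 * n) * Q"
    unfolding conj_gf_trans_quotient[OF n] Q_def by (simp add: gf_shift)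
  have rot: "lwt len (rotate 2 xs) = lwt len xs" for xs
  proof -
    have "sum_list (rotate1 zs) = sum_list zs" for zs :: "nat list" by (cases zs) auto
    then show ?thesis by (simp add: numeral_2_eq_2 flip: rotate1_map)
  qed
  have "of_nat n * Q = (\<Sum>k<n. gf {xs \<in> ?N. (rotate 2 ^^ k) xs = xs} (lwt len))"
    unfolding Q_def
    using fin_wt_lists_length[OF fin_wt_word_length, of "2 * n"] rot
    by (intro gf_burnside rotate_trans_lists n rotate_period_trans_lists) (simp_all add: trans_lists_def)
  also have "\<dots> = (\<Sum>k<n. (?\<sigma> oo fps_X ^ (n div gcd k n)) ^ (2 * gcd k n))"
  proof (rule sum.cong[OF HOL.refl])
    fix k
    have "gcd (2 * k) (2 * n) = 2 * gcd k n" by (simp add: gcd_mult_left)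
    then show "gf {xs \<in> ?N. (rotate 2 ^^ k) xs = xs} (lwt len) = (?\<sigma> oo fps_X ^ (n div gcd k n)) ^ (2 * gcd k n)"
      using gf_rotate_fixed[OF fin_wt_word_length, of "2 * n" "2 * k"] n
      by (simp add: trans_lists_def rotate_2_iter growth_series_eq)
  qed
  also have "\<dots> = (\<Sum>d | d dvd n. of_nat (totient (n div d)) * (?\<sigma> oo fps_X ^ (n div d)) ^ (2 * d))"
    by (rule sum_gcd_totient[OF n])
  finally have nQ: "of_nat n * Q = \<dots>" .
  have "Q = fps_const (1 / of_nat n) * (of_nat n * Q)"
    using n by (simp add: fps_of_nat[symmetric] mult.assoc[symmetric])
  then have "fps_X ^ (2 * n) * Q = (\<Sum>d | d dvd n. fps_X ^ (2 * n) * (fps_const (1 / of_nat n) *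
      (of_nat (totient (n div d)) * (?\<sigma> oo fps_X ^ (n div d)) ^ (2 * d))))"
    unfolding nQ by (simp only: sum_distrib_left)
  also have "\<dots> = (\<Sum>d | d dvd n. necklace_term ?\<sigma> (n div d) d)"
  proof (rule sum.cong[OF HOL.refl])
    fix d assume "d \<in> {d. d dvd n}"
    then obtain e where e: "n = d * e" by auto
    then have pos: "d > 0" "e > 0" using n by auto
    have "n div d = e" using e pos by simp
    moreover have "fps_const (1 / of_nat n) * of_nat (totient e)
        = fps_const (of_nat (totient e) / of_nat e) * fps_const (1 / of_nat d :: rat)"
      using pos by (simp add: e fps_of_nat[symmetric])
    moreover have "2 * n = 2 * e * d" using e by simp
    ultimately show "fps_X ^ (2 * n) * (fps_const (1 / of_nat n) *
        (of_nat (totient (n div d)) * (?\<sigma> oo fps_X ^ (n div d)) ^ (2 * d))) = necklace_term ?\<sigma> (n div d) d"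
      unfolding necklace_term_def by (simp add: mult_ac)
  qed
  finally show ?thesis using 1 by simp
qed

lemma conj_gf_translations:
  "conj_gf W S (\<Union>n. trans_part (Suc n)) =
    (\<Sum>k. let r = Suc k in fps_const (of_nat (totient r) / of_nat r) *
      (\<Sum>l. let s = Suc l in
        fps_const (1 / of_nat s) * (fps_X ^ (2 * r * s) * (growth_series G Z oo fps_X ^ r) ^ (2 * s))))"
  (is "_ = suminf ?F")
proof -
  let ?\<sigma> = "growth_series G Z"
  define t where "t N r s = fps_nth (necklace_term ?\<sigma> r s) N" for N r s
  have t0: "t N r s = 0" if "N < 2 * r * s" for N r s
    unfolding t_def using that by (rule necklace_term_low)
  have "(\<lambda>n. conj_gf W S (trans_part (Suc n))) sums conj_gf W S (\<Union>n. trans_part (Suc n))"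
  proof (rule W.conj_gf_UN[where U = "\<lambda>n. trans_part (Suc n)"])
    show "conj_closed W (trans_part (Suc n))" for n by (rule conj_closed_trans_part)
    show "trans_part (Suc m) \<inter> trans_part (Suc n) = {}" if "m \<noteq> n" for m n
      using that by (auto simp: trans_part_def)
    show "n \<le> word_length W S x" if "x \<in> trans_part (Suc n)" for n x
    proof -
      obtain f p where x: "x = (f, p)" "f \<in> lampF" "\<bar>p\<bar> = 2 * int (Suc n)"
        using \<open>x \<in> _\<close> by (auto simp: trans_part_def)
      obtain l m where "l + m = word_length W S (f, p)" "cost_bound l m f p"
        using cost_bound_word[OF x(2)] .
      then show ?thesis using x by (auto simp: cost_bound_def)
    qed
  qed
  then have "conj_gf W S (\<Union>n. trans_part (Suc n)) = (\<Sum>n. conj_gf W S (trans_part (Suc n)))"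
    by (rule sums_unique)
  also have "\<dots> = Abs_fps (\<lambda>N. \<Sum>n\<le>N. fps_nth (conj_gf W S (trans_part (Suc n))) N)"
  proof (rule suminf_low_coeffs_zero)
    fix n N :: nat assume "N < n"
    have "t N (Suc n div d) d = 0" if "d dvd Suc n" for d
      using that \<open>N < n\<close> by (intro t0) (simp add: mult.assoc)
    then show "fps_nth (conj_gf W S (trans_part (Suc n))) N = 0"
      by (simp add: conj_gf_trans_part fps_sum_nth t_def)
  qed
  also have "\<dots> = Abs_fps (\<lambda>N. \<Sum>n\<le>N. \<Sum>d | d dvd Suc n. t N (Suc n div d) d)"
    by (simp add: conj_gf_trans_part fps_sum_nth t_def)
  also have "\<dots> = Abs_fps (\<lambda>N. \<Sum>k\<le>N. \<Sum>l\<le>N. t N (Suc k) (Suc l))"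
  proof -
    have "(\<Sum>n\<le>N. \<Sum>d | d dvd Suc n. t N (Suc n div d) d) = (\<Sum>k\<le>N. \<Sum>l\<le>N. t N (Suc k) (Suc l))" for N
      by (rule sum_divisor_pairs) (simp add: t0)
    then show ?thesis by simp
  qed
  also have "\<dots> = suminf ?F"
  proof -
    have F: "?F k = Abs_fps (\<lambda>N. \<Sum>l\<le>N. t N (Suc k) (Suc l))" for k
    proof -
      let ?g = "\<lambda>l. fps_const (1 / of_nat (Suc l)) *
        (fps_X ^ (2 * Suc k * Suc l) * (?\<sigma> oo fps_X ^ Suc k) ^ (2 * Suc l))"
      let ?c = "of_nat (totient (Suc k)) / of_nat (Suc k) :: rat"
      have tg: "t N (Suc k) (Suc l) = ?c * fps_nth (?g l) N" for N l
        unfolding t_def necklace_term_def by (simp only: fps_mult_left_const_nth)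
      have "suminf ?g = Abs_fps (\<lambda>N. \<Sum>l\<le>N. fps_nth (?g l) N)"
      proof (rule suminf_low_coeffs_zero)
        fix l N :: nat assume "N < l"
        also have "l \<le> 2 * Suc k * Suc l" by simp
        finally have "N < 2 * Suc k * Suc l" .
        then show "fps_nth (?g l) N = 0"
          by (simp only: fps_mult_left_const_nth fps_X_power_mult_nth if_True mult_zero_right)
      qed
      then have "?F k = fps_const ?c * Abs_fps (\<lambda>N. \<Sum>l\<le>N. fps_nth (?g l) N)"
        by (simp only: Let_def)
      also have "\<dots> = Abs_fps (\<lambda>N. \<Sum>l\<le>N. t N (Suc k) (Suc l))"
        by (rule fps_ext) (simp only: fps_mult_left_const_nth fps_nth_Abs_fps sum_distrib_left tg)
      finally show ?thesis .
    qed
    have "suminf ?F = Abs_fps (\<lambda>N. \<Sum>k\<le>N. fps_nth (?F k) N)"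
    proof (rule suminf_low_coeffs_zero)
      fix k N :: nat assume "N < k"
      then have "t N (Suc k) (Suc l) = 0" for l by (intro t0) simp
      then show "fps_nth (?F k) N = 0" unfolding F by simp
    qed
    then show ?thesis unfolding F by simp
  qed
  finally show ?thesis .
qed

lemma carrier_W_partition:
  "carrier W = id_part 0 \<union> (id_part 1 \<union> (id_part (- 1) \<union>
    (refl_part 1 \<union> (refl_part (- 1) \<union> (\<Union>n. trans_part (Suc n))))))"
proof (rule equalityI; rule subsetI)
  fix x assume "x \<in> carrier W"
  then obtain f p where x: "x = (f, p)" "f \<in> lampF" by (auto simp: W_carrier)
  show "x \<in> id_part 0 \<union> (id_part 1 \<union> (id_part (- 1) \<union>
      (refl_part 1 \<union> (refl_part (- 1) \<union> (\<Union>n. trans_part (Suc n))))))"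
  proof (cases "p = 0")
    case True
    have "even (span_sum (supp f)) \<or> span_sum (supp f) mod 4 = 1 \<or> span_sum (supp f) mod 4 = - 1 mod 4"
      by presburger
    then show ?thesis using True x by (auto simp: id_part_def)
  next
    case False
    show ?thesis
    proof (cases "even p")
      case True
      then have "\<bar>p\<bar> = 2 * int (Suc (nat (\<bar>p\<bar> div 2) - 1))" using False by (auto elim!: evenE)
      then have "x \<in> trans_part (Suc (nat (\<bar>p\<bar> div 2) - 1))" using x by (simp add: trans_part_def)
      then show ?thesis by blast
    next
      case False
      then have "p mod 4 = 1 \<or> p mod 4 = - 1 mod 4" by presburger
      then show ?thesis using x by (auto simp: refl_part_def)
    qed
  qed
qed (auto simp: id_part_def refl_part_def trans_part_def W_carrier)

lemma conj_gf_W: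
  "conj_growth_series W S = conj_gf W S (id_part 0) + (conj_gf W S (id_part 1) + (conj_gf W S (id_part (- 1)) +
    (conj_gf W S (refl_part 1) + (conj_gf W S (refl_part (- 1)) + conj_gf W S (\<Union>n. trans_part (Suc n))))))"
proof -
  let ?T = "\<Union>n. trans_part (Suc n)"
  note Un = W.conj_gf_Un
  have cU: "conj_closed W (A \<union> B)" if "conj_closed W A" "conj_closed W B" for A B
    using that unfolding conj_closed_def by blast
  have cT: "conj_closed W ?T"
    unfolding conj_closed_def
  proof (intro conjI ballI allI impI)
    show "?T \<subseteq> carrier W" by (auto simp: trans_part_def W_carrier)
    fix x y assume "x \<in> ?T" "conj_rel W x y"
    then show "y \<in> ?T" using conj_closedD[OF conj_closed_trans_part] by blast
  qed
  have c: "conj_closed W (id_part 0)" "conj_closed W (id_part 1)" "conj_closed W (id_part (- 1))"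
    "conj_closed W (refl_part 1)" "conj_closed W (refl_part (- 1))"
    by (simp_all add: conj_closed_id_part conj_closed_refl_part)
  have sub: "refl_part 1 \<subseteq> {x. snd x mod 4 = 1}" "refl_part (- 1) \<subseteq> {x. snd x mod 4 = 3}"
    "id_part s \<subseteq> {x. snd x = 0}" for s
    by (auto simp: refl_part_def id_part_def)
  have subT: "?T \<subseteq> {x. even (snd x) \<and> snd x \<noteq> 0}"
  proof
    fix x assume "x \<in> ?T"
    then obtain n where "\<bar>snd x\<bar> = 2 * int (Suc n)" by (auto simp: trans_part_def)
    moreover from this have "even (snd x)" by presburger
    ultimately show "x \<in> {x. even (snd x) \<and> snd x \<noteq> 0}" by auto
  qed
  have o1: "odd k" if "k mod 4 = 1" for k :: int
    using that by presburger
  have o3: "odd k" if "k mod 4 = 3" for k :: int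
    using that by presburger
  have "{x :: (int \<Rightarrow> 'a) \<times> int. snd x mod 4 = 3} \<inter> {x. even (snd x) \<and> snd x \<noteq> 0} = {}"
    "{x :: (int \<Rightarrow> 'a) \<times> int. snd x mod 4 = 1} \<inter> ({x. snd x mod 4 = 3} \<union> {x. even (snd x) \<and> snd x \<noteq> 0}) = {}"
    by (auto dest: o1 o3)
  note disj = this
  have d5: "refl_part (- 1) \<inter> ?T = {}" using sub(2) subT disj(1) by blast
  have d4: "refl_part 1 \<inter> (refl_part (- 1) \<union> ?T) = {}" using sub(1,2) subT disj(2) by blast
  have "{x :: (int \<Rightarrow> 'a) \<times> int. snd x = 0} \<inter> ({x. snd x mod 4 = 1} \<union> ({x. snd x mod 4 = 3} \<union>
      {x. even (snd x) \<and> snd x \<noteq> 0})) = {}" by auto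
  then have d3: "id_part s \<inter> (refl_part 1 \<union> (refl_part (- 1) \<union> ?T)) = {}" for s
    using sub subT by blast
  have "id_part 1 \<inter> id_part (- 1) = {}" by (auto simp: id_part_def)
  with d3 have d2: "id_part 1 \<inter> (id_part (- 1) \<union> (refl_part 1 \<union> (refl_part (- 1) \<union> ?T))) = {}" by blast
  have "id_part 0 \<inter> id_part 1 = {}" "id_part 0 \<inter> id_part (- 1) = {}"
    by (auto simp: id_part_def dest: o1 o3)
  with d3 have d1: "id_part 0 \<inter> (id_part 1 \<union> (id_part (- 1) \<union> (refl_part 1 \<union> (refl_part (- 1) \<union> ?T)))) = {}"
    by blast
  note u5 = cU[OF c(5) cT]
  note u4 = cU[OF c(4) u5]
  note u3 = cU[OF c(3) u4]
  note u2 = cU[OF c(2) u3]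
  show ?thesis
    unfolding W.conj_growth_series_eq carrier_W_partition
      Un[OF c(1) u2 d1] Un[OF c(2) u3 d2] Un[OF c(3) u4 d3] Un[OF c(4) u5 d4] Un[OF c(5) cT d5] ..
qed

lemma conj_growth_series_W:
  fixes z \<sigma> \<tau> :: "rat fps"
  defines "z \<equiv> fps_X" and "\<sigma> \<equiv> growth_series G Z" and "\<tau> \<equiv> conj_growth_series G Z"
  shows "conj_growth_series W S =
    (\<Sum>k. let r = Suc k in fps_const (of_nat (totient r) / of_nat r) *
      (\<Sum>l. let s = Suc l in
        fps_const (1 / of_nat s) * (z ^ (2 * r * s) * (\<sigma> oo z ^ r) ^ (2 * s))))
    + 2 * z * \<tau> * ((1 - z ^ 2) / (1 - z ^ 2 * \<tau>))
    + \<tau>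
    + z ^ 2 * (1 + z ^ 2 * \<tau>) * ((\<tau> - 1) ^ 2 / (1 - z ^ 4 * \<tau> ^ 2))
    + z ^ 2 * (((\<tau> oo z ^ 2) - 1) / (1 - z ^ 4 * (\<tau> oo z ^ 2)))"
proof -
  interpret wc: weighted_set Cls class_len "{\<one>}" by (rule weighted_classes)
  have T: "gf Cls class_len = \<tau>" by (simp add: \<tau>_def conj_growth_series_gf)
  define Q where "Q = gf (even_spans {\<one>} Cls // iterate_rel (even_spans {\<one>} Cls) rev) (qwt (span_wt class_len))"
  have id: "conj_gf W S (id_part 0) = \<tau> + z ^ 4 * \<tau> * (\<tau> - 1) ^ 2 * inverse (1 - z ^ 4 * \<tau> ^ 2)"
    by (simp only: conj_gf_id_part_0 wc.gf_odd_spans T z_def)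
  have Q: "conj_gf W S (id_part 1) = Q" "conj_gf W S (id_part (- 1)) = Q"
    by (simp_all add: conj_gf_id_part_odd Q_def)
  have Q2: "2 * Q = z ^ 2 * (\<tau> - 1) ^ 2 * inverse (1 - z ^ 4 * \<tau> ^ 2)
      + z ^ 2 * ((\<tau> oo z ^ 2) - 1) * inverse (1 - z ^ 4 * (\<tau> oo z ^ 2))"
    by (simp only: Q_def wc.gf_reversal_classes T z_def)
  have R: "conj_gf W S (refl_part 1) = z * \<tau> * ((1 - z ^ 2) / (1 - z ^ 2 * \<tau>))"
    "conj_gf W S (refl_part (- 1)) = z * \<tau> * ((1 - z ^ 2) / (1 - z ^ 2 * \<tau>))"
    by (simp_all only: conj_gf_refl_part wc.gf_rays T z_def simp_thms)
  have i1: "(\<tau> - 1) ^ 2 / (1 - z ^ 4 * \<tau> ^ 2) = (\<tau> - 1) ^ 2 * inverse (1 - z ^ 4 * \<tau> ^ 2)"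
    by (rule fps_divide_unit) (simp add: z_def power4_eq_xxxx mult.assoc)
  have i2: "((\<tau> oo z ^ 2) - 1) / (1 - z ^ 4 * (\<tau> oo z ^ 2)) = ((\<tau> oo z ^ 2) - 1) * inverse (1 - z ^ 4 * (\<tau> oo z ^ 2))"
    by (rule fps_divide_unit) (simp add: z_def power4_eq_xxxx mult.assoc)
  have "conj_growth_series W S = conj_gf W S (\<Union>n. trans_part (Suc n))
      + 2 * (z * \<tau> * ((1 - z ^ 2) / (1 - z ^ 2 * \<tau>)))
      + \<tau> + z ^ 4 * \<tau> * (\<tau> - 1) ^ 2 * inverse (1 - z ^ 4 * \<tau> ^ 2) + 2 * Q"
    unfolding conj_gf_W id Q R by (simp only: mult_2 add_ac)
  also have "\<dots> = conj_gf W S (\<Union>n. trans_part (Suc n))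
      + 2 * z * \<tau> * ((1 - z ^ 2) / (1 - z ^ 2 * \<tau>)) + \<tau>
      + z ^ 2 * (1 + z ^ 2 * \<tau>) * ((\<tau> - 1) ^ 2 / (1 - z ^ 4 * \<tau> ^ 2))
      + z ^ 2 * (((\<tau> oo z ^ 2) - 1) / (1 - z ^ 4 * (\<tau> oo z ^ 2)))"
  proof -
    have z4: "z ^ 4 = z ^ 2 * z ^ 2" by (simp flip: power_add)
    show ?thesis unfolding Q2 i1 i2
      by (subst (1) z4) (simp only: distrib_left distrib_right mult_1_right mult_1_left mult_ac add_ac)
  qed
  finally show ?thesis by (simp only: conj_gf_translations z_def \<sigma>_def)
qed

end

theorem mainTheorem8:
  fixes G :: "('g, 'm) monoid_scheme" and Y :: "'g set"
  assumes "group G" and "fin_sym_gen_set G Y"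
  shows
    "let L = c2_free_c2; X = c2_free_c2_gens; z = fps_X :: rat fps;
         \<sigma> = growth_series G Y; \<tau> = conj_growth_series G Y
     in conj_growth_series (wreath G L) (wreath_gens G L Y X) =
          (\<Sum>k. let r = Suc k in fps_const (of_nat (totient r) / of_nat r) *
            (\<Sum>l. let s = Suc l in
              fps_const (1 / of_nat s) * (z ^ (2 * r * s) * (\<sigma> oo z ^ r) ^ (2 * s))))
          + 2 * z * \<tau> * ((1 - z ^ 2) / (1 - z ^ 2 * \<tau>))
          + \<tau>
          + z ^ 2 * (1 + z ^ 2 * \<tau>) * ((\<tau> - 1) ^ 2 / (1 - z ^ 4 * \<tau> ^ 2))
          + z ^ 2 * (((\<tau> oo z ^ 2) - 1) / (1 - z ^ 4 * (\<tau> oo z ^ 2)))"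
proof -
  interpret gen_group G Y by (rule gen_groupI_fin_sym_gen_set[OF assms])
  have "conj_growth_series (wreath G c2_free_c2) (wreath_gens G c2_free_c2 Y c2_free_c2_gens)
      = conj_growth_series W S"
    unfolding W_def S_def by (rule conj_growth_series_wreath_dih[OF assms(1) gens_closed])
  then show ?thesis unfolding conj_growth_series_W by (simp only: Let_def)
qed

end
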